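(* Let $m,s\ge 1$ and $t_1,\dots,t_m\ge 1$ be integers. For each $p=1,\dots,m$ let $A^p=(A^p_{ij})_{i,j=1}^s\in M_s(M_{t_p})$ be a positive semidefinite $st_p\times st_p$ complex matrix partitioned into $t_p\times t_p$ blocks $A^p_{ij}$. Put $\sigma_p=t_p^{-1}\prod_{q=1}^m t_q$. Then $$\Bigl|\bigodot_{p=1}^m A^p\Bigr|\ \ge\ \prod_{p=1}^m\prod_{i=1}^s|A^p_{ii}|^{\sigma_p}-\prod_{p=1}^m\Bigl\{\prod_{i=1}^s|A^p_{ii}|^{\sigma_p}-|A^p|^{\sigma_p}\Bigr\}.$$ Moreover, if every $A^p$ is positive definite, equality holds if and only if one of the following holds: (a) $m=1$ or $s=1$; (b) there is $p$ such that $A^p$ is block diagonal (i.e. $A^p_{ij}=0$ for all $i\ne j$); (c) $t_p=1$ for every $p$ (so $A^p\in M_s$), and there exist indices $i\neq j$ in $\{1,\dots,s\}$ (the same for all $p$) such that for every $p$ all entries of $A^p$ vanish except the diagonal entries and the $(i,j)$ and $(j,i)$ entries.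
   Context: $|X|$ denotes the determinant of a square matrix $X$. For block matrices $A^p=(A^p_{ij})_{i,j=1}^s$, $p=1,\dots,m$, the Hadamard (Khatri–Rao) product is the block matrix $\bigodot_{p=1}^mA^p=(A^1_{ij}\otimes\cdots\otimes A^m_{ij})_{i,j=1}^s$, where $\otimes$ is the Kronecker product; here it is a square matrix of size $s\prod_q t_q$. *)

theory Defs
  imports "Jordan_Normal_Form.Matrix" "Jordan_Normal_Form.Determinant" "Jordan_Normal_Form.Conjugate"
begin

definition hermitian_mat :: "complex mat \<Rightarrow> bool" where
  "hermitian_mat A \<longleftrightarrow> (\<forall>i<dim_row A. \<forall>j<dim_row A. A $$ (i,j) = cnj (A $$ (j,i)))"

definition psd_mat :: "nat \<Rightarrow> complex mat \<Rightarrow> bool" where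
  "psd_mat n A \<longleftrightarrow> A \<in> carrier_mat n n \<and> hermitian_mat A \<and>
     (\<forall>v \<in> carrier_vec n. 0 \<le> Re (conjugate v \<bullet> (A *\<^sub>v v)))"

definition pd_mat :: "nat \<Rightarrow> complex mat \<Rightarrow> bool" where
  "pd_mat n A \<longleftrightarrow> A \<in> carrier_mat n n \<and> hermitian_mat A \<and>
     (\<forall>v \<in> carrier_vec n. v \<noteq> 0\<^sub>v n \<longrightarrow> 0 < Re (conjugate v \<bullet> (A *\<^sub>v v)))"

definition blk :: "complex mat \<Rightarrow> nat \<Rightarrow> nat \<Rightarrow> nat \<Rightarrow> complex mat" where
  "blk A t i j = mat t t (\<lambda>(a,b). A $$ (i*t + a, j*t + b))"

definition kron :: "complex mat \<Rightarrow> complex mat \<Rightarrow> complex mat" where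
  "kron A B = mat (dim_row A * dim_row B) (dim_col A * dim_col B)
     (\<lambda>(i,j). A $$ (i div dim_row B, j div dim_col B) * B $$ (i mod dim_row B, j mod dim_col B))"

definition kron_list :: "complex mat list \<Rightarrow> complex mat" where
  "kron_list Ms = foldr kron Ms (1\<^sub>m 1)"

text \<open>Block Hadamard (Khatri--Rao) product of A 0, ..., A (m-1), each an
  (s * t p) x (s * t p) matrix with t p x t p blocks: the (i,j) block of the result is
  A 0_ij \<otimes> ... \<otimes> A (m-1)_ij.\<close>
definition khatri_rao :: "nat \<Rightarrow> nat \<Rightarrow> (nat \<Rightarrow> nat) \<Rightarrow> (nat \<Rightarrow> complex mat) \<Rightarrow> complex mat" where
  "khatri_rao m s t A = (let T = (\<Prod>q<m. t q) in
     mat (s*T) (s*T) (\<lambda>(x,y).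
       kron_list (map (\<lambda>p. blk (A p) (t p) (x div T) (y div T)) [0..<m]) $$ (x mod T, y mod T)))"

end

theory Submission
  imports Defs "Jordan_Normal_Form.Schur_Decomposition"
begin

text \<open>
  The determinant of a positive definite block matrix \<open>A\<close> is the product of the determinants of successive
  Schur complements. Split off the first block: \<open>A\<^sub>1\<^sub>1 = \<alpha> + \<beta>\<close> with
  \<open>\<beta> = A\<^sub>1\<^sub>2 A\<^sub>2\<^sub>2\<^sup>-\<^sup>1 A\<^sub>2\<^sub>1\<close>. Replacing each \<open>A\<^sub>1\<^sub>1\<close> by \<open>\<beta>\<close> keeps all factors, hence their
  Khatri--Rao product, positive semidefinite. So the Schur complement of the Khatri--Rao product dominates
  \<open>\<Otimes>A\<^sub>1\<^sub>1 - \<Otimes>\<beta>\<close>, whose determinant is \<open>|\<Otimes>A\<^sub>1\<^sub>1|\<close> times the product of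
  \<open>1 - \<Prod>\<^sub>p (1 - \<lambda>\<^sub>p)\<close> over all choices of eigenvalues \<open>\<lambda>\<^sub>p \<in> (0,1]\<close> of \<open>A\<^sub>1\<^sub>1\<^sup>-\<^sup>1 \<alpha>\<close>.
  These products are combined, first over the eigenvalues and then over the blocks, by
  \<open>\<Prod>\<^sub>j (1 - \<Prod>\<^sub>p (1 - x\<^sub>p\<^sub>j)) \<ge> 1 - \<Prod>\<^sub>p (1 - \<Prod>\<^sub>j x\<^sub>p\<^sub>j)\<close>, which compares the
  probabilities of two nested events. For \<open>m \<ge> 2\<close> equality in it leaves at most one nontrivial column unless
  some row is constantly 1, which yields the equality cases. Semidefinite matrices are limits of definite ones.
\<close>

text \<open>The exponent sigma_p is the number of rows of a Kronecker product that share a given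
  index in factor p. \<open>A\<^sub>1\<^sub>1\<^sup>-\<^sup>1 \<alpha>\<close> is in general not
  Hermitian and is only brought to triangular form; this suffices because Kronecker products of
  upper triangular matrices are upper triangular. Each peeled block can lose in three places: when
  the Schur complement is replaced by the tensor difference, when the eigenvalues are combined, and
  when the new block is combined with the rest. Equality forces all three losses to vanish and the
  remainder to attain its own bound. The hard case is the one in which all remainders are block
  diagonal but no first block decouples. Absence of the second loss then forces t_p = 1. That the
  nonzero entries sit at the same position in every factor cannot be seen from the determinants of
  single factors; it comes from absence of the first loss, by evaluating a null vector of the
  Khatri--Rao product with replaced blocks.\<close>

subsection \<open>Determinants of matrices given by functions\<close>

text \<open>A matrix is a function on index pairs together with an explicit size; entries outside
  that range are irrelevant. Principal submatrices and reindexings then need no carriers.\<close>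

type_synonym cfun = "nat \<Rightarrow> nat \<Rightarrow> complex"

definition fmat :: "nat \<Rightarrow> cfun \<Rightarrow> complex mat" where
  "fmat n M = mat n n (\<lambda>(i,j). M i j)"

definition fdet :: "nat \<Rightarrow> cfun \<Rightarrow> complex" where
  "fdet n M = det (fmat n M)"

definition fmult :: "nat \<Rightarrow> cfun \<Rightarrow> cfun \<Rightarrow> cfun" where
  "fmult n M N i j = (\<Sum>k<n. M i k * N k j)"

definition fone :: cfun where
  "fone i j = (if i = j then 1 else 0)"

definition feq :: "nat \<Rightarrow> cfun \<Rightarrow> cfun \<Rightarrow> bool" where
  "feq n M N \<longleftrightarrow> (\<forall>i<n. \<forall>j<n. M i j = N i j)"

definition finverse :: "nat \<Rightarrow> cfun \<Rightarrow> cfun \<Rightarrow> bool" where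
  "finverse n M N \<longleftrightarrow> feq n (fmult n M N) fone \<and> feq n (fmult n N M) fone"

definition fupper :: "nat \<Rightarrow> cfun \<Rightarrow> bool" where
  "fupper n M \<longleftrightarrow> (\<forall>i<n. \<forall>j<i. M i j = 0)"

lemma fmat_carrier [simp]: "fmat n M \<in> carrier_mat n n"
  by (simp add: fmat_def)

lemma fmat_index [simp]: "i < n \<Longrightarrow> j < n \<Longrightarrow> fmat n M $$ (i,j) = M i j"
  by (simp add: fmat_def)

lemma fmat_dim [simp]: "dim_row (fmat n M) = n" "dim_col (fmat n M) = n"
  by (simp_all add: fmat_def)

lemma fmat_of_mat: "A \<in> carrier_mat n n \<Longrightarrow> fmat n (\<lambda>i j. A $$ (i,j)) = A"
  by (rule eq_matI) auto

lemma fmat_cong: "(\<And>i j. i < n \<Longrightarrow> j < n \<Longrightarrow> M i j = N i j) \<Longrightarrow> fmat n M = fmat n N"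
  by (rule eq_matI) auto

lemma fdet_cong: "(\<And>i j. i < n \<Longrightarrow> j < n \<Longrightarrow> M i j = N i j) \<Longrightarrow> fdet n M = fdet n N"
  unfolding fdet_def using fmat_cong[of n M N] by simp

lemma fmat_mult: "fmat n M * fmat n N = fmat n (fmult n M N)"
  by (rule eq_matI) (auto simp: fmult_def scalar_prod_def lessThan_atLeast0)

lemma fmat_one: "fmat n fone = 1\<^sub>m n"
  by (rule eq_matI) (auto simp: fone_def)

lemma fdet_mult: "fdet n (fmult n M N) = fdet n M * fdet n N"
  unfolding fdet_def fmat_mult[symmetric] by (rule det_mult) auto

lemma fdet_one: "fdet n fone = 1"
  by (simp add: fdet_def fmat_one)

lemma fdet_leibniz:
  "fdet n M = (\<Sum>\<pi> | \<pi> permutes {0..<n}. signof \<pi> * (\<Prod>i=0..<n. M i (\<pi> i)))"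
  unfolding fdet_def det_def'[OF fmat_carrier]
proof (intro sum.cong refl arg_cong2[where f="(*)"] prod.cong)
  fix \<pi> i assume "\<pi> \<in> {\<pi>. \<pi> permutes {0..<n}}" "i \<in> {0..<n}"
  then have "i < n" "\<pi> i < n" using permutes_in_image[of \<pi> "{0..<n}" i] by auto
  then show "fmat n M $$ (i, \<pi> i) = M i (\<pi> i)" by simp
qed

lemma fdet_upper_triangular:
  assumes "\<And>i j. j < i \<Longrightarrow> i < n \<Longrightarrow> M i j = 0"
  shows "fdet n M = (\<Prod>i<n. M i i)"
proof -
  have "upper_triangular (fmat n M)" using assms by (intro upper_triangularI) simp
  then have "fdet n M = prod_list (diag_mat (fmat n M))"
    unfolding fdet_def by (rule det_upper_triangular[OF _ fmat_carrier])
  also have "\<dots> = (\<Prod>i<n. M i i)"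
    by (simp add: diag_mat_def prod.list_conv_set_nth lessThan_atLeast0)
  finally show ?thesis .
qed

lemma fdet_block_upper:
  assumes "\<And>i j. i < n \<Longrightarrow> j < t \<Longrightarrow> M (t + i) j = 0"
  shows "fdet (t + n) M = fdet t M * fdet n (\<lambda>i j. M (t + i) (t + j))"
proof -
  have eq: "fmat (t + n) M = four_block_mat (fmat t M) (mat t n (\<lambda>(i,j). M i (t + j)))
      (0\<^sub>m n t) (fmat n (\<lambda>i j. M (t + i) (t + j)))" (is "?L = ?R")
  proof (rule eq_matI)
    fix i j assume "i < dim_row ?R" "j < dim_col ?R"
    then have ij: "i < t + n" "j < t + n" by auto
    have "M i j = 0" if "\<not> i < t" "j < t"
      using assms[of "i - t" j] that ij by simp
    then show "?L $$ (i,j) = ?R $$ (i,j)" using ij by auto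
  qed auto
  show ?thesis unfolding fdet_def eq
    by (rule det_four_block_mat_lower_left_zero) auto
qed

lemma fdet_block_lower:
  assumes "\<And>i j. i < t \<Longrightarrow> j < n \<Longrightarrow> M i (t + j) = 0"
  shows "fdet (t + n) M = fdet t M * fdet n (\<lambda>i j. M (t + i) (t + j))"
proof -
  have eq: "fmat (t + n) M = four_block_mat (fmat t M) (0\<^sub>m t n)
      (mat n t (\<lambda>(i,j). M (t + i) j)) (fmat n (\<lambda>i j. M (t + i) (t + j)))" (is "?L = ?R")
  proof (rule eq_matI)
    fix i j assume "i < dim_row ?R" "j < dim_col ?R"
    then have ij: "i < t + n" "j < t + n" by auto
    have "M i j = 0" if "i < t" "\<not> j < t"
      using assms[of i "j - t"] that ij by simp
    then show "?L $$ (i,j) = ?R $$ (i,j)" using ij by auto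
  qed auto
  show ?thesis unfolding fdet_def eq
    by (rule det_four_block_mat_upper_right_zero) auto
qed

lemma fdet_zero_imp_kernel:
  assumes "fdet n M = 0"
  obtains v where "\<exists>i<n. v i \<noteq> 0" "\<And>i. i < n \<Longrightarrow> (\<Sum>j<n. M i j * v j) = 0"
proof -
  from assms obtain v where v: "v \<in> carrier_vec n" "v \<noteq> 0\<^sub>v n" "fmat n M *\<^sub>v v = 0\<^sub>v n"
    unfolding fdet_def det_0_iff_vec_prod_zero_field[OF fmat_carrier] by blast
  have 1: "\<exists>i<n. v $ i \<noteq> 0"
  proof (rule ccontr)
    assume "\<not> ?thesis"
    then have "v = 0\<^sub>v n" using v(1) by (intro eq_vecI) auto
    with v(2) show False by simp
  qed
  have 2: "(\<Sum>j<n. M i j * v $ j) = 0" if "i < n" for i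
  proof -
    have "(fmat n M *\<^sub>v v) $ i = 0" using v(3) that by simp
    then show ?thesis using that v(1) by (simp add: scalar_prod_def lessThan_atLeast0)
  qed
  show thesis using that[OF 1 2] by blast
qed

lemma feq_iff_fmat: "feq n M N \<longleftrightarrow> fmat n M = fmat n N"
  unfolding feq_def using fmat_cong[of n M N] fmat_index by metis

lemma fdet_nonzero_imp_inverse:
  assumes "fdet n M \<noteq> 0"
  shows "\<exists>N. finverse n M N"
proof -
  from det_non_zero_imp_unit[OF fmat_carrier, of n M "()"] assms
  obtain B where B: "B \<in> carrier_mat n n" "B * fmat n M = 1\<^sub>m n" "fmat n M * B = 1\<^sub>m n"
    unfolding fdet_def Units_def ring_mat_def by auto
  have "B = fmat n (\<lambda>i j. B $$ (i,j))" using fmat_of_mat[OF B(1)] by simp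
  then obtain N where "B = fmat n N" by blast
  then have "finverse n M N"
    using B(2,3) by (simp add: finverse_def feq_iff_fmat fmat_mult fmat_one)
  then show ?thesis by blast
qed

text \<open>Schur's triangularization, kept only as a similarity. It stands in for diagonalization
  throughout, since triangular form survives Kronecker products and requires no normality.\<close>

lemma triangularization:
  "\<exists>P U Q. finverse n P Q \<and> feq n M (fmult n P (fmult n U Q)) \<and> fupper n U"
proof -
  from char_poly_factorized[OF fmat_carrier, of n M] schur_decomposition_exists[OF fmat_carrier, of n M]
  obtain B where B: "B \<in> carrier_mat n n" "upper_triangular B" "similar_mat (fmat n M) B"
    by blast
  from B(3) obtain P Q where "similar_mat_wit (fmat n M) B P Q"
    unfolding similar_mat_def by blast
  note w = similar_mat_witD2[OF fmat_carrier this]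
  define P' U' Q' where "P' = (\<lambda>i j. P $$ (i,j))" and "U' = (\<lambda>i j. B $$ (i,j))"
    and "Q' = (\<lambda>i j. Q $$ (i,j))"
  have eqs: "P = fmat n P'" "B = fmat n U'" "Q = fmat n Q'"
    using fmat_of_mat w(5-7) by (simp_all add: P'_def U'_def Q'_def)
  have "finverse n P' Q'"
    using w(1,2) unfolding eqs by (simp add: finverse_def feq_iff_fmat fmat_mult fmat_one)
  moreover have "fmat n M = fmat n P' * (fmat n U' * fmat n Q')"
    using w(3) unfolding eqs assoc_mult_mat[OF fmat_carrier fmat_carrier fmat_carrier] .
  then have "feq n M (fmult n P' (fmult n U' Q'))" by (simp only: fmat_mult feq_iff_fmat)
  moreover have "fupper n U'"
    using upper_triangularD[OF B(2)] B(1) by (auto simp: U'_def fupper_def)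
  ultimately show ?thesis by blast
qed

lemma sum_lessThan_add:
  fixes f :: "nat \<Rightarrow> 'a::comm_monoid_add"
  shows "(\<Sum>i<t + n. f i) = (\<Sum>i<t. f i) + (\<Sum>i<n. f (t + i))"
  by (induction n) (simp_all add: add.assoc)

lemma fmult_assoc: "fmult n (fmult k A B) C i j = fmult k A (fmult n B C) i j"
  unfolding fmult_def sum_distrib_left sum_distrib_right
  by (subst sum.swap) (simp add: mult.assoc)

lemma fmult_cong:
  "\<lbrakk>\<And>k. k < n \<Longrightarrow> A i k = A' i k; \<And>k. k < n \<Longrightarrow> B k j = B' k j\<rbrakk> \<Longrightarrow> fmult n A B i j = fmult n A' B' i j"
  unfolding fmult_def by (intro sum.cong) auto

lemma fmult_fone_left: "i < n \<Longrightarrow> fmult n fone A i j = A i j"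
  by (simp add: fmult_def fone_def if_distrib[of "\<lambda>x. x * _"] cong: if_cong)

lemma fmult_fone_right: "j < n \<Longrightarrow> fmult n A fone i j = A i j"
  by (simp add: fmult_def fone_def if_distrib[of "\<lambda>x. _ * x"] cong: if_cong)

subsection \<open>Hermitian forms and Schur complements\<close>

definition fvec :: "nat \<Rightarrow> cfun \<Rightarrow> (nat \<Rightarrow> complex) \<Rightarrow> nat \<Rightarrow> complex" where
  "fvec n M y i = (\<Sum>j<n. M i j * y j)"

definition sform :: "nat \<Rightarrow> cfun \<Rightarrow> (nat \<Rightarrow> complex) \<Rightarrow> (nat \<Rightarrow> complex) \<Rightarrow> complex" where
  "sform n M x y = (\<Sum>i<n. \<Sum>j<n. cnj (x i) * M i j * y j)"

definition fherm :: "nat \<Rightarrow> cfun \<Rightarrow> bool" where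
  "fherm n M \<longleftrightarrow> (\<forall>i<n. \<forall>j<n. M i j = cnj (M j i))"

definition fpsd :: "nat \<Rightarrow> cfun \<Rightarrow> bool" where
  "fpsd n M \<longleftrightarrow> fherm n M \<and> (\<forall>v. 0 \<le> Re (sform n M v v))"

definition fpd :: "nat \<Rightarrow> cfun \<Rightarrow> bool" where
  "fpd n M \<longleftrightarrow> fherm n M \<and> (\<forall>v. (\<exists>i<n. v i \<noteq> 0) \<longrightarrow> 0 < Re (sform n M v v))"

lemma fvec_fmult: "fvec n (fmult k A B) y = fvec k A (fvec n B y)"
proof
  show "fvec n (fmult k A B) y i = fvec k A (fvec n B y) i" for i
    unfolding fmult_def fvec_def sum_distrib_left sum_distrib_right
    by (subst sum.swap) (simp add: mult.assoc)
qed

lemma fvec_cong: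
  "\<lbrakk>\<And>k. k < n \<Longrightarrow> A i k = A' i k; \<And>k. k < n \<Longrightarrow> x k = x' k\<rbrakk> \<Longrightarrow> fvec n A x i = fvec n A' x' i"
  unfolding fvec_def by (intro sum.cong) auto

lemma fvec_fone: "i < n \<Longrightarrow> fvec n fone x i = x i"
  by (simp add: fvec_def fone_def if_distrib[of "\<lambda>x. x * _"] cong: if_cong)

lemma sform_fvec: "sform n M x y = (\<Sum>i<n. cnj (x i) * fvec n M y i)"
  by (simp add: sform_def fvec_def sum_distrib_left mult.assoc)

lemma sform_cong:
  "\<lbrakk>\<And>i j. i < n \<Longrightarrow> j < n \<Longrightarrow> M i j = M' i j; \<And>i. i < n \<Longrightarrow> x i = x' i; \<And>i. i < n \<Longrightarrow> y i = y' i\<rbrakk>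
    \<Longrightarrow> sform n M x y = sform n M' x' y'"
  unfolding sform_def by (intro sum.cong) auto

lemma sform_add_left: "sform n M (\<lambda>i. x i + x' i) y = sform n M x y + sform n M x' y"
  by (simp add: sform_def algebra_simps sum.distrib)

lemma sform_add_right: "sform n M x (\<lambda>i. y i + y' i) = sform n M x y + sform n M x y'"
  by (simp add: sform_def algebra_simps sum.distrib)

lemma sform_mat_add: "sform n (\<lambda>i j. M i j + N i j) x y = sform n M x y + sform n N x y"
  by (simp add: sform_def algebra_simps sum.distrib)

lemma sform_mat_diff: "sform n (\<lambda>i j. M i j - N i j) x y = sform n M x y - sform n N x y"
  by (simp add: sform_def algebra_simps sum_subtractf)

lemma fhermD: "fherm n M \<Longrightarrow> i < n \<Longrightarrow> j < n \<Longrightarrow> M i j = cnj (M j i)"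
  unfolding fherm_def by blast

lemma fhermI: "(\<And>i j. i < n \<Longrightarrow> j < n \<Longrightarrow> M i j = cnj (M j i)) \<Longrightarrow> fherm n M"
  unfolding fherm_def by blast

lemma fherm_sform:
  assumes "fherm n M" shows "sform n M x y = cnj (sform n M y x)"
proof -
  have "cnj (sform n M y x) = (\<Sum>i<n. \<Sum>j<n. y i * cnj (M i j) * cnj (x j))"
    by (simp add: sform_def)
  also have "\<dots> = (\<Sum>j<n. \<Sum>i<n. y i * cnj (M i j) * cnj (x j))" by (rule sum.swap)
  also have "\<dots> = sform n M x y" unfolding sform_def
  proof (intro sum.cong refl)
    fix i j assume "i \<in> {..<n}" "j \<in> {..<n}"
    then have "cnj (M j i) = M i j" using fhermD[OF assms, of i j] by simp
    then show "y j * cnj (M j i) * cnj (x i) = cnj (x i) * M i j * y j" by simp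
  qed
  finally show ?thesis by simp
qed

lemma fherm_sform_Im: "fherm n M \<Longrightarrow> Im (sform n M x x) = 0"
  using fherm_sform[of n M x x] by (simp add: complex_eq_iff)

lemma fpd_imp_fpsd: "fpd n M \<Longrightarrow> fpsd n M"
  unfolding fpd_def fpsd_def
proof (intro conjI allI)
  fix v assume A: "fherm n M \<and> (\<forall>v. (\<exists>i<n. v i \<noteq> 0) \<longrightarrow> 0 < Re (sform n M v v))"
  show "0 \<le> Re (sform n M v v)"
  proof (cases "\<exists>i<n. v i \<noteq> 0")
    case True then show ?thesis using A by (simp add: less_imp_le)
  next
    case False
    then have "sform n M v v = 0" by (simp add: sform_def)
    then show ?thesis by simp
  qed
qed simp

lemma fherm_cong:
  assumes "\<And>i j. i < n \<Longrightarrow> j < n \<Longrightarrow> M i j = M' i j" shows "fherm n M \<longleftrightarrow> fherm n M'"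
  unfolding fherm_def using assms by metis

lemma fpsd_cong:
  assumes "\<And>i j. i < n \<Longrightarrow> j < n \<Longrightarrow> M i j = M' i j" shows "fpsd n M \<longleftrightarrow> fpsd n M'"
  using sform_cong[of n M M', OF assms refl refl] fherm_cong[of n M M', OF assms]
  unfolding fpsd_def by simp

lemma fherm_add:
  assumes "fherm n M" "fherm n N" shows "fherm n (\<lambda>i j. M i j + N i j)"
  using fhermD[OF assms(1)] fhermD[OF assms(2)]
  by (intro fhermI) (metis complex_cnj_add)

lemma fherm_diff:
  assumes "fherm n M" "fherm n N" shows "fherm n (\<lambda>i j. M i j - N i j)"
  using fhermD[OF assms(1)] fhermD[OF assms(2)]
  by (intro fhermI) (metis complex_cnj_diff)

lemma fherm_head: "fherm (t + n) M \<Longrightarrow> fherm t M"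
  unfolding fherm_def by (meson trans_less_add1)

lemma fpd_add_fpsd:
  assumes "fpd n M" "fpsd n N" shows "fpd n (\<lambda>i j. M i j + N i j)"
  using assms unfolding fpd_def fpsd_def sform_mat_add
  by (auto intro!: add_pos_nonneg fherm_add)

lemma fpd_fdet_nonzero:
  assumes "fpd n M" shows "fdet n M \<noteq> 0"
proof
  assume "fdet n M = 0"
  then obtain v where v: "\<exists>i<n. v i \<noteq> 0" "\<And>i. i < n \<Longrightarrow> (\<Sum>j<n. M i j * v j) = 0"
    by (rule fdet_zero_imp_kernel) blast
  have "sform n M v v = 0" unfolding sform_fvec using v(2) by (simp add: fvec_def)
  moreover have "0 < Re (sform n M v v)" using assms v(1) by (simp add: fpd_def)
  ultimately show False by simp
qed

lemma fpd_fone: "fpd n fone"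
proof -
  have "sform n fone v v = of_real (\<Sum>i<n. (cmod (v i))\<^sup>2)" for v
    unfolding sform_fvec of_real_sum complex_norm_square
    by (intro sum.cong refl) (simp add: fvec_fone mult.commute)
  moreover have "0 < (\<Sum>i<n. (cmod (v i))\<^sup>2)" if "\<exists>i<n. v i \<noteq> 0" for v :: "nat \<Rightarrow> complex"
    using that by (auto intro!: sum_pos2)
  ultimately show ?thesis by (auto simp: fpd_def fherm_def fone_def)
qed

section \<open>Leading and trailing blocks, Schur complements\<close>

definition ftail :: "nat \<Rightarrow> cfun \<Rightarrow> cfun" where
  "ftail t M = (\<lambda>i j. M (t + i) (t + j))"

lemma sform_restrict:
  assumes "l \<le> n" "\<And>i. i < n \<Longrightarrow> \<not> i < l \<Longrightarrow> v i = 0"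
  shows "sform n M v v = sform l M v v"
proof -
  have "sform n M v v = (\<Sum>i<n. \<Sum>j<l. cnj (v i) * M i j * v j)"
    unfolding sform_def using assms by (intro sum.cong refl sum.mono_neutral_right) auto
  also have "\<dots> = sform l M v v"
    unfolding sform_def using assms by (intro sum.mono_neutral_right) auto
  finally show ?thesis .
qed

lemma sform_split:
  "sform (t + n) M v v = sform t M v v + (\<Sum>i<t. \<Sum>j<n. cnj (v i) * M i (t + j) * v (t + j))
    + (\<Sum>i<n. \<Sum>j<t. cnj (v (t + i)) * M (t + i) j * v j)
    + sform n (ftail t M) (\<lambda>i. v (t + i)) (\<lambda>i. v (t + i))"
  unfolding sform_def sum_lessThan_add ftail_def sum.distrib by (simp add: add.assoc)

lemma fpd_head:
  assumes "fpd (t + n) M" shows "fpd t M"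
proof -
  have "0 < Re (sform t M v v)" if "\<exists>i<t. v i \<noteq> 0" for v
  proof -
    define w where "w = (\<lambda>i. if i < t then v i else 0)"
    from that obtain i where "i < t" "v i \<noteq> 0" by blast
    then have "i < t + n" "w i \<noteq> 0" by (auto simp: w_def)
    then have "0 < Re (sform (t + n) M w w)" using assms unfolding fpd_def by blast
    also have "sform (t + n) M w w = sform t M w w" by (rule sform_restrict) (auto simp: w_def)
    also have "\<dots> = sform t M v v" by (rule sform_cong) (auto simp: w_def)
    finally show ?thesis .
  qed
  then show ?thesis using assms fherm_head by (auto simp: fpd_def)
qed

lemma fherm_tail: "fherm (t + n) M \<Longrightarrow> fherm n (ftail t M)"
  unfolding fherm_def ftail_def by (meson nat_add_left_cancel_less)

lemma fpd_tail:
  assumes "fpd (t + n) M" shows "fpd n (ftail t M)"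
proof -
  have "0 < Re (sform n (ftail t M) v v)" if "\<exists>i<n. v i \<noteq> 0" for v
  proof -
    define w where "w = (\<lambda>i. if i < t then 0 else v (i - t))"
    have "\<exists>i<t + n. w i \<noteq> 0"
    proof -
      from that obtain i where "i < n" "v i \<noteq> 0" by blast
      then have "t + i < t + n" "w (t + i) \<noteq> 0" by (auto simp: w_def)
      then show ?thesis by blast
    qed
    then have "0 < Re (sform (t + n) M w w)" using assms unfolding fpd_def by blast
    also have "sform (t + n) M w w = sform n (ftail t M) v v"
      unfolding sform_split by (simp add: w_def sform_def)
    finally show ?thesis .
  qed
  then show ?thesis using assms fherm_tail by (auto simp: fpd_def)
qed

lemma schur_solve:
  assumes "fpd n (ftail t M)"
  shows "\<exists>V. \<forall>i<n. \<forall>j. fmult n (ftail t M) V i j = M (t + i) j"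
proof -
  from fdet_nonzero_imp_inverse[OF fpd_fdet_nonzero[OF assms]]
  obtain N where "finverse n (ftail t M) N" by blast
  then have N: "\<And>i j. i < n \<Longrightarrow> j < n \<Longrightarrow> fmult n (ftail t M) N i j = fone i j"
    by (simp add: finverse_def feq_def)
  have "fmult n (ftail t M) (fmult n N (\<lambda>i j. M (t + i) j)) i j = M (t + i) j"
    if "i < n" for i j
  proof -
    have "fmult n (ftail t M) (fmult n N (\<lambda>i j. M (t + i) j)) i j
        = fmult n fone (\<lambda>i j. M (t + i) j) i j"
      unfolding fmult_assoc[symmetric] using N that by (intro fmult_cong) auto
    then show ?thesis using that by (simp add: fmult_fone_left)
  qed
  then show ?thesis by blast
qed

text \<open>In block notation \<open>V\<close> is
  \<open>M\<^sub>2\<^sub>2\<^sup>-\<^sup>1 M\<^sub>2\<^sub>1\<close> and \<open>\<beta>\<close> is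
  \<open>M\<^sub>1\<^sub>2 M\<^sub>2\<^sub>2\<^sup>-\<^sup>1 M\<^sub>2\<^sub>1\<close>. Both are
  given by equations that do not mention the leading block of \<open>M\<close>, so
  \<open>krao_peel\<close> can use one pair for two matrices that differ only there.\<close>

locale schur =
  fixes t n :: nat and M V \<beta> :: cfun
  assumes herm: "fherm (t + n) M"
    and V: "\<And>i j. i < n \<Longrightarrow> j < t \<Longrightarrow> fmult n (ftail t M) V i j = M (t + i) j"
    and beta: "\<And>i j. i < t \<Longrightarrow> j < t \<Longrightarrow> \<beta> i j = fmult n (\<lambda>i k. M i (t + k)) V i j"
begin

lemma herm_tail: "fherm n (ftail t M)"
  using herm by (rule fherm_tail)

lemma upper_right: "i < t \<Longrightarrow> k < n \<Longrightarrow> M i (t + k) = (\<Sum>l<n. cnj (V l i) * ftail t M l k)"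
proof -
  assume ik: "i < t" "k < n"
  have "M i (t + k) = cnj (M (t + k) i)" using ik by (intro fhermD[OF herm]) auto
  also have "\<dots> = cnj (fmult n (ftail t M) V k i)" using V ik by simp
  also have "\<dots> = (\<Sum>l<n. cnj (V l i) * cnj (ftail t M k l))"
    by (simp add: fmult_def mult.commute)
  also have "\<dots> = (\<Sum>l<n. cnj (V l i) * ftail t M l k)"
    using ik by (intro sum.cong refl arg_cong2[where f="(*)"] fhermD[OF herm_tail, symmetric]) auto
  finally show ?thesis .
qed

lemma beta_sform: "i < t \<Longrightarrow> j < t \<Longrightarrow> \<beta> i j = sform n (ftail t M) (\<lambda>l. V l i) (\<lambda>k. V k j)"
  unfolding beta fmult_def sform_def
  by (subst sum.swap) (simp add: upper_right sum_distrib_right)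

lemma herm_beta: "fherm t \<beta>"
  by (rule fhermI) (simp add: beta_sform fherm_sform[OF herm_tail, symmetric])

lemma herm_alpha: "fherm t (\<lambda>i j. M i j - \<beta> i j)"
  by (rule fherm_diff[OF fherm_head[OF herm] herm_beta])

lemma cross_sum:
  "(\<Sum>i<t. \<Sum>j<n. cnj (v i) * M i (t + j) * y j) = sform n (ftail t M) (\<lambda>i. fvec t V v i) y"
proof -
  have "(\<Sum>i<t. \<Sum>j<n. cnj (v i) * M i (t + j) * y j)
      = (\<Sum>i<t. \<Sum>j<n. \<Sum>l<n. cnj (v i) * cnj (V l i) * ftail t M l j * y j)"
    by (intro sum.cong refl) (simp add: upper_right sum_distrib_left sum_distrib_right mult.assoc)
  also have "\<dots> = (\<Sum>i<t. \<Sum>l<n. \<Sum>j<n. cnj (v i) * cnj (V l i) * ftail t M l j * y j)"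
    by (intro sum.cong refl sum.swap)
  also have "\<dots> = (\<Sum>l<n. \<Sum>i<t. \<Sum>j<n. cnj (v i) * cnj (V l i) * ftail t M l j * y j)"
    by (rule sum.swap)
  also have "\<dots> = (\<Sum>l<n. \<Sum>j<n. \<Sum>i<t. cnj (v i) * cnj (V l i) * ftail t M l j * y j)"
    by (intro sum.cong refl sum.swap)
  also have "\<dots> = sform n (ftail t M) (\<lambda>i. fvec t V v i) y"
    unfolding sform_def fvec_def
    by (intro sum.cong refl) (simp add: sum_distrib_right sum_distrib_left mult_ac)
  finally show ?thesis .
qed

lemma sform_beta: "sform t \<beta> v v = sform n (ftail t M) (fvec t V v) (fvec t V v)"
proof -
  have "sform t \<beta> v v = (\<Sum>i<t. \<Sum>k<n. cnj (v i) * M i (t + k) * fvec t V v k)"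
    unfolding sform_fvec
  proof (intro sum.cong refl)
    fix i assume "i \<in> {..<t}"
    then have i: "i < t" by simp
    have "fvec t \<beta> v i = fvec t (fmult n (\<lambda>i k. M i (t + k)) V) v i"
      using beta i by (intro fvec_cong) auto
    also have "\<dots> = (\<Sum>k<n. M i (t + k) * fvec t V v k)"
      unfolding fvec_fmult by (simp add: fvec_def)
    finally show "cnj (v i) * fvec t \<beta> v i = (\<Sum>k<n. cnj (v i) * M i (t + k) * fvec t V v k)"
      by (simp add: sum_distrib_left mult.assoc)
  qed
  then show ?thesis using cross_sum[of v "fvec t V v"] by simp
qed

text \<open>Completing the square: \<open>\<beta>\<close> is the form of the trailing block pulled
  back along \<open>V\<close>, so shifting the trailing coordinates by \<open>V v\<close> absorbs
  all cross terms.\<close>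

lemma sform_schur:
  "sform (t + n) M v v = sform t (\<lambda>i j. M i j - \<beta> i j) v v
    + sform n (ftail t M) (\<lambda>i. v (t + i) + fvec t V v i) (\<lambda>i. v (t + i) + fvec t V v i)"
proof -
  let ?S = "sform n (ftail t M)" and ?v = "\<lambda>i. v (t + i)" and ?u = "fvec t V v"
  have low: "(\<Sum>i<n. \<Sum>j<t. cnj (v (t + i)) * M (t + i) j * v j) = ?S ?v ?u"
  proof -
    have "(\<Sum>i<n. \<Sum>j<t. cnj (v (t + i)) * M (t + i) j * v j)
        = (\<Sum>i<n. cnj (v (t + i)) * fvec t (fmult n (ftail t M) V) v i)"
      by (intro sum.cong refl) (simp add: V fvec_def sum_distrib_left mult.assoc)
    then show ?thesis by (simp add: fvec_fmult sform_fvec)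
  qed
  show ?thesis
    unfolding sform_split low cross_sum sform_mat_diff sform_beta sform_add_left sform_add_right
    by simp
qed

lemma fpd_alpha:
  assumes "fpd (t + n) M" shows "fpd t (\<lambda>i j. M i j - \<beta> i j)"
  unfolding fpd_def
proof (intro conjI herm_alpha allI impI)
  fix v :: "nat \<Rightarrow> complex" assume v: "\<exists>i<t. v i \<noteq> 0"
  \<comment> \<open>The trailing coordinates are chosen to make the completed square vanish, so that
    only the Schur complement remains.\<close>
  define w where "w = (\<lambda>i. if i < t then v i else - fvec t V v (i - t))"
  have "fvec t V w = fvec t V v" by (rule ext, rule fvec_cong) (auto simp: w_def)
  then have "sform (t + n) M w w = sform t (\<lambda>i j. M i j - \<beta> i j) w w"
    unfolding sform_schur by (simp add: w_def sform_def)
  also have "\<dots> = sform t (\<lambda>i j. M i j - \<beta> i j) v v" by (rule sform_cong) (auto simp: w_def)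
  finally have eq: "sform (t + n) M w w = sform t (\<lambda>i j. M i j - \<beta> i j) v v" .
  from v obtain i where "i < t" "v i \<noteq> 0" by blast
  then have "i < t + n" "w i \<noteq> 0" by (auto simp: w_def)
  then have "0 < Re (sform (t + n) M w w)" using assms unfolding fpd_def by blast
  then show "0 < Re (sform t (\<lambda>i j. M i j - \<beta> i j) v v)" using eq by simp
qed

lemma fpsd_alpha:
  assumes "fpsd (t + n) M" shows "fpsd t (\<lambda>i j. M i j - \<beta> i j)"
  unfolding fpsd_def
proof (intro conjI herm_alpha allI)
  fix v :: "nat \<Rightarrow> complex"
  define w where "w = (\<lambda>i. if i < t then v i else - fvec t V v (i - t))"
  have "fvec t V w = fvec t V v" by (rule ext, rule fvec_cong) (auto simp: w_def)
  then have "sform (t + n) M w w = sform t (\<lambda>i j. M i j - \<beta> i j) w w"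
    unfolding sform_schur by (simp add: w_def sform_def)
  also have "\<dots> = sform t (\<lambda>i j. M i j - \<beta> i j) v v" by (rule sform_cong) (auto simp: w_def)
  finally have eq: "sform (t + n) M w w = sform t (\<lambda>i j. M i j - \<beta> i j) v v" .
  have "0 \<le> Re (sform (t + n) M w w)" using assms unfolding fpsd_def by blast
  then show "0 \<le> Re (sform t (\<lambda>i j. M i j - \<beta> i j) v v)" using eq by simp
qed

lemma fpsd_beta:
  assumes "fpsd n (ftail t M)" shows "fpsd t \<beta>"
  using assms herm_beta by (simp add: fpsd_def sform_beta)

lemma fdet_schur: "fdet (t + n) M = fdet t (\<lambda>i j. M i j - \<beta> i j) * fdet n (ftail t M)"
proof -
  \<comment> \<open>\<open>L\<close> is unipotent block lower triangular with lower left block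
    \<open>-V\<close>. The column operations it encodes clear the lower left block of
    \<open>M\<close> and turn the leading block into the Schur complement, which gives
    \<open>N\<close>.\<close>
  define L where "L = (\<lambda>i j. if i < t then fone i j else if j < t then - V (i - t) j else fone i j)"
  define N where "N = (\<lambda>i j. if j < t then (if i < t then M i j - \<beta> i j else 0) else M i j)"
  have "fdet (t + n) L = fdet t L * fdet n (\<lambda>i j. L (t + i) (t + j))"
    by (rule fdet_block_lower) (simp add: L_def fone_def)
  also have "fdet t L = fdet t fone" by (rule fdet_cong) (simp add: L_def)
  also have "fdet n (\<lambda>i j. L (t + i) (t + j)) = fdet n fone"
    by (rule fdet_cong) (simp add: L_def fone_def)
  finally have L: "fdet (t + n) L = 1" by (simp add: fdet_one)
  have "fmult (t + n) M L i j = N i j" if "i < t + n" "j < t + n" for i j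
  proof (cases "j < t")
    case True
    have "fmult (t + n) M L i j = (\<Sum>k<t. M i k * fone k j) - (\<Sum>k<n. M i (t + k) * V k j)"
      using True by (simp add: fmult_def sum_lessThan_add L_def sum_negf)
    also have "(\<Sum>k<t. M i k * fone k j) = M i j"
      using fmult_fone_right[OF True, of M i] by (simp add: fmult_def)
    also have "M i j - (\<Sum>k<n. M i (t + k) * V k j) = N i j"
    proof (cases "i < t")
      case True
      then show ?thesis using \<open>j < t\<close> by (simp add: N_def beta fmult_def)
    next
      case False
      then have "(\<Sum>k<n. M i (t + k) * V k j) = M i j"
        using V[of "i - t" j] \<open>j < t\<close> \<open>i < t + n\<close> by (simp add: fmult_def ftail_def)
      then show ?thesis using False True by (simp add: N_def)
    qed
    finally show ?thesis .
  next
    case False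
    have "fmult (t + n) M L i j = (\<Sum>k<t + n. M i k * fone k j)"
      unfolding fmult_def using False by (intro sum.cong refl) (auto simp: L_def)
    also have "\<dots> = M i j" using fmult_fone_right[OF that(2), of M i] by (simp add: fmult_def)
    finally show ?thesis using False by (simp add: N_def)
  qed
  then have "fdet (t + n) N = fdet (t + n) (fmult (t + n) M L)" by (intro fdet_cong) simp
  also have "\<dots> = fdet (t + n) M" by (simp add: fdet_mult L)
  finally have "fdet (t + n) M = fdet (t + n) N" by simp
  also have "\<dots> = fdet t N * fdet n (\<lambda>i j. N (t + i) (t + j))"
    by (rule fdet_block_upper) (simp add: N_def)
  also have "fdet t N = fdet t (\<lambda>i j. M i j - \<beta> i j)" by (rule fdet_cong) (simp add: N_def)
  also have "fdet n (\<lambda>i j. N (t + i) (t + j)) = fdet n (ftail t M)"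
    by (rule fdet_cong) (simp add: N_def ftail_def)
  finally show ?thesis .
qed

end

lemma schur_exists:
  assumes "fherm (t + n) M" "fpd n (ftail t M)"
  obtains V \<beta> where "schur t n M V \<beta>"
proof -
  from schur_solve[OF assms(2)] obtain V where V: "\<forall>i<n. \<forall>j. fmult n (ftail t M) V i j = M (t + i) j"
    by blast
  have "schur t n M V (fmult n (\<lambda>i k. M i (t + k)) V)"
    by unfold_locales (use assms(1) V in auto)
  then show thesis by (rule that)
qed

subsection \<open>Eigenvalues relative to a positive definite matrix\<close>

text \<open>\<open>A\<^sup>-\<^sup>1 B\<close> need not be Hermitian, but at an eigenvector v its
  eigenvalue is the quotient of the forms of \<open>B\<close> and \<open>A\<close>. Hence it is real
  and positive, and at most 1 when \<open>A - B\<close> is semidefinite.\<close>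

lemma relative_triangularization:
  assumes A: "fpd n A" and B: "fpd n B"
  shows "\<exists>P U Q lam. finverse n P Q \<and> feq n B (fmult n A (fmult n P (fmult n U Q))) \<and> fupper n U
    \<and> (\<forall>k<n. U k k = complex_of_real (lam k) \<and> 0 < lam k
          \<and> (fpsd n (\<lambda>i j. A i j - B i j) \<longrightarrow> lam k \<le> 1))"
proof -
  from fdet_nonzero_imp_inverse[OF fpd_fdet_nonzero[OF A]] obtain N where "finverse n A N" by blast
  then have N: "\<And>i j. i < n \<Longrightarrow> j < n \<Longrightarrow> fmult n A N i j = fone i j"
    by (simp add: finverse_def feq_def)
  from triangularization[of n "fmult n N B"] obtain P U Q where inv: "finverse n P Q"
    and PUQ: "feq n (fmult n N B) (fmult n P (fmult n U Q))" and up: "fupper n U" by blast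
  have QP: "\<And>i j. i < n \<Longrightarrow> j < n \<Longrightarrow> fmult n Q P i j = fone i j"
    and M: "\<And>i j. i < n \<Longrightarrow> j < n \<Longrightarrow> fmult n N B i j = fmult n P (fmult n U Q) i j"
    and U: "\<And>i j. j < i \<Longrightarrow> i < n \<Longrightarrow> U i j = 0"
    using inv PUQ up by (simp_all add: finverse_def feq_def fupper_def)
  have B': "B i j = fmult n A (fmult n P (fmult n U Q)) i j" if "i < n" "j < n" for i j
  proof -
    have "fmult n A (fmult n P (fmult n U Q)) i j = fmult n A (fmult n N B) i j"
      using M that by (intro fmult_cong[OF refl]) auto
    also have "\<dots> = fmult n fone B i j"
      unfolding fmult_assoc[symmetric] using N that by (intro fmult_cong) auto
    finally show ?thesis using that by (simp add: fmult_fone_left)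
  qed
  have ev: "\<exists>v. (\<exists>i<n. v i \<noteq> 0) \<and> sform n B v v = U k k * sform n A v v" if k: "k < n" for k
  proof -
    \<comment> \<open>The triangular matrix \<open>U - U\<^sub>k\<^sub>k I\<close> has a zero on its
      diagonal, hence a kernel vector w; then \<open>P w\<close> is an eigenvector of
      \<open>A\<^sup>-\<^sup>1 B\<close>.\<close>
    define W where "W = (\<lambda>i j. U i j - U k k * fone i j)"
    have "fdet n W = (\<Prod>i<n. W i i)" by (rule fdet_upper_triangular) (simp add: W_def U fone_def)
    also have "\<dots> = 0" using k by (auto simp: W_def fone_def)
    finally obtain w where w: "\<exists>i<n. w i \<noteq> 0" "\<And>i. i < n \<Longrightarrow> (\<Sum>j<n. W i j * w j) = 0"
      by (rule fdet_zero_imp_kernel) blast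
    have Uw: "fvec n U w i = U k k * w i" if "i < n" for i
    proof -
      have "(\<Sum>j<n. W i j * w j) = fvec n U w i - U k k * fvec n fone w i"
        by (simp add: W_def fvec_def algebra_simps sum_subtractf sum_distrib_left)
      then show ?thesis using w(2)[OF that] that by (simp add: fvec_fone)
    qed
    define v where "v = fvec n P w"
    have Qv: "fvec n Q v i = w i" if "i < n" for i
    proof -
      have "fvec n Q v i = fvec n (fmult n Q P) w i" by (simp add: v_def fvec_fmult)
      also have "\<dots> = fvec n fone w i" using QP that by (intro fvec_cong) auto
      finally show ?thesis using that by (simp add: fvec_fone)
    qed
    have v0: "\<exists>i<n. v i \<noteq> 0"
    proof (rule ccontr)
      assume "\<not> ?thesis"
      then have "fvec n Q v i = 0" for i by (simp add: fvec_def)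
      with Qv w(1) show False by auto
    qed
    have Bv: "fvec n B v i = U k k * fvec n A v i" if i: "i < n" for i
    proof -
      have "fvec n B v i = fvec n (fmult n A (fmult n P (fmult n U Q))) v i"
        using B' i by (intro fvec_cong) auto
      also have "\<dots> = fvec n A (fvec n P (fvec n U (fvec n Q v))) i"
        by (simp only: fvec_fmult)
      also have "\<dots> = fvec n A (\<lambda>i. U k k * v i) i"
      proof (rule fvec_cong[OF refl])
        fix a assume a: "a < n"
        have "fvec n P (fvec n U (fvec n Q v)) a = fvec n P (\<lambda>i. U k k * w i) a"
        proof (rule fvec_cong[OF refl])
          fix b assume b: "b < n"
          have "fvec n U (fvec n Q v) b = fvec n U w b" using Qv by (intro fvec_cong) auto
          then show "fvec n U (fvec n Q v) b = U k k * w b" using Uw b by simp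
        qed
        then show "fvec n P (fvec n U (fvec n Q v)) a = U k k * v a"
          by (simp add: v_def fvec_def sum_distrib_left mult_ac)
      qed
      finally show ?thesis by (simp add: fvec_def sum_distrib_left mult_ac)
    qed
    have "sform n B v v = U k k * sform n A v v"
      unfolding sform_fvec sum_distrib_left by (intro sum.cong refl) (simp add: Bv)
    then show ?thesis using v0 by blast
  qed
  define lam where "lam = (\<lambda>k. Re (U k k))"
  have lam: "U k k = of_real (lam k) \<and> 0 < lam k \<and> (fpsd n (\<lambda>i j. A i j - B i j) \<longrightarrow> lam k \<le> 1)"
    if k: "k < n" for k
  proof -
    from ev[OF k] obtain v where v: "\<exists>i<n. v i \<noteq> 0" "sform n B v v = U k k * sform n A v v" by blast
    define a b where "a = Re (sform n A v v)" and "b = Re (sform n B v v)"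
    have a: "sform n A v v = of_real a" "0 < a" using A v(1) fherm_sform_Im[of n A v]
      by (auto simp: fpd_def a_def complex_eq_iff)
    have b: "sform n B v v = of_real b" "0 < b" using B v(1) fherm_sform_Im[of n B v]
      by (auto simp: fpd_def b_def complex_eq_iff)
    have "U k k = of_real (b / a)" using v(2) a b by (simp add: field_simps)
    then have l: "U k k = of_real (lam k)" "lam k = b / a" by (simp_all add: lam_def)
    have "lam k \<le> 1" if "fpsd n (\<lambda>i j. A i j - B i j)"
    proof -
      have "0 \<le> Re (sform n (\<lambda>i j. A i j - B i j) v v)" using that by (simp add: fpsd_def)
      then have "b \<le> a" by (simp add: sform_mat_diff a_def b_def)
      then show ?thesis unfolding l(2) using a by (simp add: field_simps)
    qed
    then show ?thesis using l a b by simp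
  qed
  have "feq n B (fmult n A (fmult n P (fmult n U Q)))" using B' by (simp add: feq_def)
  with inv up lam show ?thesis by blast
qed

section \<open>Determinants through relative eigenvalues\<close>

lemma fdet_finverse: "finverse n P Q \<Longrightarrow> fdet n P * fdet n Q = 1"
  using fdet_cong[of n "fmult n P Q" fone] by (simp add: fdet_mult fdet_one finverse_def feq_def)

lemma fdet_relative:
  assumes "finverse n P Q" "feq n B (fmult n A (fmult n P (fmult n U Q)))" "fupper n U"
  shows "fdet n B = fdet n A * (\<Prod>k<n. U k k)"
proof -
  have "fdet n P * fdet n Q = 1" by (rule fdet_finverse[OF assms(1)])
  moreover have "fdet n B = fdet n A * (fdet n P * (fdet n U * fdet n Q))"
    using fdet_cong[of n B "fmult n A (fmult n P (fmult n U Q))"] assms(2)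
    by (simp add: fdet_mult feq_def)
  ultimately show ?thesis using fdet_upper_triangular[of n U] assms(3)
    by (simp add: algebra_simps fupper_def)
qed

text \<open>Relative to the identity, the relative eigenvalues are the eigenvalues of
  \<open>B\<close> itself, so the determinant is a product of positive reals.\<close>

lemma fpd_fdet_pos:
  assumes "fpd n B" shows "fdet n B = of_real (Re (fdet n B))" "0 < Re (fdet n B)"
proof -
  from relative_triangularization[OF fpd_fone assms] obtain P U Q lam where *: "finverse n P Q"
    "feq n B (fmult n fone (fmult n P (fmult n U Q)))" "fupper n U"
    "\<forall>k<n. U k k = complex_of_real (lam k) \<and> 0 < lam k" by blast
  have "fdet n B = of_real (\<Prod>k<n. lam k)"
    using fdet_relative[OF *(1-3)] *(4) by (simp add: fdet_one)
  moreover have "0 < (\<Prod>k<n. lam k)" using *(4) by (intro prod_pos) auto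
  ultimately show "fdet n B = of_real (Re (fdet n B))" "0 < Re (fdet n B)"
    by (simp_all del: of_real_prod)
qed

lemma fpd_sform_zero: "fpd n A \<Longrightarrow> sform n A x x = 0 \<Longrightarrow> i < n \<Longrightarrow> x i = 0"
  unfolding fpd_def by (metis less_irrefl zero_complex.sel(1))

text \<open>If all eigenvalues of \<open>A\<^sup>-\<^sup>1 B\<close> are 1, then \<open>I - A\<^sup>-\<^sup>1 B = P S Q\<close> with \<open>S\<close> strictly upper triangular;
  as this operator is self-adjoint for the inner product given by \<open>A\<close>, it vanishes.\<close>
lemma relative_eigenvalues_one:
  assumes A: "fpd n A" and B: "fherm n B"
    and inv: "finverse n P Q" and BU': "feq n B (fmult n A (fmult n P (fmult n U Q)))"
    and up: "fupper n U"
    and one: "\<And>k. k < n \<Longrightarrow> U k k = 1"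
    and ij: "i < n" "j < n"
  shows "A i j = B i j"
proof -
  have PQ: "\<And>i j. i < n \<Longrightarrow> j < n \<Longrightarrow> fmult n P Q i j = fone i j"
    and QP: "\<And>i j. i < n \<Longrightarrow> j < n \<Longrightarrow> fmult n Q P i j = fone i j"
    and BU: "\<And>i j. i < n \<Longrightarrow> j < n \<Longrightarrow> B i j = fmult n A (fmult n P (fmult n U Q)) i j"
    and U: "\<And>i j. j < i \<Longrightarrow> i < n \<Longrightarrow> U i j = 0"
    using inv BU' up by (simp_all add: finverse_def feq_def fupper_def)
  define S where "S = (\<lambda>i j. fone i j - U i j)"
  define N where "N = fmult n P (fmult n S Q)"
  define E where "E = (\<lambda>i j. A i j - B i j)"
  have hE: "fherm n E" unfolding E_def using A B by (intro fherm_diff) (auto simp: fpd_def)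
  have E: "E i j = fmult n A N i j" if "i < n" "j < n" for i j
  proof -
    have "fmult n S Q k j = Q k j - fmult n U Q k j" if "k < n" for k
      using fmult_fone_left[OF that, of Q j]
      by (simp add: S_def fmult_def algebra_simps sum_subtractf)
    then have "fmult n P (fmult n S Q) k j = fmult n P (\<lambda>k j. Q k j - fmult n U Q k j) k j" for k
      by (intro fmult_cong) auto
    then have "N k j = fmult n P Q k j - fmult n P (fmult n U Q) k j" for k
      by (simp add: N_def fmult_def[of n P] right_diff_distrib sum_subtractf)
    then have "fmult n A N i j = fmult n A (fmult n P Q) i j - fmult n A (fmult n P (fmult n U Q)) i j"
      by (simp add: fmult_def[of n A] right_diff_distrib sum_subtractf)
    moreover have "fmult n A (fmult n P Q) i j = fmult n A fone i j"
      using PQ that by (intro fmult_cong) auto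
    ultimately show ?thesis using BU that by (simp add: E_def fmult_fone_right)
  qed
  \<comment> \<open>\<open>N\<close> is self-adjoint for the inner product given by
    \<open>A\<close>, because \<open>A N = E\<close> is Hermitian. So if
    \<open>N\<^sup>2 v = 0\<close>, then \<open>N v\<close> has norm zero in that inner
    product.\<close>
  have key: "fvec n N v i = 0" if NN: "\<And>i. i < n \<Longrightarrow> fvec n N (fvec n N v) i = 0" and "i < n" for v i
  proof -
    let ?x = "fvec n N v"
    have Ev: "fvec n E y i = fvec n A (fvec n N y) i" if "i < n" for y i
      using E that by (subst fvec_fmult[symmetric]) (auto intro: fvec_cong)
    have "sform n A ?x ?x = sform n E ?x v" by (simp add: sform_fvec Ev)
    also have "\<dots> = cnj (sform n E v ?x)" by (rule fherm_sform[OF hE])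
    also have "sform n E v ?x = (\<Sum>i<n. cnj (v i) * fvec n A (fvec n N ?x) i)"
      by (simp add: sform_fvec Ev)
    also have "\<dots> = 0" using NN by (simp add: fvec_def[of n A])
    finally show ?thesis using fpd_sform_zero[OF A] that by simp
  qed
  have QN: "fmult n Q N i j = fmult n S Q i j" if "i < n" for i j
  proof -
    have "fmult n Q N i j = fmult n fone (fmult n S Q) i j"
      unfolding N_def fmult_assoc[symmetric] using QP that by (intro fmult_cong) auto
    then show ?thesis using that by (simp add: fmult_fone_left)
  qed
  \<comment> \<open>Column k of \<open>S\<close> lives in rows j with j < k, and the columns j of
    \<open>S\<close> vanish by induction, so \<open>S\<close> annihilates column k. Hence
    \<open>N\<^sup>2\<close> annihilates column k of \<open>P\<close>; by \<open>key\<close> so does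
    \<open>N\<close>, which means that column k of \<open>S\<close> is zero.\<close>
  have S0: "S i k = 0" if "k < n" "i < n" for i k
    using that
  proof (induction k arbitrary: i rule: less_induct)
    case (less k)
    let ?v = "\<lambda>i. P i k"
    have Qv: "fvec n Q ?v b = fone b k" if "b < n" for b
      using QP[OF that less.prems(1)] by (simp add: fvec_def fmult_def)
    have SQv: "fvec n (fmult n S Q) ?v b = S b k" if "b < n" for b
    proof -
      have "fvec n (fmult n S Q) ?v b = (\<Sum>j<n. S b j * fone j k)"
        unfolding fvec_fmult using Qv by (simp add: fvec_def[of n S])
      then show ?thesis using fmult_fone_right[OF less.prems(1), of S b] by (simp add: fmult_def)
    qed
    have Nv: "fvec n N ?v b = fvec n P (\<lambda>j. S j k) b" for b
      unfolding N_def fvec_fmult[of n n P] using SQv by (intro fvec_cong) auto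
    have NN: "fvec n N (fvec n N ?v) b = 0" for b
    proof -
      have 1: "fvec n Q (fvec n N ?v) c = S c k" if "c < n" for c
      proof -
        have "fvec n Q (fvec n N ?v) c = fvec n (fmult n Q N) ?v c" by (simp add: fvec_fmult)
        also have "\<dots> = fvec n (fmult n S Q) ?v c" using QN that by (intro fvec_cong) auto
        finally show ?thesis using SQv that by simp
      qed
      have 2: "fvec n S (fvec n Q (fvec n N ?v)) c = 0" if "c < n" for c
      proof -
        have "fvec n S (fvec n Q (fvec n N ?v)) c = (\<Sum>j<n. S c j * S j k)"
          unfolding fvec_def[of n S] using 1 by simp
        also have "\<dots> = 0"
        proof (rule sum.neutral, intro ballI)
          fix j assume j: "j \<in> {..<n}"
          show "S c j * S j k = 0"
          proof (cases "j < k")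
            case True
            then show ?thesis using less.IH[of j c] j that by simp
          next
            case False
            then have "S j k = 0" using U[of k j] one[of k] j less.prems(1)
              by (cases "j = k") (auto simp: S_def fone_def)
            then show ?thesis by simp
          qed
        qed
        finally show ?thesis .
      qed
      have "fvec n N (fvec n N ?v) b = fvec n P (fvec n S (fvec n Q (fvec n N ?v))) b"
        by (simp only: N_def fvec_fmult)
      then show ?thesis using 2 by (simp add: fvec_def[of n P])
    qed
    have "fvec n N ?v b = 0" if "b < n" for b by (rule key[OF NN that])
    then have "fvec n Q (fvec n N ?v) i = 0" by (simp add: fvec_def[of n Q])
    also have "fvec n Q (fvec n N ?v) i = fvec n (fmult n Q N) ?v i" by (simp add: fvec_fmult)
    also have "\<dots> = fvec n (fmult n S Q) ?v i" using QN less.prems by (intro fvec_cong) auto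
    also have "\<dots> = S i k" by (rule SQv[OF less.prems(2)])
    finally show ?case by simp
  qed
  have "fmult n S Q i j = 0" if "i < n" for i j using S0 that by (simp add: fmult_def)
  then have "N i j = 0" for i j by (simp add: N_def fmult_def[of n P])
  then have "E i j = 0" using E[OF ij] by (simp add: fmult_def)
  then show ?thesis by (simp add: E_def)
qed

text \<open>The quotient of the determinants is a product of relative eigenvalues in (0,1], and it
  equals 1 only if all of them do.\<close>

lemma fdet_mono:
  assumes A: "fpd n A" and B: "fpd n B" and le: "fpsd n (\<lambda>i j. A i j - B i j)"
  shows "Re (fdet n B) \<le> Re (fdet n A)"
    and "Re (fdet n B) = Re (fdet n A) \<Longrightarrow> i < n \<Longrightarrow> j < n \<Longrightarrow> A i j = B i j"
proof -
  from relative_triangularization[OF A B] le obtain P U Q lam where inv: "finverse n P Q"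
    and BU: "feq n B (fmult n A (fmult n P (fmult n U Q)))" and up: "fupper n U"
    and "\<forall>k<n. U k k = complex_of_real (lam k) \<and> 0 < lam k \<and> lam k \<le> 1" by blast
  then have *: "\<And>k. k < n \<Longrightarrow> U k k = complex_of_real (lam k)" "\<And>k. k < n \<Longrightarrow> 0 < lam k"
    "\<And>k. k < n \<Longrightarrow> lam k \<le> 1" by auto
  have det: "fdet n B = fdet n A * of_real (\<Prod>k<n. lam k)"
    using fdet_relative[OF inv BU up] *(1) by simp
  have prod: "(\<Prod>k<n. lam k) \<le> 1" using *(2,3) by (intro prod_le_1) (auto simp: less_imp_le)
  have detR: "Re (fdet n B) = Re (fdet n A) * (\<Prod>k<n. lam k)" unfolding det by (simp del: of_real_prod)
  show "Re (fdet n B) \<le> Re (fdet n A)" unfolding detR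
    using prod fpd_fdet_pos(2)[OF A] by (simp add: mult_left_le)
  assume eq: "Re (fdet n B) = Re (fdet n A)" and ij: "i < n" "j < n"
  then have p1: "(\<Prod>k<n. lam k) = 1" using detR fpd_fdet_pos(2)[OF A] by simp
  have "lam k = 1" if k: "k < n" for k
  proof -
    have "(\<Prod>k<n. lam k) = lam k * (\<Prod>k\<in>{..<n} - {k}. lam k)" using k by (simp add: prod.remove)
    also have "\<dots> \<le> lam k * 1" using *(2,3) k
      by (intro mult_left_mono prod_le_1) (auto simp: less_imp_le)
    finally show ?thesis using p1 *(3)[OF k] by simp
  qed
  then show "A i j = B i j"
    using relative_eigenvalues_one[OF A _ inv BU up _ ij] B *(1) by (auto simp: fpd_def)
qed

subsection \<open>Gram factors and Hadamard products\<close>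

text \<open>A Gram factor certifies semidefiniteness in a form that passes to entrywise products.
  \<open>N\<close> is kept separate from \<open>n\<close> because the matrix with replaced leading
  block has a factor with fewer rows than columns.\<close>

definition gram :: "nat \<Rightarrow> nat \<Rightarrow> cfun \<Rightarrow> cfun \<Rightarrow> bool" where
  "gram N n A g \<longleftrightarrow> (\<forall>i<n. \<forall>j<n. A i j = (\<Sum>r<N. cnj (g r i) * g r j))"

lemma gram_sform:
  assumes "gram N n A g"
  shows "sform n A x y = (\<Sum>r<N. cnj (fvec n g x r) * fvec n g y r)"
proof -
  have "sform n A x y = (\<Sum>i<n. \<Sum>j<n. \<Sum>r<N. cnj (g r i * x i) * (g r j * y j))"
    unfolding sform_def using assms
    by (intro sum.cong refl) (simp add: gram_def sum_distrib_left sum_distrib_right mult_ac)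
  also have "\<dots> = (\<Sum>i<n. \<Sum>r<N. \<Sum>j<n. cnj (g r i * x i) * (g r j * y j))"
    by (intro sum.cong refl sum.swap)
  also have "\<dots> = (\<Sum>r<N. \<Sum>i<n. \<Sum>j<n. cnj (g r i * x i) * (g r j * y j))"
    by (rule sum.swap)
  also have "\<dots> = (\<Sum>r<N. cnj (fvec n g x r) * fvec n g y r)"
    by (simp only: fvec_def cnj_sum sum_product)
  finally show ?thesis .
qed

context schur begin

text \<open>As a block row \<open>W\<close> is \<open>(V, I)\<close>. Congruence by it turns the
  trailing block into \<open>M\<close> with leading block replaced by \<open>\<beta>\<close>, so
  this replacement inherits Gram factors from the trailing block.\<close>

definition W :: cfun where "W l i = (if i < t then V l i else fone l (i - t))"

lemma tail_sform_W:
  assumes "i < t + n" "j < t + n"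
  shows "sform n (ftail t M) (\<lambda>l. W l i) (\<lambda>l. W l j) = (if i < t \<and> j < t then \<beta> i j else M i j)"
proof -
  have right: "sform n (ftail t M) x (\<lambda>l. W l j) = (\<Sum>l<n. cnj (x l) * M (t + l) j)"
    if "j < t + n" for x j
    unfolding sform_fvec
  proof (intro sum.cong refl arg_cong2[where f="(*)"])
    fix l assume "l \<in> {..<n}"
    then have l: "l < n" by simp
    show "fvec n (ftail t M) (\<lambda>l. W l j) l = M (t + l) j"
    proof (cases "j < t")
      case True
      then show ?thesis using V[OF l True] by (simp add: fvec_def fmult_def W_def)
    next
      case False
      then have j: "j - t < n" using that by simp
      have "fvec n (ftail t M) (\<lambda>l. W l j) l = fmult n (ftail t M) fone l (j - t)"
        using False by (simp add: fvec_def fmult_def W_def)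
      then show ?thesis using False by (simp add: fmult_fone_right[OF j] ftail_def)
    qed
  qed
  consider "i < t" "j < t" | "i < t" "\<not> j < t" | "\<not> i < t" by blast
  then show ?thesis
  proof cases
    case 1
    then show ?thesis by (simp add: beta_sform W_def)
  next
    case 2
    have "sform n (ftail t M) (\<lambda>l. W l i) (\<lambda>l. W l j) = cnj (sform n (ftail t M) (\<lambda>l. W l j) (\<lambda>l. W l i))"
      by (rule fherm_sform[OF herm_tail])
    also have "\<dots> = cnj (\<Sum>l<n. cnj (fone l (j - t)) * M (t + l) i)"
      unfolding right[OF assms(1)] using 2 by (simp add: W_def)
    also have "(\<Sum>l<n. cnj (fone l (j - t)) * M (t + l) i) = M j i"
    proof -
      have "(\<Sum>l<n. cnj (fone l (j - t)) * M (t + l) i) = (\<Sum>l<n. if l = j - t then M (t + l) i else 0)"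
        by (intro sum.cong refl) (simp add: fone_def)
      then show ?thesis using 2 assms by simp
    qed
    also have "cnj (M j i) = M i j" by (rule fhermD[OF herm assms, symmetric])
    finally show ?thesis using 2 by simp
  next
    case 3
    have "(\<Sum>l<n. cnj (W l i) * M (t + l) j) = (\<Sum>l<n. if l = i - t then M (t + l) j else 0)"
      using 3 by (intro sum.cong refl) (simp add: W_def fone_def)
    then show ?thesis unfolding right[OF assms(2)] using 3 assms by simp
  qed
qed

lemma gram_W:
  assumes "gram N n (ftail t M) g"
  shows "gram N (t + n) (\<lambda>i j. if i < t \<and> j < t then \<beta> i j else M i j) (fmult n g W)"
  unfolding gram_def
proof (intro allI impI)
  fix i j assume ij: "i < t + n" "j < t + n"
  show "(if i < t \<and> j < t then \<beta> i j else M i j) = (\<Sum>r<N. cnj (fmult n g W r i) * fmult n g W r j)"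
    unfolding tail_sform_W[OF ij, symmetric] gram_sform[OF assms] by (simp add: fvec_def fmult_def)
qed

end

text \<open>The Cholesky construction: \<open>A\<close> exceeds the replaced matrix of
  \<open>gram_W\<close> only in its first diagonal entry, by a positive amount, so a single row is
  added to the factor \<open>g W\<close>.\<close>

lemma fpd_gram: "fpd n A \<Longrightarrow> \<exists>g. gram n n A g"
proof (induction n arbitrary: A)
  case 0
  show ?case by (auto simp: gram_def)
next
  case (Suc n)
  then have A: "fpd (1 + n) A" by simp
  from Suc.IH[OF fpd_tail[OF A]] obtain g where g: "gram n n (ftail 1 A) g" by blast
  from A have h: "fherm (1 + n) A" by (simp add: fpd_def)
  obtain V \<beta> where "schur 1 n A V \<beta>" using schur_exists[OF h fpd_tail[OF A]] by blast
  then interpret schur 1 n A V \<beta> .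
  define a where "a = Re (A 0 0 - \<beta> 0 0)"
  have "sform 1 (\<lambda>i j. A i j - \<beta> i j) (\<lambda>_. 1) (\<lambda>_. 1) = A 0 0 - \<beta> 0 0" by (simp add: sform_def)
  moreover have "0 < Re (sform 1 (\<lambda>i j. A i j - \<beta> i j) (\<lambda>_. 1) (\<lambda>_. 1))"
    using fpd_alpha[OF A] unfolding fpd_def by auto
  moreover note fherm_sform_Im[OF herm_alpha, of "\<lambda>_. 1"]
  ultimately have a: "0 < a" "A 0 0 = \<beta> 0 0 + of_real a" by (auto simp: a_def complex_eq_iff)
  define G where "G = (\<lambda>r i. if r = 0 then (if i = 0 then of_real (sqrt a) else 0) else fmult n g W (r - 1) i)"
  have "gram (1 + n) (1 + n) A G"
    unfolding gram_def
  proof (intro allI impI)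
    fix i j assume ij: "i < 1 + n" "j < 1 + n"
    have "(\<Sum>r<1 + n. cnj (G r i) * G r j) = cnj (G 0 i) * G 0 j + (\<Sum>r<n. cnj (fmult n g W r i) * fmult n g W r j)"
      unfolding sum_lessThan_add by (simp add: G_def)
    also have "(\<Sum>r<n. cnj (fmult n g W r i) * fmult n g W r j) = (if i < 1 \<and> j < 1 then \<beta> i j else A i j)"
      using gram_W[OF g] ij unfolding gram_def by simp
    also have "cnj (G 0 i) * G 0 j + \<dots> = A i j"
      using a by (auto simp: G_def simp flip: of_real_mult)
    finally show "A i j = (\<Sum>r<1 + n. cnj (G r i) * G r j)" by simp
  qed
  then show ?case by (metis plus_1_eq_Suc)
qed

text \<open>Since \<open>A\<close> is the conjugate transpose of g times g, the product of the
  inverse of \<open>A\<close> with that transpose is a left inverse of g. It serves to pick single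
  coordinates out of vanishing combinations of Gram rows.\<close>

lemma fpd_gram_left_inverse:
  assumes "fpd n A"
  shows "\<exists>g h. gram n n A g \<and> feq n (fmult n h g) fone"
proof -
  from fpd_gram[OF assms] obtain g where g: "gram n n A g" by blast
  from fdet_nonzero_imp_inverse[OF fpd_fdet_nonzero[OF assms]] obtain N where N: "finverse n A N" by blast
  define g' where "g' = (\<lambda>l r. cnj (g r l))"
  have A: "A i j = fmult n g' g i j" if "i < n" "j < n" for i j
    using g that by (simp add: gram_def fmult_def g'_def)
  have "fmult n (fmult n N g') g i j = fone i j" if "i < n" "j < n" for i j
  proof -
    have "fmult n (fmult n N g') g i j = fmult n N A i j"
      unfolding fmult_assoc using A that by (intro fmult_cong) auto
    then show ?thesis using N that by (simp add: finverse_def feq_def)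
  qed
  then show ?thesis using g unfolding feq_def by blast
qed

text \<open>\<open>\<phi> p x\<close> is the row of factor p that row x refers to. Mixed-radix
  digits give the Kronecker product, block indices the Khatri--Rao product; positivity is thus
  proved once for both.\<close>

definition hadamard :: "nat \<Rightarrow> (nat \<Rightarrow> nat \<Rightarrow> nat) \<Rightarrow> (nat \<Rightarrow> cfun) \<Rightarrow> cfun" where
  "hadamard m \<phi> A x y = (\<Prod>p<m. A p (\<phi> p x) (\<phi> p y))"

lemma fherm_hadamard:
  assumes "\<And>p. p < m \<Longrightarrow> fherm (n p) (A p)" "\<And>p x. p < m \<Longrightarrow> x < N \<Longrightarrow> \<phi> p x < n p"
  shows "fherm N (hadamard m \<phi> A)"
proof (rule fhermI)
  fix x y assume "x < N" "y < N"
  then show "hadamard m \<phi> A x y = cnj (hadamard m \<phi> A y x)"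
    unfolding hadamard_def cnj_prod using assms by (intro prod.cong refl fhermD) auto
qed

context
  fixes m N :: nat and n k :: "nat \<Rightarrow> nat" and \<phi> :: "nat \<Rightarrow> nat \<Rightarrow> nat" and A g :: "nat \<Rightarrow> cfun"
  assumes gr: "\<And>p. p < m \<Longrightarrow> gram (k p) (n p) (A p) (g p)"
    and \<phi>: "\<And>p x. p < m \<Longrightarrow> x < N \<Longrightarrow> \<phi> p x < n p"
begin

text \<open>Multiplying out the Gram sums of all factors produces one square for every tuple
  \<open>\<rho>\<close> of Gram rows.\<close>

lemma hadamard_sform:
  "sform N (hadamard m \<phi> A) v v = of_real (\<Sum>\<rho>\<in>PiE {..<m} (\<lambda>p. {..<k p}).
     (cmod (\<Sum>x<N. v x * (\<Prod>p<m. g p (\<rho> p) (\<phi> p x))))\<^sup>2)"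
proof -
  let ?R = "PiE {..<m} (\<lambda>p. {..<k p})"
  let ?F = "\<lambda>\<rho> x. v x * (\<Prod>p<m. g p (\<rho> p) (\<phi> p x))"
  have "cnj (v x) * hadamard m \<phi> A x y * v y = (\<Sum>\<rho>\<in>?R. cnj (?F \<rho> x) * ?F \<rho> y)"
    if "x < N" "y < N" for x y
  proof -
    have "hadamard m \<phi> A x y = (\<Prod>p<m. \<Sum>r<k p. cnj (g p r (\<phi> p x)) * g p r (\<phi> p y))"
      unfolding hadamard_def using gr \<phi> that by (intro prod.cong refl) (auto simp: gram_def)
    also have "\<dots> = (\<Sum>\<rho>\<in>?R. \<Prod>p<m. cnj (g p (\<rho> p) (\<phi> p x)) * g p (\<rho> p) (\<phi> p y))"
      by (rule prod_sum_PiE) auto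
    finally show ?thesis
      by (simp add: sum_distrib_left sum_distrib_right prod.distrib mult_ac)
  qed
  then have "sform N (hadamard m \<phi> A) v v = (\<Sum>x<N. \<Sum>y<N. \<Sum>\<rho>\<in>?R. cnj (?F \<rho> x) * ?F \<rho> y)"
    unfolding sform_def by (intro sum.cong refl) auto
  also have "\<dots> = (\<Sum>x<N. \<Sum>\<rho>\<in>?R. \<Sum>y<N. cnj (?F \<rho> x) * ?F \<rho> y)"
    by (intro sum.cong refl sum.swap)
  also have "\<dots> = (\<Sum>\<rho>\<in>?R. \<Sum>x<N. \<Sum>y<N. cnj (?F \<rho> x) * ?F \<rho> y)"
    by (rule sum.swap)
  also have "\<dots> = (\<Sum>\<rho>\<in>?R. of_real ((cmod (\<Sum>x<N. ?F \<rho> x))\<^sup>2))"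
  proof (intro sum.cong refl)
    fix \<rho>
    have "(\<Sum>x<N. \<Sum>y<N. cnj (?F \<rho> x) * ?F \<rho> y) = cnj (\<Sum>x<N. ?F \<rho> x) * (\<Sum>x<N. ?F \<rho> x)"
      by (simp only: cnj_sum sum_product)
    then show "(\<Sum>x<N. \<Sum>y<N. cnj (?F \<rho> x) * ?F \<rho> y) = of_real ((cmod (\<Sum>x<N. ?F \<rho> x))\<^sup>2)"
      by (simp only: complex_norm_square mult.commute)
  qed
  finally show ?thesis by simp
qed

lemma hadamard_sform_nonneg: "0 \<le> Re (sform N (hadamard m \<phi> A) v v)"
  unfolding hadamard_sform Re_complex_of_real by (rule sum_nonneg) simp

text \<open>A vanishing sum of squares kills the linear form of every tuple \<open>\<rho>\<close>;
  these forms are combined here with the weights \<open>h p (\<rho> p)\<close>. The choice of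
  \<open>h\<close> decides which coordinates of v are detected.\<close>

lemma hadamard_sform_zero:
  assumes "Re (sform N (hadamard m \<phi> A) v v) = 0"
  shows "(\<Sum>x<N. v x * (\<Prod>p<m. \<Sum>r<k p. h p r * g p r (\<phi> p x))) = 0"
proof -
  let ?R = "PiE {..<m} (\<lambda>p. {..<k p})"
  have fin: "finite ?R" by (intro finite_PiE) auto
  have "(\<Sum>\<rho>\<in>?R. (cmod (\<Sum>x<N. v x * (\<Prod>p<m. g p (\<rho> p) (\<phi> p x))))\<^sup>2) = 0"
    using assms unfolding hadamard_sform Re_complex_of_real .
  then have zero: "(\<Sum>x<N. v x * (\<Prod>p<m. g p (\<rho> p) (\<phi> p x))) = 0" if "\<rho> \<in> ?R" for \<rho>
    using that fin by (simp add: sum_nonneg_eq_0_iff)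
  have "(\<Sum>x<N. v x * (\<Prod>p<m. \<Sum>r<k p. h p r * g p r (\<phi> p x)))
      = (\<Sum>x<N. \<Sum>\<rho>\<in>?R. (\<Prod>p<m. h p (\<rho> p)) * (v x * (\<Prod>p<m. g p (\<rho> p) (\<phi> p x))))"
    by (intro sum.cong refl) (subst prod_sum_PiE; simp add: prod.distrib sum_distrib_left mult_ac)
  also have "\<dots> = (\<Sum>\<rho>\<in>?R. \<Sum>x<N. (\<Prod>p<m. h p (\<rho> p)) * (v x * (\<Prod>p<m. g p (\<rho> p) (\<phi> p x))))"
    by (rule sum.swap)
  also have "\<dots> = 0"
    using zero by (simp flip: sum_distrib_left)
  finally show ?thesis .
qed

end

lemma fpd_hadamard:
  assumes A: "\<And>p. p < m \<Longrightarrow> fpd (n p) (A p)" and \<phi>: "\<And>p x. p < m \<Longrightarrow> x < N \<Longrightarrow> \<phi> p x < n p"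
    and inj: "\<And>x y. x < N \<Longrightarrow> y < N \<Longrightarrow> (\<And>p. p < m \<Longrightarrow> \<phi> p x = \<phi> p y) \<Longrightarrow> x = y"
  shows "fpd N (hadamard m \<phi> A)"
proof -
  from fpd_gram_left_inverse[OF A]
  have "\<forall>p. \<exists>g h. p < m \<longrightarrow> gram (n p) (n p) (A p) g \<and> feq (n p) (fmult (n p) h g) fone" by blast
  then obtain g h where g: "\<And>p. p < m \<Longrightarrow> gram (n p) (n p) (A p) (g p)"
    and h: "\<And>p. p < m \<Longrightarrow> feq (n p) (fmult (n p) (h p) (g p)) fone" by metis
  have "0 < Re (sform N (hadamard m \<phi> A) v v)" if v: "\<exists>i<N. v i \<noteq> 0" for v
  proof (rule ccontr)
    assume "\<not> ?thesis"
    then have z: "Re (sform N (hadamard m \<phi> A) v v) = 0"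
      using hadamard_sform_nonneg[OF g \<phi>, where v=v] by fastforce
    have "v y = 0" if y: "y < N" for y
    proof -
      \<comment> \<open>With row \<open>\<phi> p y\<close> of the left inverse as weights, the
        linear form is the coordinate of v at y, since the maps \<open>\<phi> p\<close> jointly
        separate points.\<close>
      have "(\<Prod>p<m. \<Sum>r<n p. h p (\<phi> p y) r * g p r (\<phi> p x)) = fone y x" if x: "x < N" for x
      proof -
        have "(\<Prod>p<m. \<Sum>r<n p. h p (\<phi> p y) r * g p r (\<phi> p x)) = (\<Prod>p<m. fone (\<phi> p y) (\<phi> p x))"
          using h \<phi> x y by (intro prod.cong refl) (simp add: feq_def fmult_def)
        also have "\<dots> = fone y x"
          using inj[OF y x] by (auto simp: fone_def)
        finally show ?thesis .
      qed
      then have "(\<Sum>x<N. v x * fone y x) = 0"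
        using hadamard_sform_zero[OF g \<phi> z, where h="\<lambda>p. h p (\<phi> p y)"] by simp
      then show ?thesis using fvec_fone[OF y, of v] by (simp add: fvec_def mult.commute)
    qed
    with v show False by blast
  qed
  moreover have "fherm N (hadamard m \<phi> A)"
    using A \<phi> by (intro fherm_hadamard[of m n]) (auto simp: fpd_def)
  ultimately show ?thesis by (simp add: fpd_def)
qed

subsection \<open>A correlation inequality\<close>

lemma prod_unit_interval:
  fixes x :: "'a \<Rightarrow> real"
  assumes "\<And>p. p \<in> S \<Longrightarrow> 0 \<le> x p \<and> x p \<le> 1"
  shows "0 \<le> prod x S" "prod x S \<le> 1"
  using assms by (auto intro!: prod_nonneg prod_le_1)

lemma prod_eq_one_imp:
  fixes x :: "'a \<Rightarrow> real"
  assumes "finite S" "\<And>p. p \<in> S \<Longrightarrow> 0 \<le> x p \<and> x p \<le> 1" "prod x S = 1" "p \<in> S"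
  shows "x p = 1"
proof -
  have "prod x S = x p * prod x (S - {p})" using assms by (simp add: prod.remove)
  also have "\<dots> \<le> x p * 1" using assms by (intro mult_left_mono prod_le_1) auto
  finally show ?thesis using assms by force
qed

text \<open>The probability that some \<open>E p\<close> and some \<open>F q\<close> occur, for independent events of probability
  \<open>x p\<close> and \<open>y q\<close>, is at least the probability that \<open>E p\<close> and \<open>F p\<close> occur for a common \<open>p\<close>.\<close>
lemma union_prob_mult:
  fixes x y :: "nat \<Rightarrow> real"
  assumes "\<And>p. p < m \<Longrightarrow> 0 \<le> x p \<and> x p \<le> 1" "\<And>p. p < m \<Longrightarrow> 0 \<le> y p \<and> y p \<le> 1"
  shows "1 - (\<Prod>p<m. 1 - x p * y p) \<le> (1 - (\<Prod>p<m. 1 - x p)) * (1 - (\<Prod>p<m. 1 - y p))"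
  using assms
proof (induction m)
  case (Suc m)
  define X Y Z where "X = (\<Prod>p<m. 1 - x p)" and "Y = (\<Prod>p<m. 1 - y p)" and "Z = (\<Prod>p<m. 1 - x p * y p)"
  define a b where "a = x m" and "b = y m"
  have ab: "0 \<le> a" "a \<le> 1" "0 \<le> b" "b \<le> 1" using Suc.prems by (auto simp: a_def b_def)
  have XY: "0 \<le> X" "X \<le> 1" "0 \<le> Y" "Y \<le> 1"
    using prod_unit_interval[of "{..<m}" "\<lambda>p. 1 - x p"] prod_unit_interval[of "{..<m}" "\<lambda>p. 1 - y p"] Suc.prems
    by (auto simp: X_def Y_def)
  have "1 - Z \<le> (1 - X) * (1 - Y)" unfolding X_def Y_def Z_def using Suc by simp
  then have "(1 - (1 - X) * (1 - Y)) * (1 - a * b) \<le> Z * (1 - a * b)"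
    using ab by (intro mult_right_mono) (auto simp: mult_le_one)
  moreover have "0 \<le> X * a * (1 - b) * (1 - Y)" "0 \<le> Y * b * (1 - a) * (1 - X)" using ab XY by auto
  \<comment> \<open>The slack of adding one event on each side, beyond that of the induction
    hypothesis. The equality case below rests on the vanishing of these two nonnegative
    terms.\<close>
  moreover have "(1 - (1 - X) * (1 - Y)) * (1 - a * b) - (1 - (1 - X * (1 - a)) * (1 - Y * (1 - b)))
      = X * a * (1 - b) * (1 - Y) + Y * b * (1 - a) * (1 - X)" by (simp add: algebra_simps)
  ultimately have "1 - Z * (1 - a * b) \<le> (1 - X * (1 - a)) * (1 - Y * (1 - b))" by linarith
  then show ?case by (simp add: X_def Y_def Z_def a_def b_def)
qed simp

text \<open>Equality makes both slack terms in the induction step of \<open>union_prob_mult\<close>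
  vanish. Unless both new events are certain, it follows for each side that the new event is certain
  or some old event of the other side is; the induction hypothesis aligns these
  alternatives.\<close>

lemma union_prob_mult_eq:
  fixes x y :: "nat \<Rightarrow> real"
  assumes "\<And>p. p < m \<Longrightarrow> 0 < x p \<and> x p \<le> 1" "\<And>p. p < m \<Longrightarrow> 0 < y p \<and> y p \<le> 1"
    and "1 - (\<Prod>p<m. 1 - x p * y p) = (1 - (\<Prod>p<m. 1 - x p)) * (1 - (\<Prod>p<m. 1 - y p))"
  shows "m \<le> 1 \<or> (\<exists>p<m. x p = 1 \<and> y p = 1) \<or> (\<forall>p<m. x p = 1) \<or> (\<forall>p<m. y p = 1)"
  using assms
proof (induction m)
  case (Suc m)
  define X Y Z where "X = (\<Prod>p<m. 1 - x p)" and "Y = (\<Prod>p<m. 1 - y p)" and "Z = (\<Prod>p<m. 1 - x p * y p)"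
  define a b where "a = x m" and "b = y m"
  have ab: "0 < a" "a \<le> 1" "0 < b" "b \<le> 1" using Suc.prems by (auto simp: a_def b_def)
  have XY: "0 \<le> X" "X \<le> 1" "0 \<le> Y" "Y \<le> 1"
    using prod_unit_interval[of "{..<m}" "\<lambda>p. 1 - x p"] prod_unit_interval[of "{..<m}" "\<lambda>p. 1 - y p"] Suc.prems
    by (auto simp: X_def Y_def less_imp_le)
  have ZXY: "1 - Z \<le> (1 - X) * (1 - Y)"
    unfolding X_def Y_def Z_def using Suc.prems by (intro union_prob_mult) (auto simp: less_imp_le)
  have eq: "1 - Z * (1 - a * b) = (1 - X * (1 - a)) * (1 - Y * (1 - b))"
    using Suc.prems(3) by (simp add: X_def Y_def Z_def a_def b_def)
  have nn: "0 \<le> X * a * (1 - b) * (1 - Y)" "0 \<le> Y * b * (1 - a) * (1 - X)" using ab XY by auto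
  have id: "(1 - (1 - X) * (1 - Y)) * (1 - a * b) - (1 - (1 - X * (1 - a)) * (1 - Y * (1 - b)))
      = X * a * (1 - b) * (1 - Y) + Y * b * (1 - a) * (1 - X)" by (simp add: algebra_simps)
  show ?case
  proof (cases "m = 0 \<or> (a = 1 \<and> b = 1)")
    case True
    then show ?thesis by (auto simp: a_def b_def)
  next
    case False
    then have m: "0 < m" by simp
    have ab1: "a * b < 1"
    proof (cases "a = 1")
      case True then show ?thesis using False ab by auto
    next
      case f: False
      have "a * b \<le> a * 1" using ab by (intro mult_left_mono) auto
      then show ?thesis using ab f by linarith
    qed
    have le: "(1 - (1 - X) * (1 - Y)) * (1 - a * b) \<le> Z * (1 - a * b)"
      using ab1 ZXY by (intro mult_right_mono) auto
    have z1: "X * a * (1 - b) * (1 - Y) = 0" "Y * b * (1 - a) * (1 - X) = 0"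
      and "(1 - (1 - X) * (1 - Y)) * (1 - a * b) = Z * (1 - a * b)"
      using nn id eq le by linarith+
    then have "1 - Z = (1 - X) * (1 - Y)" using ab1 by simp
    then have IH: "m \<le> 1 \<or> (\<exists>p<m. x p = 1 \<and> y p = 1) \<or> (\<forall>p<m. x p = 1) \<or> (\<forall>p<m. y p = 1)"
      using Suc by (simp add: X_def Y_def Z_def)
    have lt1: "(\<Prod>p<m. 1 - u p) \<noteq> 1" if "\<And>p. p < m \<Longrightarrow> 0 < u p \<and> u p \<le> 1" for u :: "nat \<Rightarrow> real"
    proof
      assume "(\<Prod>p<m. 1 - u p) = 1"
      then have "1 - u 0 = 1"
        using m that by (intro prod_eq_one_imp[of "{..<m}" "\<lambda>p. 1 - u p" 0]) (auto simp: less_imp_le)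
      then show False using that[OF m] by simp
    qed
    have "X \<noteq> 1" "Y \<noteq> 1" unfolding X_def Y_def using Suc.prems by (auto intro!: lt1)
    then have c1: "b = 1 \<or> X = 0" and c2: "a = 1 \<or> Y = 0" using z1 ab by auto
    have X0: "\<exists>p<m. x p = 1" if "X = 0" using that by (auto simp: X_def)
    have Y0: "\<exists>p<m. y p = 1" if "Y = 0" using that by (auto simp: Y_def)
    consider "X = 0" "Y = 0" | "b = 1" "Y = 0" | "a = 1" "X = 0" using c1 c2 False by auto
    then show ?thesis
    proof cases
      case 1
      from X0[OF 1(1)] Y0[OF 1(2)] obtain p q where pq: "p < m" "x p = 1" "q < m" "y q = 1" by blast
      have "\<exists>p<m. x p = 1 \<and> y p = 1"
      proof (cases "m = 1")
        case True then show ?thesis using pq by auto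
      next
        case False then show ?thesis using IH m pq by auto
      qed
      then show ?thesis using less_SucI by blast
    next
      case 2
      from Y0[OF 2(2)] obtain q where q: "q < m" "y q = 1" by blast
      have "(\<exists>p<m. x p = 1 \<and> y p = 1) \<or> (\<forall>p<m. y p = 1)"
      proof (cases "m = 1")
        case True then show ?thesis using q by auto
      next
        case False then show ?thesis using IH m q by auto
      qed
      then show ?thesis using 2(1) by (auto simp: b_def less_Suc_eq)
    next
      case 3
      from X0[OF 3(2)] obtain q where q: "q < m" "x q = 1" by blast
      have "(\<exists>p<m. x p = 1 \<and> y p = 1) \<or> (\<forall>p<m. x p = 1)"
      proof (cases "m = 1")
        case True then show ?thesis using q by auto
      next
        case False then show ?thesis using IH m q by auto
      qed
      then show ?thesis using 3(1) by (auto simp: a_def less_Suc_eq)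
    qed
  qed
qed simp

lemma union_prob_pos:
  fixes x :: "nat \<Rightarrow> real"
  assumes "1 \<le> m" "\<And>p. p < m \<Longrightarrow> 0 < x p \<and> x p \<le> 1"
  shows "0 < 1 - (\<Prod>p<m. 1 - x p)"
proof -
  have "(\<Prod>p<m. 1 - x p) \<noteq> 1"
  proof
    assume "(\<Prod>p<m. 1 - x p) = 1"
    then have "1 - x 0 = 1"
      using assms by (intro prod_eq_one_imp[of "{..<m}" "\<lambda>p. 1 - x p" 0]) (auto simp: less_imp_le)
    then show False using assms(2)[of 0] assms(1) by simp
  qed
  moreover have "(\<Prod>p<m. 1 - x p) \<le> 1" using assms(2) by (intro prod_unit_interval) (auto simp: less_imp_le)
  ultimately show ?thesis by simp
qed

text \<open>Columns are merged one at a time: \<open>union_prob_mult\<close> is applied to the row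
  products of the first N columns and to column N.\<close>

lemma union_prob_prod:
  fixes x :: "nat \<Rightarrow> nat \<Rightarrow> real"
  assumes "1 \<le> m" "\<And>p j. p < m \<Longrightarrow> j < N \<Longrightarrow> 0 < x p j \<and> x p j \<le> 1"
  shows "1 - (\<Prod>p<m. 1 - (\<Prod>j<N. x p j)) \<le> (\<Prod>j<N. 1 - (\<Prod>p<m. 1 - x p j))"
  using assms(2)
proof (induction N)
  case 0
  \<comment> \<open>With no columns the left side is 1 - 0^m, which is 1 because m \<ge> 1.\<close>
  then show ?case using assms(1) by (simp add: power_0_left)
next
  case (Suc N)
  have "1 - (\<Prod>p<m. 1 - (\<Prod>j<Suc N. x p j)) \<le> (1 - (\<Prod>p<m. 1 - (\<Prod>j<N. x p j))) * (1 - (\<Prod>p<m. 1 - x p N))"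
    unfolding prod.lessThan_Suc using Suc.prems
    by (intro union_prob_mult conjI prod_unit_interval) (auto simp: less_imp_le)
  also have "\<dots> \<le> (\<Prod>j<N. 1 - (\<Prod>p<m. 1 - x p j)) * (1 - (\<Prod>p<m. 1 - x p N))"
    using Suc union_prob_pos[OF assms(1), of "\<lambda>p. x p N"] by (intro mult_right_mono) (auto simp: less_imp_le)
  finally show ?case by simp
qed

text \<open>Equality must hold at every merging of a column. A row whose product so far and whose
  new entry are both 1 is excluded by assumption, so either all earlier columns or the new one are
  constantly 1. At most one column escapes, which is expressed through pairs.\<close>

lemma union_prob_prod_eq:
  fixes x :: "nat \<Rightarrow> nat \<Rightarrow> real"
  assumes "2 \<le> m" "\<And>p j. p < m \<Longrightarrow> j < N \<Longrightarrow> 0 < x p j \<and> x p j \<le> 1"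
    and "1 - (\<Prod>p<m. 1 - (\<Prod>j<N. x p j)) = (\<Prod>j<N. 1 - (\<Prod>p<m. 1 - x p j))"
    and "\<And>p. p < m \<Longrightarrow> \<exists>j<N. x p j \<noteq> 1"
    and "i < N" "j < N" "i \<noteq> j"
  shows "(\<forall>p<m. x p i = 1) \<or> (\<forall>p<m. x p j = 1)"
  using assms(2-)
proof (induction N arbitrary: i j)
  case (Suc N)
  have m1: "1 \<le> m" using assms(1) by simp
  define G where "G = (\<Prod>j<N. 1 - (\<Prod>p<m. 1 - x p j))"
  define g where "g = 1 - (\<Prod>p<m. 1 - x p N)"
  define X where "X = (\<lambda>p. \<Prod>j<N. x p j)"
  have X: "0 < X p \<and> X p \<le> 1" if "p < m" for p
    using Suc.prems(1) that unfolding X_def by (intro conjI prod_pos prod_unit_interval) (auto simp: less_imp_le)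
  have g: "0 < g" unfolding g_def using Suc.prems(1) by (intro union_prob_pos m1) auto
  have 1: "1 - (\<Prod>p<m. 1 - X p * x p N) \<le> (1 - (\<Prod>p<m. 1 - X p)) * g"
    unfolding g_def using X Suc.prems(1) by (intro union_prob_mult) (auto simp: less_imp_le)
  have 2: "1 - (\<Prod>p<m. 1 - X p) \<le> G" unfolding X_def G_def
    using Suc.prems(1) by (intro union_prob_prod m1) auto
  have 3: "1 - (\<Prod>p<m. 1 - X p * x p N) = G * g"
    using Suc.prems(2) by (simp add: X_def G_def g_def)
  have "(1 - (\<Prod>p<m. 1 - X p)) * g \<le> G * g" using 2 g by simp
  then have e1: "1 - (\<Prod>p<m. 1 - X p * x p N) = (1 - (\<Prod>p<m. 1 - X p)) * g"
    and "(1 - (\<Prod>p<m. 1 - X p)) * g = G * g" using 1 3 by linarith+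
  then have e2: "1 - (\<Prod>p<m. 1 - X p) = G" using g by simp
  have Xone: "x p j = 1" if "X p = 1" "p < m" "j < N" for p j
    using that Suc.prems(1) unfolding X_def by (intro prod_eq_one_imp[of "{..<N}" "x p" j]) (auto simp: less_imp_le)
  have "m \<le> 1 \<or> (\<exists>p<m. X p = 1 \<and> x p N = 1) \<or> (\<forall>p<m. X p = 1) \<or> (\<forall>p<m. x p N = 1)"
    using X Suc.prems(1) e1 unfolding g_def by (intro union_prob_mult_eq) auto
  moreover have False if "p < m" "X p = 1" "x p N = 1" for p
    using Suc.prems(3)[OF that(1)] Xone[OF that(2,1)] that(3) by (auto simp: less_Suc_eq)
  ultimately consider "\<forall>p<m. X p = 1" | "\<forall>p<m. x p N = 1" using assms(1) by fastforce
  then show ?case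
  proof cases
    case 1
    then show ?thesis using Xone Suc.prems(4-6) by (auto simp: less_Suc_eq)
  next
    case 2
    show ?thesis
    proof (cases "i = N \<or> j = N")
      case True then show ?thesis using 2 by auto
    next
      case False
      have "\<exists>j<N. x p j \<noteq> 1" if "p < m" for p
        using Suc.prems(3)[OF that] 2 that by (auto simp: less_Suc_eq)
      then show ?thesis using False Suc.prems e2 by (intro Suc.IH) (auto simp: X_def G_def)
    qed
  qed
qed simp

subsection \<open>Mixed-radix digits and tensor products\<close>

text \<open>The place value of digit p is \<open>tprod m t (Suc p)\<close>, and
  \<open>tprod m t 0\<close> is the size of the Kronecker product.\<close>

definition tprod :: "nat \<Rightarrow> (nat \<Rightarrow> nat) \<Rightarrow> nat \<Rightarrow> nat" where
  "tprod m t k = (\<Prod>q\<in>{k..<m}. t q)"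

text \<open>The mixed-radix digits of a row index of a Kronecker product of factors of sizes \<open>t 0, \<dots>, t (m-1)\<close>;
  the last factor varies fastest.\<close>
definition digit :: "nat \<Rightarrow> (nat \<Rightarrow> nat) \<Rightarrow> nat \<Rightarrow> nat \<Rightarrow> nat" where
  "digit m t p x = (x div tprod m t (Suc p)) mod t p"

lemma tprod_rec: "p < m \<Longrightarrow> tprod m t p = tprod m t (Suc p) * t p"
  by (simp add: tprod_def prod.atLeast_Suc_lessThan mult.commute)

lemma prod_lessThan_mult:
  fixes f :: "nat \<Rightarrow> 'a::comm_monoid_mult"
  shows "(\<Prod>x<n * c. f x) = (\<Prod>i<n. \<Prod>j<c. f (i * c + j))"
proof (induction n)
  case (Suc n)
  have split: "prod f {..<a + b} = prod f {..<a} * (\<Prod>j<b. f (a + j))" for a b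
    by (induction b) (simp_all add: mult.assoc)
  show ?case using split[of "n * c" c] Suc by (simp add: add.commute)
qed simp

locale mixed_radix =
  fixes m :: nat and t :: "nat \<Rightarrow> nat"
  assumes m_pos: "1 \<le> m" and t_pos: "\<And>p. p < m \<Longrightarrow> 1 \<le> t p"
begin

abbreviation T :: nat where "T \<equiv> tprod m t 0"
abbreviation dig :: "nat \<Rightarrow> nat \<Rightarrow> nat" where "dig \<equiv> digit m t"
abbreviation tens :: "(nat \<Rightarrow> cfun) \<Rightarrow> cfun" where "tens \<equiv> hadamard m dig"

lemma tprod_pos: "0 < tprod m t k"
  unfolding tprod_def using t_pos by (intro prod_pos) force

lemma dig_less: "p < m \<Longrightarrow> dig p x < t p"
  using t_pos[of p] by (simp add: digit_def)

text \<open>Used in contrapositive form: a smaller column index has some smaller digit, so Kronecker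
  products of upper triangular matrices are upper triangular. The induction adds digits starting
  from the least significant one.\<close>

lemma dig_le_imp_le:
  assumes "\<And>p. p < m \<Longrightarrow> dig p x \<le> dig p y" "x < T" "y < T"
  shows "x \<le> y"
proof -
  have "x mod tprod m t k \<le> y mod tprod m t k" if "k \<le> m" for k
    using that
  proof (induction k rule: inc_induct)
    case base
    show ?case by (simp add: tprod_def)
  next
    case (step k)
    have "tprod m t (Suc k) * dig k x \<le> tprod m t (Suc k) * dig k y"
      using assms(1)[of k] step by simp
    then show ?case
      using step unfolding tprod_rec[OF step(2)] mod_mult2_eq digit_def[symmetric] by (intro add_mono)
  qed
  from this[of 0] show ?thesis using assms(2,3) by simp
qed

lemma dig_inj:
  assumes "\<And>p. p < m \<Longrightarrow> dig p x = dig p y" "x < T" "y < T"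
  shows "x = y"
  using dig_le_imp_le[of x y] dig_le_imp_le[of y x] assms by force

lemma bij_dig: "bij_betw (\<lambda>x. \<lambda>p\<in>{..<m}. dig p x) {..<T} (PiE {..<m} (\<lambda>p. {..<t p}))"
proof -
  let ?F = "\<lambda>x. \<lambda>p\<in>{..<m}. dig p x"
  have inj: "inj_on ?F {..<T}"
  proof (rule inj_onI)
    fix x y assume xy: "x \<in> {..<T}" "y \<in> {..<T}" and eq: "?F x = ?F y"
    have "dig p x = dig p y" if "p < m" for p using fun_cong[OF eq, of p] that by simp
    then show "x = y" using dig_inj xy by simp
  qed
  have sub: "?F ` {..<T} \<subseteq> PiE {..<m} (\<lambda>p. {..<t p})" 
    using dig_less by (intro image_subsetI) (simp add: restrict_PiE_iff)
  have "card (?F ` {..<T}) = T" using inj by (simp add: card_image)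
  moreover have "card (PiE {..<m} (\<lambda>p. {..<t p})) = T"
    by (simp add: card_PiE tprod_def lessThan_atLeast0)
  ultimately have "?F ` {..<T} = PiE {..<m} (\<lambda>p. {..<t p})"
    using sub by (intro card_subset_eq finite_PiE) auto
  then show ?thesis using inj by (simp add: bij_betw_def)
qed

lemma sum_dig:
  fixes f :: "nat \<Rightarrow> nat \<Rightarrow> complex"
  shows "(\<Sum>x<T. \<Prod>p<m. f p (dig p x)) = (\<Prod>p<m. \<Sum>a<t p. f p a)"
proof -
  have "(\<Prod>p<m. \<Sum>a<t p. f p a) = (\<Sum>g\<in>PiE {..<m} (\<lambda>p. {..<t p}). \<Prod>p<m. f p (g p))"
    by (rule prod_sum_PiE) auto
  also have "\<dots> = (\<Sum>x<T. \<Prod>p<m. f p ((\<lambda>p\<in>{..<m}. dig p x) p))"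
    by (rule sum.reindex_bij_betw[OF bij_dig, symmetric])
  also have "\<dots> = (\<Sum>x<T. \<Prod>p<m. f p (dig p x))" by (intro sum.cong refl prod.cong) auto
  finally show ?thesis by simp
qed

lemma dig_surj:
  assumes "\<And>p. p < m \<Longrightarrow> f p < t p"
  shows "\<exists>x<T. \<forall>p<m. dig p x = f p"
proof -
  have "restrict f {..<m} \<in> PiE {..<m} (\<lambda>p. {..<t p})" 
    using assms by (simp add: restrict_PiE_iff)
  then have "restrict f {..<m} \<in> (\<lambda>x. \<lambda>p\<in>{..<m}. dig p x) ` {..<T}"
    using bij_betw_imp_surj_on[OF bij_dig] by simp
  then obtain x where x: "x < T" "(\<lambda>p\<in>{..<m}. dig p x) = restrict f {..<m}" by auto
  have "dig p x = f p" if "p < m" for p using fun_cong[OF x(2), of p] that by simp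
  with x(1) show ?thesis by blast
qed

lemma T_factor:
  assumes "p < m" shows "T = (\<Prod>q<p. t q) * t p * tprod m t (Suc p)"
proof -
  have "{0..<m} = {0..<p} \<union> {p..<m}" using assms by auto
  then have "T = (\<Prod>q\<in>{0..<p}. t q) * tprod m t p"
    unfolding tprod_def by (subst prod.union_disjoint[symmetric]) auto
  then show ?thesis by (simp add: tprod_rec[OF assms] lessThan_atLeast0 mult_ac)
qed

text \<open>The origin of the exponent \<open>T div t p\<close>: T is (higher places) times
  \<open>t p\<close> times (lower places), and each value of digit p occurs once for every choice of
  the other digits.\<close>

lemma prod_dig:
  fixes h :: "nat \<Rightarrow> 'a::comm_semiring_1"
  assumes "p < m"
  shows "(\<Prod>x<T. h (dig p x)) = (\<Prod>a<t p. h a) ^ (T div t p)"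
proof -
  define a b c where "a = (\<Prod>q<p. t q)" and "b = t p" and "c = tprod m t (Suc p)"
  have bc: "0 < b" "0 < c" using t_pos[OF assms] tprod_pos by (auto simp: b_def c_def)
  have T: "T = (a * b) * c" using T_factor[OF assms] by (simp add: a_def b_def c_def)
  have "(\<Prod>x<T. h (dig p x)) = (\<Prod>i<a * b. \<Prod>j<c. h (i mod b))"
    unfolding T prod_lessThan_mult using bc by (simp add: digit_def b_def c_def)
  also have "\<dots> = (\<Prod>i<a. \<Prod>j<b. h j ^ c)"
    unfolding prod_lessThan_mult by simp
  also have "\<dots> = (\<Prod>j<b. h j) ^ (a * c)"
    by (simp add: prod_power_distrib[symmetric] power_mult[symmetric] mult.commute)
  also have "a * c = T div t p" unfolding T using bc by (simp add: b_def)
  finally show ?thesis by (simp add: b_def)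
qed

lemma tens_mult: "fmult T (tens A) (tens B) x y = tens (\<lambda>p. fmult (t p) (A p) (B p)) x y"
proof -
  have "fmult T (tens A) (tens B) x y = (\<Sum>z<T. \<Prod>p<m. A p (dig p x) (dig p z) * B p (dig p z) (dig p y))"
    by (simp add: fmult_def hadamard_def prod.distrib)
  also have "\<dots> = (\<Prod>p<m. \<Sum>a<t p. A p (dig p x) a * B p a (dig p y))"
    by (rule sum_dig)
  finally show ?thesis by (simp add: fmult_def hadamard_def)
qed

lemma tens_fone: "x < T \<Longrightarrow> y < T \<Longrightarrow> tens (\<lambda>_. fone) x y = fone x y"
  using dig_inj[of x y] by (auto simp: hadamard_def fone_def)

lemma tens_cong:
  assumes "\<And>p. p < m \<Longrightarrow> feq (t p) (A p) (B p)"
  shows "tens A x y = tens B x y"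
  unfolding hadamard_def using assms dig_less by (intro prod.cong refl) (simp add: feq_def)

lemma tens_upper:
  assumes "\<And>p. p < m \<Longrightarrow> fupper (t p) (U p)"
  shows "fupper T (tens U)"
  unfolding fupper_def
proof (intro allI impI)
  fix x y assume x: "x < T" and y: "y < x"
  have "\<exists>p<m. dig p y < dig p x"
  proof (rule ccontr)
    assume "\<not> ?thesis"
    then have "\<And>p. p < m \<Longrightarrow> dig p x \<le> dig p y" by (meson not_less)
    then have "x \<le> y" using x y by (intro dig_le_imp_le[of x y]) auto
    then show False using y by simp
  qed
  then obtain p where "p < m" "dig p y < dig p x" by blast
  then have "U p (dig p x) (dig p y) = 0" using assms dig_less by (simp add: fupper_def)
  then show "tens U x y = 0" using \<open>p < m\<close> by (auto simp: hadamard_def)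
qed

lemma tens_inverse:
  assumes "\<And>p. p < m \<Longrightarrow> finverse (t p) (P p) (Q p)"
  shows "finverse T (tens P) (tens Q)"
proof -
  have "tens (\<lambda>p. fmult (t p) (P p) (Q p)) x y = tens (\<lambda>_. fone) x y"
    "tens (\<lambda>p. fmult (t p) (Q p) (P p)) x y = tens (\<lambda>_. fone) x y" for x y
    using assms by (auto intro!: tens_cong simp: finverse_def)
  then show ?thesis by (simp add: finverse_def feq_def tens_mult tens_fone)
qed

lemma fdet_tens_upper:
  assumes "\<And>p. p < m \<Longrightarrow> fupper (t p) (U p)"
  shows "fdet T (tens U) = (\<Prod>p<m. (\<Prod>k<t p. U p k k) ^ (T div t p))"
proof -
  have "fdet T (tens U) = (\<Prod>x<T. tens U x x)"
    using tens_upper[OF assms] by (intro fdet_upper_triangular) (simp add: fupper_def)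
  also have "\<dots> = (\<Prod>p<m. \<Prod>x<T. U p (dig p x) (dig p x))"
    unfolding hadamard_def by (rule prod.swap)
  also have "\<dots> = (\<Prod>p<m. (\<Prod>k<t p. U p k k) ^ (T div t p))"
    by (intro prod.cong refl prod_dig[where h="\<lambda>k. U _ k k"]) simp
  finally show ?thesis .
qed

lemma fdet_tens: "fdet T (tens A) = (\<Prod>p<m. fdet (t p) (A p) ^ (T div t p))"
proof -
  have "\<forall>p. \<exists>P U Q. finverse (t p) P Q \<and> feq (t p) (A p) (fmult (t p) P (fmult (t p) U Q)) \<and> fupper (t p) U"
    using triangularization by blast
  then obtain P U Q where inv: "\<And>p. finverse (t p) (P p) (Q p)"
    and eq: "\<And>p. feq (t p) (A p) (fmult (t p) (P p) (fmult (t p) (U p) (Q p)))"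
    and up: "\<And>p. fupper (t p) (U p)" by metis
  have "tens A x y = fmult T (tens P) (fmult T (tens U) (tens Q)) x y" for x y
  proof -
    have "tens A x y = tens (\<lambda>p. fmult (t p) (P p) (fmult (t p) (U p) (Q p))) x y"
      using eq by (intro tens_cong)
    also have "\<dots> = fmult T (tens P) (tens (\<lambda>p. fmult (t p) (U p) (Q p))) x y" by (simp add: tens_mult)
    also have "\<dots> = fmult T (tens P) (fmult T (tens U) (tens Q)) x y"
      by (intro fmult_cong refl) (simp add: tens_mult)
    finally show ?thesis .
  qed
  then have "fdet T (tens A) = fdet T (fmult T (tens P) (fmult T (tens U) (tens Q)))"
    by (intro fdet_cong) simp
  also have "\<dots> = (fdet T (tens P) * fdet T (tens Q)) * fdet T (tens U)" by (simp add: fdet_mult mult_ac)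
  also have "\<dots> = (\<Prod>p<m. (\<Prod>k<t p. U p k k) ^ (T div t p))"
    using fdet_finverse[OF tens_inverse, of P Q] inv up by (simp add: fdet_tens_upper)
  also have "\<dots> = (\<Prod>p<m. fdet (t p) (A p) ^ (T div t p))"
  proof (intro prod.cong refl arg_cong2[where f=power])
    fix p
    \<comment> \<open>Relative to the identity, \<open>fdet_relative\<close> identifies the product
      of the diagonal of \<open>U p\<close> with the determinant of \<open>A p\<close>.\<close>
    have "feq (t p) (A p) (fmult (t p) fone (fmult (t p) (P p) (fmult (t p) (U p) (Q p))))"
      using eq[of p] by (simp add: feq_def fmult_fone_left)
    from fdet_relative[OF inv this up] show "(\<Prod>k<t p. U p k k) = fdet (t p) (A p)"
      by (simp add: fdet_one)
  qed
  finally show ?thesis .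
qed

section \<open>Differences of Kronecker products\<close>

lemma fpd_tens:
  assumes "\<And>p. p < m \<Longrightarrow> fpd (t p) (A p)" shows "fpd T (tens A)"
  using assms dig_less dig_inj by (intro fpd_hadamard[of m t]) auto

text \<open>Writing \<open>A = (A - B) + B\<close> and multiplying out gives one term for each set
  of factors that contribute \<open>A - B\<close>. The full set gives a definite term, the empty set
  cancels, and the mixed terms are semidefinite by their Gram factors.\<close>

lemma fpd_tens_diff:
  assumes A: "\<And>p. p < m \<Longrightarrow> fpd (t p) (\<lambda>i j. A p i j - B p i j)"
    and B: "\<And>p. p < m \<Longrightarrow> gram (k p) (t p) (B p) (g p)"
    and herm: "\<And>p. p < m \<Longrightarrow> fherm (t p) (B p)"
  shows "fpd T (\<lambda>x y. tens A x y - tens B x y)"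
proof -
  define C where "C = (\<lambda>S p i j. if p \<in> S then A p i j - B p i j else B p i j)"
  define \<S> where "\<S> = Pow {..<m} - {{}} - {{..<m}}"
  have fin: "finite \<S>" by (simp add: \<S>_def)
  have Pow: "Pow {..<m} = insert {} (insert {..<m} \<S>)" by (auto simp: \<S>_def)
  have expand: "tens A x y - tens B x y = tens (\<lambda>p i j. A p i j - B p i j) x y + (\<Sum>S\<in>\<S>. tens (C S) x y)"
    for x y
  proof -
    define f h where "f = (\<lambda>p. A p (dig p x) (dig p y) - B p (dig p x) (dig p y))"
      and "h = (\<lambda>p. B p (dig p x) (dig p y))"
    have term_eq: "prod f S * prod h ({..<m} - S) = tens (C S) x y" if "S \<subseteq> {..<m}" for S
    proof -
      have "tens (C S) x y = (\<Prod>p<m. if p \<in> S then f p else h p)"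
        by (simp add: hadamard_def C_def f_def h_def if_distrib cong: if_cong)
      also have "\<dots> = prod f ({..<m} \<inter> {p. p \<in> S}) * prod h ({..<m} \<inter> - {p. p \<in> S})"
        by (rule prod.If_cases) simp
      also have "{..<m} \<inter> {p. p \<in> S} = S" using that by auto
      also have "{..<m} \<inter> - {p. p \<in> S} = {..<m} - S" by auto
      finally show ?thesis by simp
    qed
    have "tens A x y = (\<Prod>p<m. f p + h p)" by (simp add: hadamard_def f_def h_def)
    also have "\<dots> = (\<Sum>S\<in>Pow {..<m}. prod f S * prod h ({..<m} - S))" by (rule prod_add) simp
    also have "\<dots> = (\<Sum>S\<in>Pow {..<m}. tens (C S) x y)" using term_eq by (intro sum.cong) auto
    also have "\<dots> = tens (C {}) x y + (tens (C {..<m}) x y + (\<Sum>S\<in>\<S>. tens (C S) x y))"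
    proof -
      have "0 \<in> {..<m}" using m_pos by simp
      then have "{} \<noteq> {..<m}" by blast
      then have "{} \<notin> insert {..<m} \<S>" "{..<m} \<notin> \<S>" by (auto simp: \<S>_def)
      then show ?thesis unfolding Pow using fin by simp
    qed
    finally show ?thesis by (simp add: C_def hadamard_def)
  qed
  have gramA: "\<exists>g. gram (t p) (t p) (\<lambda>i j. A p i j - B p i j) g" if "p < m" for p
    by (rule fpd_gram[OF A[OF that]])
  have psd: "fpsd T (tens (C S))" for S
  proof -
    have "\<forall>p. \<exists>k' g'. p < m \<longrightarrow> gram k' (t p) (C S p) g'"
    proof
      fix p show "\<exists>k' g'. p < m \<longrightarrow> gram k' (t p) (C S p) g'"
      proof (cases "p \<in> S")
        case True then show ?thesis using gramA[of p] by (auto simp: C_def)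
      next
        case False
        then have "C S p = B p" by (simp add: C_def)
        then show ?thesis using B[of p] by auto
      qed
    qed
    then obtain k' g' where "\<And>p. p < m \<Longrightarrow> gram (k' p) (t p) (C S p) (g' p)" by metis
    then have "0 \<le> Re (sform T (tens (C S)) v v)" for v
      by (rule hadamard_sform_nonneg[where n=t and k=k' and g=g']) (simp_all add: dig_less)
    moreover have "fherm T (tens (C S))"
    proof (rule fherm_hadamard[of m t])
      fix p assume p: "p < m"
      show "fherm (t p) (C S p)"
        using A[OF p] herm[OF p] by (cases "p \<in> S") (auto simp: C_def fpd_def)
    qed (rule dig_less)
    ultimately show ?thesis by (simp add: fpsd_def)
  qed
  have "fpsd T (\<lambda>x y. \<Sum>S\<in>\<S>. tens (C S) x y)"
    using fin
  proof (induction \<S> rule: finite_induct)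
    case empty
    show ?case by (simp add: fpsd_def fherm_def sform_def)
  next
    case (insert S \<F>)
    then show ?case using psd[of S] by (auto simp: fpsd_def sform_mat_add intro: fherm_add)
  qed
  from fpd_add_fpsd[OF fpd_tens[OF A] this] show ?thesis by (simp add: expand)
qed

text \<open>If \<open>A\<^sup>-\<^sup>1 (A - B) = P U Q\<close>, then
  \<open>A\<^sup>-\<^sup>1 B = P (I - U) Q\<close>. Tensoring the latter and subtracting from the
  identity leaves the triangular matrix \<open>R\<close>, with diagonal entries 1 minus a product of
  terms 1 - lam.\<close>

lemma fdet_tens_diff:
  assumes A: "\<And>p. p < m \<Longrightarrow> fpd (t p) (A p)"
    and \<alpha>: "\<And>p. p < m \<Longrightarrow> fpd (t p) (\<lambda>i j. A p i j - B p i j)"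
    and B: "\<And>p. p < m \<Longrightarrow> fpsd (t p) (B p)"
  shows "\<exists>lam. fdet T (\<lambda>x y. tens A x y - tens B x y)
        = fdet T (tens A) * of_real (\<Prod>x<T. 1 - (\<Prod>p<m. 1 - lam p (dig p x)))
      \<and> (\<forall>p<m. \<forall>k<t p. 0 < lam p k \<and> lam p k \<le> 1)
      \<and> (\<forall>p<m. Re (fdet (t p) (\<lambda>i j. A p i j - B p i j)) = Re (fdet (t p) (A p)) * (\<Prod>k<t p. lam p k))"
proof -
  define good where "good = (\<lambda>p P U Q lam. finverse (t p) P Q
    \<and> feq (t p) (\<lambda>i j. A p i j - B p i j) (fmult (t p) (A p) (fmult (t p) P (fmult (t p) U Q))) \<and> fupper (t p) U
    \<and> (\<forall>k<t p. U k k = complex_of_real (lam k) \<and> 0 < lam k \<and> lam k \<le> 1))"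
  have "\<exists>P U Q lam. good p P U Q lam" if "p < m" for p
  proof -
    have "fpsd (t p) (\<lambda>i j. A p i j - (A p i j - B p i j))" using B[OF that] by simp
    with relative_triangularization[OF A[OF that] \<alpha>[OF that]] show ?thesis
      unfolding good_def by blast
  qed
  then obtain P U Q lam where good: "\<And>p. p < m \<Longrightarrow> good p (P p) (U p) (Q p) (lam p)" by metis
  have inv: "\<And>p. p < m \<Longrightarrow> finverse (t p) (P p) (Q p)"
    and eq: "\<And>p. p < m \<Longrightarrow> feq (t p) (\<lambda>i j. A p i j - B p i j)
        (fmult (t p) (A p) (fmult (t p) (P p) (fmult (t p) (U p) (Q p))))"
    and up: "\<And>p. p < m \<Longrightarrow> fupper (t p) (U p)"
    and lam: "\<And>p k. p < m \<Longrightarrow> k < t p \<Longrightarrow> U p k k = complex_of_real (lam p k) \<and> 0 < lam p k \<and> lam p k \<le> 1"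
    using good unfolding good_def by auto
  define S where "S = (\<lambda>p i j. fone i j - U p i j)"
  have upS: "fupper (t p) (S p)" if "p < m" for p
    using up[OF that] by (simp add: fupper_def S_def fone_def)
  have BS: "feq (t p) (B p) (fmult (t p) (A p) (fmult (t p) (P p) (fmult (t p) (S p) (Q p))))" if p: "p < m" for p
    unfolding feq_def
  proof (intro allI impI)
    fix i j assume ij: "i < t p" "j < t p"
    let ?n = "t p" and ?A = "A p" and ?P = "P p" and ?Q = "Q p" and ?U = "U p" and ?S = "S p"
    have "fmult ?n ?S ?Q k j = ?Q k j - fmult ?n ?U ?Q k j" if "k < ?n" for k
      using fmult_fone_left[OF that, of ?Q j]
      by (simp add: S_def fmult_def algebra_simps sum_subtractf)
    then have "fmult ?n ?P (fmult ?n ?S ?Q) k j = fmult ?n ?P (\<lambda>k j. ?Q k j - fmult ?n ?U ?Q k j) k j" for k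
      by (intro fmult_cong) auto
    then have "fmult ?n ?P (fmult ?n ?S ?Q) k j = fmult ?n ?P ?Q k j - fmult ?n ?P (fmult ?n ?U ?Q) k j" for k
      by (simp add: fmult_def[of ?n ?P] right_diff_distrib sum_subtractf)
    then have "fmult ?n ?A (fmult ?n ?P (fmult ?n ?S ?Q)) i j
        = fmult ?n ?A (fmult ?n ?P ?Q) i j - fmult ?n ?A (fmult ?n ?P (fmult ?n ?U ?Q)) i j"
      by (simp add: fmult_def[of ?n ?A] right_diff_distrib sum_subtractf)
    moreover have "fmult ?n ?A (fmult ?n ?P ?Q) i j = fmult ?n ?A fone i j"
      using inv[OF p] ij by (intro fmult_cong[OF refl]) (simp add: finverse_def feq_def)
    moreover have "fmult ?n ?A (fmult ?n ?P (fmult ?n ?U ?Q)) i j = ?A i j - B p i j"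
      using eq[OF p] ij by (simp add: feq_def)
    ultimately show "B p i j = fmult ?n ?A (fmult ?n ?P (fmult ?n ?S ?Q)) i j"
      using ij by (simp add: fmult_fone_right)
  qed
  have tensB: "tens B x y = fmult T (tens A) (fmult T (tens P) (fmult T (tens S) (tens Q))) x y" for x y
  proof -
    have "tens B x y = tens (\<lambda>p. fmult (t p) (A p) (fmult (t p) (P p) (fmult (t p) (S p) (Q p)))) x y"
      using BS by (intro tens_cong)
    also have "\<dots> = fmult T (tens A) (tens (\<lambda>p. fmult (t p) (P p) (fmult (t p) (S p) (Q p)))) x y"
      by (simp add: tens_mult)
    also have "\<dots> = fmult T (tens A) (fmult T (tens P) (tens (\<lambda>p. fmult (t p) (S p) (Q p)))) x y"
      by (intro fmult_cong refl) (simp add: tens_mult)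
    also have "\<dots> = fmult T (tens A) (fmult T (tens P) (fmult T (tens S) (tens Q))) x y"
      by (intro fmult_cong refl) (simp add: tens_mult)
    finally show ?thesis .
  qed
  define R where "R = (\<lambda>x y. fone x y - tens S x y)"
  have inv_T: "finverse T (tens P) (tens Q)" by (rule tens_inverse[OF inv])
  have diff: "feq T (\<lambda>x y. tens A x y - tens B x y) (fmult T (tens A) (fmult T (tens P) (fmult T R (tens Q))))"
    unfolding feq_def
  proof (intro allI impI)
    fix x y assume xy: "x < T" "y < T"
    let ?A = "tens A" and ?P = "tens P" and ?Q = "tens Q" and ?S = "tens S"
    have "fmult T R ?Q k y = ?Q k y - fmult T ?S ?Q k y" if "k < T" for k
      using fmult_fone_left[OF that, of ?Q y]
      by (simp add: R_def fmult_def algebra_simps sum_subtractf)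
    then have "fmult T ?P (fmult T R ?Q) k y = fmult T ?P (\<lambda>k j. ?Q k j - fmult T ?S ?Q k j) k y" for k
      by (intro fmult_cong) auto
    then have "fmult T ?P (fmult T R ?Q) k y = fmult T ?P ?Q k y - fmult T ?P (fmult T ?S ?Q) k y" for k
      by (simp add: fmult_def[of T ?P] right_diff_distrib sum_subtractf)
    then have "fmult T ?A (fmult T ?P (fmult T R ?Q)) x y
        = fmult T ?A (fmult T ?P ?Q) x y - fmult T ?A (fmult T ?P (fmult T ?S ?Q)) x y"
      by (simp add: fmult_def[of T ?A] right_diff_distrib sum_subtractf)
    moreover have "fmult T ?A (fmult T ?P ?Q) x y = fmult T ?A fone x y"
      using inv_T xy by (intro fmult_cong[OF refl]) (simp add: finverse_def feq_def)
    ultimately show "tens A x y - tens B x y = fmult T ?A (fmult T ?P (fmult T R ?Q)) x y"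
      using xy by (simp add: fmult_fone_right tensB)
  qed
  have upR: "fupper T R" using tens_upper[OF upS] by (auto simp: fupper_def R_def fone_def)
  have "R x x = of_real (1 - (\<Prod>p<m. 1 - lam p (dig p x)))" for x
    using lam dig_less by (simp add: R_def S_def hadamard_def fone_def)
  then have 1: "fdet T (\<lambda>x y. tens A x y - tens B x y)
        = fdet T (tens A) * of_real (\<Prod>x<T. 1 - (\<Prod>p<m. 1 - lam p (dig p x)))"
    using fdet_relative[OF inv_T diff upR] by simp
  have 2: "Re (fdet (t p) (\<lambda>i j. A p i j - B p i j)) = Re (fdet (t p) (A p)) * (\<Prod>k<t p. lam p k)" if p: "p < m" for p
  proof -
    have "fdet (t p) (\<lambda>i j. A p i j - B p i j) = fdet (t p) (A p) * of_real (\<Prod>k<t p. lam p k)"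
      using fdet_relative[OF inv[OF p] eq[OF p] up[OF p]] lam[OF p] by simp
    then show ?thesis by (simp del: of_real_prod)
  qed
  show ?thesis using 1 2 lam by blast
qed

end

subsection \<open>Fischer's inequality\<close>

definition dblk :: "nat \<Rightarrow> nat \<Rightarrow> cfun \<Rightarrow> cfun" where
  "dblk t i M = (\<lambda>a b. M (i * t + a) (i * t + b))"

definition block_diagonal :: "nat \<Rightarrow> nat \<Rightarrow> cfun \<Rightarrow> bool" where
  "block_diagonal s t M \<longleftrightarrow>
    (\<forall>i<s. \<forall>j<s. i \<noteq> j \<longrightarrow> (\<forall>a<t. \<forall>b<t. M (i * t + a) (j * t + b) = 0))"

lemma fdet_0: "fdet 0 M = 1"
  using fdet_cong[of 0 M fone] by (simp add: fdet_one)

lemma dblk_ftail: "dblk t i (ftail t M) = dblk t (Suc i) M"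
  by (simp add: dblk_def ftail_def add.assoc)

lemma dblk_0: "dblk t 0 M = M"
  by (simp add: dblk_def)

lemma fpd_dblk:
  assumes "fpd (s * t) M" "i < s" shows "fpd t (dblk t i M)"
  using assms
proof (induction i arbitrary: s M)
  case 0
  then obtain s' where "s = Suc s'" by (cases s) auto
  then show ?case using fpd_head[of t "s' * t" M] 0 by (simp add: dblk_0)
next
  case (Suc i)
  then obtain s' where s: "s = Suc s'" by (cases s) auto
  then have "fpd (s' * t) (ftail t M)" using Suc.prems fpd_tail[of t "s' * t" M] by simp
  then show ?case using Suc.IH[of s' "ftail t M"] Suc.prems s by (simp add: dblk_ftail)
qed

text \<open>Below the diagonal only the first block column is new; the first block row follows by
  Hermitian symmetry.\<close>

lemma block_diagonal_Suc:
  assumes h: "fherm (t + s * t) M"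
  shows "block_diagonal (Suc s) t M \<longleftrightarrow>
    block_diagonal s t (ftail t M) \<and> (\<forall>i<s * t. \<forall>j<t. M (t + i) j = 0)"
proof
  assume L: "block_diagonal (Suc s) t M"
  have "M (t + i) j = 0" if "i < s * t" "j < t" for i j
  proof -
    have "i div t < s" "i mod t < t" using that by (auto simp: less_mult_imp_div_less)
    then have "M (Suc (i div t) * t + i mod t) (0 * t + j) = 0"
      using L that unfolding block_diagonal_def by blast
    then show ?thesis by (simp add: add.assoc)
  qed
  moreover have "block_diagonal s t (ftail t M)"
    unfolding block_diagonal_def ftail_def
  proof (intro allI impI)
    fix i j a b assume "i < s" "j < s" "i \<noteq> j" "a < t" "b < t"
    then have "M (Suc i * t + a) (Suc j * t + b) = 0"
      by (intro L[unfolded block_diagonal_def, rule_format]) auto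
    then show "M (t + (i * t + a)) (t + (j * t + b)) = 0" by (simp add: add.assoc)
  qed
  ultimately show "block_diagonal s t (ftail t M) \<and> (\<forall>i<s * t. \<forall>j<t. M (t + i) j = 0)" by blast
next
  assume R: "block_diagonal s t (ftail t M) \<and> (\<forall>i<s * t. \<forall>j<t. M (t + i) j = 0)"
  have idx: "i * t + a < s * t" if "i < s" "a < t" for i a
  proof -
    have "i * t + a < Suc i * t" using that by simp
    also have "\<dots> \<le> s * t" using that by (intro mult_le_mono1) simp
    finally show ?thesis .
  qed
  have low: "M (Suc i * t + a) b = 0" if "i < s" "a < t" "b < t" for i a b
    using R idx[OF that(1,2)] that(3) by (simp add: add.assoc)
  have up: "M b (Suc i * t + a) = 0" if "i < s" "a < t" "b < t" for i a b
  proof -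
    have "M b (Suc i * t + a) = cnj (M (Suc i * t + a) b)"
      using idx[OF that(1,2)] that by (intro fhermD[OF h]) auto
    then show ?thesis using low[OF that] by simp
  qed
  show "block_diagonal (Suc s) t M"
    unfolding block_diagonal_def
  proof (intro allI impI)
    fix i j a b assume ij: "i < Suc s" "j < Suc s" "i \<noteq> j" and ab: "a < t" "b < t"
    show "M (i * t + a) (j * t + b) = 0"
    proof (cases i)
      case 0
      then obtain j' where "j = Suc j'" using ij by (cases j) auto
      then show ?thesis using up[of j' b a] 0 ij ab by simp
    next
      case (Suc i')
      show ?thesis
      proof (cases j)
        case 0
        then show ?thesis using low[of i' a b] Suc ij ab by simp
      next
        case j: (Suc j')
        then have "ftail t M (i' * t + a) (j' * t + b) = 0"
          using R ij ab Suc unfolding block_diagonal_def by auto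
        then show ?thesis using Suc j by (simp add: ftail_def add.assoc)
      qed
    qed
  qed
qed

context schur begin

text \<open>The diagonal entry \<open>\<beta> j j\<close> is the form of the definite trailing block
  at column j of \<open>V\<close>, so it vanishes only if that column does.\<close>

lemma beta_zero_imp:
  assumes pd: "fpd n (ftail t M)" and z: "\<And>j. j < t \<Longrightarrow> \<beta> j j = 0" and ij: "i < n" "j < t"
  shows "M (t + i) j = 0"
proof -
  have V0: "V l j = 0" if "l < n" for l
    using fpd_sform_zero[OF pd _ that, of "\<lambda>l. V l j"] beta_sform[OF ij(2) ij(2)] z[OF ij(2)] by simp
  then show ?thesis using V[OF ij] by (simp add: fmult_def)
qed

lemma low_zero_imp_beta_zero:
  assumes "\<And>i j. i < n \<Longrightarrow> j < t \<Longrightarrow> M (t + i) j = 0" and ij: "i < t" "j < t"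
  shows "\<beta> i j = 0"
proof -
  have "fvec n (ftail t M) (\<lambda>k. V k j) l = 0" if "l < n" for l
    using V[OF that ij(2)] assms(1)[OF that ij(2)] by (simp add: fvec_def fmult_def)
  then show ?thesis using beta_sform[OF ij] by (simp add: sform_fvec)
qed

lemma fdet_alpha_le:
  assumes pd: "fpd (t + n) M"
  shows "Re (fdet t (\<lambda>i j. M i j - \<beta> i j)) \<le> Re (fdet t M)"
    and "Re (fdet t (\<lambda>i j. M i j - \<beta> i j)) = Re (fdet t M) \<longleftrightarrow> (\<forall>i<n. \<forall>j<t. M (t + i) j = 0)"
proof -
  have psd: "fpsd t (\<lambda>i j. M i j - (M i j - \<beta> i j))"
    using fpsd_beta[OF fpd_imp_fpsd[OF fpd_tail[OF pd]]] by simp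
  show "Re (fdet t (\<lambda>i j. M i j - \<beta> i j)) \<le> Re (fdet t M)"
    by (rule fdet_mono(1)[OF fpd_head[OF pd] fpd_alpha[OF pd] psd])
  show "Re (fdet t (\<lambda>i j. M i j - \<beta> i j)) = Re (fdet t M) \<longleftrightarrow> (\<forall>i<n. \<forall>j<t. M (t + i) j = 0)"
  proof
    assume eq: "Re (fdet t (\<lambda>i j. M i j - \<beta> i j)) = Re (fdet t M)"
    have "\<beta> j j = 0" if "j < t" for j
      using fdet_mono(2)[OF fpd_head[OF pd] fpd_alpha[OF pd] psd eq that that] by simp
    then show "\<forall>i<n. \<forall>j<t. M (t + i) j = 0" using beta_zero_imp[OF fpd_tail[OF pd]] by blast
  next
    assume "\<forall>i<n. \<forall>j<t. M (t + i) j = 0"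
    then have "\<beta> i j = 0" if "i < t" "j < t" for i j using low_zero_imp_beta_zero that by blast
    then have "fdet t (\<lambda>i j. M i j - \<beta> i j) = fdet t M" by (intro fdet_cong) simp
    then show "Re (fdet t (\<lambda>i j. M i j - \<beta> i j)) = Re (fdet t M)" by simp
  qed
qed

lemma Re_fdet_schur:
  assumes pd: "fpd (t + n) M"
  shows "Re (fdet (t + n) M) = Re (fdet t (\<lambda>i j. M i j - \<beta> i j)) * Re (fdet n (ftail t M))"
  unfolding fdet_schur using fpd_fdet_pos(1)[OF fpd_alpha[OF pd]] fpd_fdet_pos(1)[OF fpd_tail[OF pd]]
  by (metis Re_complex_of_real of_real_mult)

end

lemma fpd_schur:
  assumes "fpd (t + n) M" obtains V \<beta> where "schur t n M V \<beta>"
  using schur_exists[OF _ fpd_tail[OF assms]] assms by (auto simp: fpd_def)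

lemma mult_eq_mono:
  fixes a b c d :: real
  assumes "a \<le> b" "c \<le> d" "0 < a" "0 < c" "a * c = b * d"
  shows "a = b" "c = d"
proof -
  have "a * c \<le> b * c" using assms by (intro mult_right_mono) auto
  moreover have "b * c \<le> b * d" using assms by (intro mult_left_mono) auto
  ultimately have "a * c = b * c" "b * c = b * d" using assms by linarith+
  then show "a = b" "c = d" using assms by auto
qed

text \<open>Peeling off the first block, the determinant is that of the Schur complement times that
  of the tail, and \<open>fdet_alpha_le\<close> compares the former with the leading block. All
  factors are positive, so equality of the products forces equality in both comparisons.\<close>

lemma fischer:
  assumes "fpd (s * t) M"
  shows "Re (fdet (s * t) M) \<le> (\<Prod>i<s. Re (fdet t (dblk t i M)))"
    and "Re (fdet (s * t) M) = (\<Prod>i<s. Re (fdet t (dblk t i M))) \<longleftrightarrow> block_diagonal s t M"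
proof -
  have "Re (fdet (s * t) M) \<le> (\<Prod>i<s. Re (fdet t (dblk t i M))) \<and>
    (Re (fdet (s * t) M) = (\<Prod>i<s. Re (fdet t (dblk t i M))) \<longleftrightarrow> block_diagonal s t M)"
    using assms
  proof (induction s arbitrary: M)
    case 0
    show ?case by (simp add: fdet_0 block_diagonal_def)
  next
    case (Suc s)
    have pd: "fpd (t + s * t) M" using Suc.prems by simp
    from fpd_schur[OF pd] obtain V \<beta> where "schur t (s * t) M V \<beta>" .
    then interpret schur t "s * t" M V \<beta> .
    define a b c d where "a = Re (fdet t (\<lambda>i j. M i j - \<beta> i j))" and "b = Re (fdet t M)"
      and "c = Re (fdet (s * t) (ftail t M))" and "d = (\<Prod>i<s. Re (fdet t (dblk t (Suc i) M)))"
    have IH: "c \<le> d" "c = d \<longleftrightarrow> block_diagonal s t (ftail t M)"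
      using Suc.IH[OF fpd_tail[OF pd]] by (simp_all add: dblk_ftail c_def d_def)
    have pos: "0 < a" "0 < c"
      using fpd_fdet_pos(2)[OF fpd_alpha[OF pd]] fpd_fdet_pos(2)[OF fpd_tail[OF pd]] by (simp_all add: a_def c_def)
    have ab: "a \<le> b" "a = b \<longleftrightarrow> (\<forall>i<s * t. \<forall>j<t. M (t + i) j = 0)"
      using fdet_alpha_le[OF pd] by (simp_all add: a_def b_def)
    have det: "Re (fdet (Suc s * t) M) = a * c" using Re_fdet_schur[OF pd] by (simp add: a_def c_def)
    have prod: "(\<Prod>i<Suc s. Re (fdet t (dblk t i M))) = b * d"
      unfolding prod.lessThan_Suc_shift by (simp add: dblk_0 b_def d_def)
    have "a * c \<le> b * d" using ab(1) IH(1) pos by (intro mult_mono) auto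
    moreover have "a * c = b * d \<longleftrightarrow> a = b \<and> c = d"
      using mult_eq_mono[OF ab(1) IH(1) pos] by auto
    ultimately show ?case unfolding det prod block_diagonal_Suc[OF herm] using ab(2) IH(2) by blast
  qed
  then show "Re (fdet (s * t) M) \<le> (\<Prod>i<s. Re (fdet t (dblk t i M)))"
    and "Re (fdet (s * t) M) = (\<Prod>i<s. Re (fdet t (dblk t i M))) \<longleftrightarrow> block_diagonal s t M" by auto
qed

section \<open>Determinants of tensor differences and their equality case\<close>

context mixed_radix begin

lemma T_div_pos: "p < m \<Longrightarrow> 0 < T div t p"
proof -
  assume p: "p < m"
  have "T = t p * ((\<Prod>q<p. t q) * tprod m t (Suc p))" using T_factor[OF p] by (simp add: mult_ac)
  then have "t p dvd T" by (rule dvdI)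
  then show "0 < T div t p" using tprod_pos[of 0] t_pos[OF p] by (simp add: div_greater_zero_iff dvd_imp_le)
qed

lemma power_T_div_eq_1: "p < m \<Longrightarrow> 0 \<le> r \<Longrightarrow> r ^ (T div t p) = 1 \<longleftrightarrow> (r::real) = 1"
  using T_div_pos[of p] by (metis power_eq_imp_eq_base power_one zero_le_one)

lemma Re_fdet_tens:
  assumes "\<And>p. p < m \<Longrightarrow> fpd (t p) (A p)"
  shows "fdet T (tens A) = of_real (\<Prod>p<m. Re (fdet (t p) (A p)) ^ (T div t p))"
    and "Re (fdet T (tens A)) = (\<Prod>p<m. Re (fdet (t p) (A p)) ^ (T div t p))"
proof -
  show eq: "fdet T (tens A) = of_real (\<Prod>p<m. Re (fdet (t p) (A p)) ^ (T div t p))"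
    unfolding fdet_tens of_real_prod of_real_power
    using fpd_fdet_pos(1) assms by (intro prod.cong refl arg_cong2[where f=power]) auto
  show "Re (fdet T (tens A)) = (\<Prod>p<m. Re (fdet (t p) (A p)) ^ (T div t p))"
    unfolding eq by (simp del: of_real_prod)
qed

text \<open>By \<open>prod_dig\<close>, \<open>y p\<close> is the product of
  \<open>lam p (dig p x)\<close> over all rows x of the tensor product. So
  \<open>union_prob_prod\<close> applies with one column for each such row.\<close>

lemma tens_diff_bound:
  assumes A: "\<And>p. p < m \<Longrightarrow> fpd (t p) (A p)"
    and \<alpha>: "\<And>p. p < m \<Longrightarrow> fpd (t p) (\<lambda>i j. A p i j - B p i j)"
    and B: "\<And>p. p < m \<Longrightarrow> fpsd (t p) (B p)"
  defines "y \<equiv> \<lambda>p. (Re (fdet (t p) (\<lambda>i j. A p i j - B p i j)) / Re (fdet (t p) (A p))) ^ (T div t p)"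
    and "Y \<equiv> Re (fdet T (\<lambda>x y. tens A x y - tens B x y))"
    and "D \<equiv> (\<Prod>p<m. Re (fdet (t p) (A p)) ^ (T div t p))"
  shows "D * (1 - (\<Prod>p<m. 1 - y p)) \<le> Y"
    and "Y = D * (1 - (\<Prod>p<m. 1 - y p)) \<Longrightarrow> 2 \<le> m \<Longrightarrow> (\<And>p. p < m \<Longrightarrow> y p \<noteq> 1) \<Longrightarrow> (\<forall>p<m. t p = 1)"
proof -
  from fdet_tens_diff[OF A \<alpha> B] obtain lam where
    det: "fdet T (\<lambda>x y. tens A x y - tens B x y)
        = fdet T (tens A) * of_real (\<Prod>x<T. 1 - (\<Prod>p<m. 1 - lam p (dig p x)))"
    and lam: "\<And>p k. p < m \<Longrightarrow> k < t p \<Longrightarrow> 0 < lam p k \<and> lam p k \<le> 1"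
    and al: "\<And>p. p < m \<Longrightarrow> Re (fdet (t p) (\<lambda>i j. A p i j - B p i j)) = Re (fdet (t p) (A p)) * (\<Prod>k<t p. lam p k)"
    by auto
  define G where "G = (\<Prod>x<T. 1 - (\<Prod>p<m. 1 - lam p (dig p x)))"
  have "fdet T (tens A) = of_real D"
    unfolding D_def by (rule Re_fdet_tens(1)[OF A])
  then have Y: "Y = D * G" unfolding Y_def det G_def by (simp del: of_real_prod)
  have D: "0 < D" unfolding D_def using fpd_fdet_pos(2)[OF A] by (intro prod_pos) auto
  have y: "y p = (\<Prod>x<T. lam p (dig p x))" if "p < m" for p
    using al[OF that] fpd_fdet_pos(2)[OF A[OF that]] prod_dig[OF that, of "lam p"] by (simp add: y_def)
  have yp: "(\<Prod>p<m. 1 - y p) = (\<Prod>p<m. 1 - (\<Prod>x<T. lam p (dig p x)))" using y by simp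
  have lx: "0 < lam p (dig p x) \<and> lam p (dig p x) \<le> 1" if "p < m" for p x
    using lam dig_less that by simp
  have "1 - (\<Prod>p<m. 1 - y p) \<le> G"
    unfolding yp G_def using lx by (intro union_prob_prod m_pos) auto
  then show "D * (1 - (\<Prod>p<m. 1 - y p)) \<le> Y" unfolding Y using D by simp
  assume eq: "Y = D * (1 - (\<Prod>p<m. 1 - y p))" and m2: "2 \<le> m" and ne: "\<And>p. p < m \<Longrightarrow> y p \<noteq> 1"
  have G: "1 - (\<Prod>p<m. 1 - (\<Prod>x<T. lam p (dig p x))) = G" using eq D unfolding Y yp by simp
  have ex: "\<exists>k<t p. lam p k \<noteq> 1" if "p < m" for p
  proof (rule ccontr)
    assume "\<not> ?thesis"
    then have "lam p (dig p x) = 1" for x using dig_less[OF that] by blast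
    then show False using ne[OF that] y[OF that] by simp
  qed
  show "\<forall>p<m. t p = 1"
  proof (rule ccontr)
    assume "\<not> ?thesis"
    then obtain q where q: "q < m" "1 < t q" using t_pos by force
    obtain p where p: "p < m" "p \<noteq> q"
    proof (cases "q = 0")
      case True then show thesis using m2 that[of 1] by simp
    next
      case False then show thesis using m2 that[of 0] by simp
    qed
    \<comment> \<open>The rows x and x' built next share in factor p an eigenvalue different from 1
      but differ in digit q. They are two columns that are not constantly 1, which equality
      forbids.\<close>
    from ex[OF p(1)] obtain k where k: "k < t p" "lam p k \<noteq> 1" by blast
    have t0: "\<And>r. r < m \<Longrightarrow> 0 < t r" using t_pos by force
    have "\<exists>x<T. \<forall>r<m. dig r x = (if r = p then k else 0)"
      using t0 k by (intro dig_surj) auto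
    then obtain x where x: "x < T" "\<And>r. r < m \<Longrightarrow> dig r x = (if r = p then k else 0)" by blast
    have "\<exists>x<T. \<forall>r<m. dig r x = (if r = p then k else if r = q then 1 else 0)"
      using t0 k q by (intro dig_surj) auto
    then obtain x' where x': "x' < T"
      "\<And>r. r < m \<Longrightarrow> dig r x' = (if r = p then k else if r = q then 1 else 0)" by blast
    have "x \<noteq> x'" using x(2)[OF q(1)] x'(2)[OF q(1)] p(2) by auto
    have "(\<forall>r<m. lam r (dig r x) = 1) \<or> (\<forall>r<m. lam r (dig r x') = 1)"
    proof (rule union_prob_prod_eq[OF m2 lx _ _ x(1) x'(1) \<open>x \<noteq> x'\<close>])
      show "1 - (\<Prod>p<m. 1 - (\<Prod>j<T. lam p (dig p j))) = (\<Prod>j<T. 1 - (\<Prod>p<m. 1 - lam p (dig p j)))"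
        using G by (simp add: G_def)
      fix r assume r: "r < m"
      from ex[OF r] obtain k' where k': "k' < t r" "lam r k' \<noteq> 1" by blast
      have "\<exists>z<T. \<forall>q<m. dig q z = (if q = r then k' else 0)"
        using t0 k' by (intro dig_surj) auto
      then obtain z where "z < T" "dig r z = k'" using r by auto
      then show "\<exists>j<T. lam r (dig r j) \<noteq> 1" using k' by blast
    qed
    then show False using x(2)[OF p(1)] x'(2)[OF p(1)] k p by auto
  qed
qed


subsection \<open>Splitting off the leading blocks\<close>

definition bidx :: "nat \<Rightarrow> nat \<Rightarrow> nat" where
  "bidx p x = (x div T) * t p + dig p (x mod T)"

abbreviation krao :: "(nat \<Rightarrow> cfun) \<Rightarrow> cfun" where "krao \<equiv> hadamard m bidx"

lemma bidx_low: "x < T \<Longrightarrow> bidx p x = dig p x"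
  by (simp add: bidx_def)

lemma bidx_shift: "bidx p (T + x) = t p + bidx p x"
  using tprod_pos[of 0] by (simp add: bidx_def)

lemma bidx_div: "p < m \<Longrightarrow> bidx p x div t p = x div T"
  using dig_less[of p "x mod T"] by (simp add: bidx_def)

lemma bidx_less:
  assumes "p < m" "x < s * T" shows "bidx p x < s * t p"
proof -
  have "x div T < s" using assms(2) by (simp add: less_mult_imp_div_less)
  then have "bidx p x div t p < s" by (simp add: bidx_div[OF assms(1)])
  then show ?thesis using t_pos[OF assms(1)] by (simp add: div_less_iff_less_mult)
qed

lemma bidx_inj:
  assumes "\<And>p. p < m \<Longrightarrow> bidx p x = bidx p y"
  shows "x = y"
proof -
  have "0 < m" using m_pos by simp
  then have d: "x div T = y div T" using assms[of 0] bidx_div[of 0 x] bidx_div[of 0 y] by simp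
  have "dig p (x mod T) = dig p (y mod T)" if "p < m" for p
    using assms[OF that] d by (simp add: bidx_def)
  then have "x mod T = y mod T" by (rule dig_inj) (simp_all add: tprod_pos)
  with d show ?thesis by (metis div_mult_mod_eq)
qed

lemma fpd_krao:
  assumes "\<And>p. p < m \<Longrightarrow> fpd (s * t p) (A p)" shows "fpd (s * T) (krao A)"
proof (rule fpd_hadamard[of m "\<lambda>p. s * t p"])
  show "x = y" if "\<And>p. p < m \<Longrightarrow> bidx p x = bidx p y" for x y by (rule bidx_inj[OF that])
qed (simp_all add: assms bidx_less)

lemma krao_low: "x < T \<Longrightarrow> y < T \<Longrightarrow> krao A x y = tens A x y"
  by (simp add: hadamard_def bidx_low)

lemma krao_tail: "ftail T (krao A) = krao (\<lambda>p. ftail (t p) (A p))"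
  by (simp add: hadamard_def ftail_def bidx_shift fun_eq_iff)

text \<open>Replacing the leading blocks \<open>A p\<close> by \<open>\<beta> p\<close> keeps the matrices positive semidefinite, hence so is
  their Khatri--Rao product; its Schur complement bounds the subtracted term \<open>Z\<close> by the tensor product of the \<open>\<beta> p\<close>.\<close>
lemma krao_peel:
  assumes A: "\<And>p. p < m \<Longrightarrow> fpd (t p + s * t p) (A p)"
    and sch: "\<And>p. p < m \<Longrightarrow> schur (t p) (s * t p) (A p) (V p) (\<beta> p)"
  defines "Y \<equiv> \<lambda>x y. tens A x y - tens \<beta> x y"
  shows "\<exists>E. Re (fdet (T + s * T) (krao A)) = E * Re (fdet (s * T) (krao (\<lambda>p. ftail (t p) (A p))))
    \<and> Re (fdet T Y) \<le> E \<and> 0 < Re (fdet T Y)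
    \<and> (Re (fdet T Y) = E \<longrightarrow> (\<forall>y a. a < T \<longrightarrow> (\<forall>p<m. y p < s * t p)
      \<longrightarrow> (\<forall>x<s * T. \<exists>p<m. bidx p x \<noteq> y p) \<longrightarrow> (\<Prod>p<m. V p (y p) (dig p a)) = 0))"
proof -
  have pdK: "fpd (T + s * T) (krao A)" using fpd_krao[of "Suc s" A] A by simp
  from fpd_schur[OF pdK] obtain VK Z where schK: "schur T (s * T) (krao A) VK Z" .
  interpret K: schur T "s * T" "krao A" VK Z by (rule schK)
  define H where "H = (\<lambda>p i j. if i < t p \<and> j < t p then \<beta> p i j else A p i j)"
  \<comment> \<open>The left inverses \<open>h\<close> serve the equality part, where they isolate
    single rows of \<open>W\<close>.\<close>
  have "\<exists>g h. gram (s * t p) (s * t p) (ftail (t p) (A p)) g \<and> feq (s * t p) (fmult (s * t p) h g) fone"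
    if "p < m" for p by (rule fpd_gram_left_inverse[OF fpd_tail[OF A[OF that]]])
  then obtain g h where g: "\<And>p. p < m \<Longrightarrow> gram (s * t p) (s * t p) (ftail (t p) (A p)) (g p)"
    and h: "\<And>p. p < m \<Longrightarrow> feq (s * t p) (fmult (s * t p) (h p) (g p)) fone" by metis
  define W where "W = (\<lambda>p. schur.W (t p) (V p))"
  define g' where "g' = (\<lambda>p. fmult (s * t p) (g p) (W p))"
  have gH: "gram (s * t p) (t p + s * t p) (H p) (g' p)" if "p < m" for p
    unfolding H_def g'_def W_def by (rule schur.gram_W[OF sch[OF that] g[OF that]])
  have bl: "bidx p x < t p + s * t p" if "p < m" "x < T + s * T" for p x
    using bidx_less[of p x "Suc s"] that by simp
  have hH: "fherm (t p + s * t p) (H p)" if p: "p < m" for p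
  proof (rule fhermI)
    fix i j assume ij: "i < t p + s * t p" "j < t p + s * t p"
    have "fherm (t p + s * t p) (A p)" using A[OF p] by (simp add: fpd_def)
    from fhermD[OF this ij] fhermD[OF schur.herm_beta[OF sch[OF p]], of i j]
    show "H p i j = cnj (H p j i)" by (auto simp: H_def)
  qed
  have nn: "0 \<le> Re (sform (T + s * T) (krao H) v v)" for v
    by (rule hadamard_sform_nonneg[OF gH bl])
  have psdH: "fpsd (T + s * T) (krao H)"
    using nn hH bl by (auto simp: fpsd_def intro!: fherm_hadamard[where n="\<lambda>p. t p + s * t p"])
  have H_low: "krao H x y = tens \<beta> x y" if "x < T" "y < T" for x y
    using that dig_less by (simp add: hadamard_def bidx_low H_def)
  have H_eq: "krao H x y = krao A x y" if "\<not> (x < T \<and> y < T)" for x y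
  proof -
    have "\<not> bidx p x < t p" if "\<not> x < T" "p < m" for x p
    proof -
      have "bidx p (T + (x - T)) = t p + bidx p (x - T)" by (rule bidx_shift)
      then show ?thesis using that by simp
    qed
    then have "\<not> (bidx p x < t p \<and> bidx p y < t p)" if "p < m" for p
      using \<open>\<not> (x < T \<and> y < T)\<close> that by blast
    then show ?thesis unfolding hadamard_def by (intro prod.cong refl) (auto simp: H_def)
  qed
  have tailH: "ftail T (krao H) = ftail T (krao A)"
    by (simp add: ftail_def H_eq fun_eq_iff)
  \<comment> \<open>Replacing the leading blocks leaves the tail and the off-diagonal blocks of the
    Khatri--Rao product unchanged, so \<open>VK\<close> and \<open>Z\<close> serve
    \<open>krao H\<close> as well. Its Schur complement \<open>krao H - Z\<close> is then
    \<open>X - Y\<close>.\<close>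
  interpret H: schur T "s * T" "krao H" VK Z
  proof
    show "fherm (T + s * T) (krao H)" using psdH by (simp add: fpsd_def)
    show "fmult (s * T) (ftail T (krao H)) VK i j = krao H (T + i) j" if "i < s * T" "j < T" for i j
      using K.V[OF that] by (simp add: tailH H_eq)
    show "Z i j = fmult (s * T) (\<lambda>i k. krao H i (T + k)) VK i j" if "i < T" "j < T" for i j
      using K.beta[OF that] by (simp add: H_eq)
  qed
  define X where "X = (\<lambda>i j. krao A i j - Z i j)"
  have pdX: "fpd T X" unfolding X_def by (rule K.fpd_alpha[OF pdK])
  have psd: "fpsd T (\<lambda>i j. krao H i j - Z i j)" by (rule H.fpsd_alpha[OF psdH])
  have XY: "X i j - Y i j = krao H i j - Z i j" if "i < T" "j < T" for i j
    using that by (simp add: X_def Y_def krao_low[of i j A] H_low)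
  have psdXY: "fpsd T (\<lambda>i j. X i j - Y i j)" using fpsd_cong[OF XY] psd by simp
  have pdY: "fpd T Y" unfolding Y_def
  proof (rule fpd_tens_diff)
    fix p assume p: "p < m"
    show "fpd (t p) (\<lambda>i j. A p i j - \<beta> p i j)" by (rule schur.fpd_alpha[OF sch[OF p] A[OF p]])
    show "fherm (t p) (\<beta> p)" by (rule schur.herm_beta[OF sch[OF p]])
    show "gram (s * t p) (t p) (\<beta> p) (g' p)"
      unfolding gram_def
    proof (intro allI impI)
      fix i j assume ij: "i < t p" "j < t p"
      then have "H p i j = (\<Sum>r<s * t p. cnj (g' p r i) * g' p r j)"
        using gH[OF p] unfolding gram_def by (meson trans_less_add1)
      then show "\<beta> p i j = (\<Sum>r<s * t p. cnj (g' p r i) * g' p r j)" using ij by (simp add: H_def)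
    qed
  qed
  have 1: "Re (fdet (T + s * T) (krao A)) = Re (fdet T X) * Re (fdet (s * T) (krao (\<lambda>p. ftail (t p) (A p))))"
    using K.Re_fdet_schur[OF pdK] by (simp add: X_def krao_tail)
  have 2: "Re (fdet T Y) \<le> Re (fdet T X)" by (rule fdet_mono(1)[OF pdX pdY psdXY])
  have 3: "0 < Re (fdet T Y)" by (rule fpd_fdet_pos(2)[OF pdY])
  have 4: "(\<Prod>p<m. V p (y p) (dig p a)) = 0"
    if eq: "Re (fdet T Y) = Re (fdet T X)" and a: "a < T" and y: "\<And>p. p < m \<Longrightarrow> y p < s * t p"
      and nr: "\<And>x. x < s * T \<Longrightarrow> \<exists>p<m. bidx p x \<noteq> y p" for a y
  proof -
    \<comment> \<open>Equality makes the Schur complement of \<open>krao H\<close> zero, so column a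
      of the identity, extended by minus column a of \<open>VK\<close>, is a null vector of its
      form.\<close>
    define v where "v = (\<lambda>i. if i < T then fone i a else - VK (i - T) a)"
    have "fvec T VK v i = VK i a" for i
    proof -
      have "fvec T VK v i = fmult T VK fone i a"
        unfolding fvec_def fmult_def by (intro sum.cong refl) (simp add: v_def)
      then show ?thesis using a by (simp add: fmult_fone_right)
    qed
    then have "sform (T + s * T) (krao H) v v = sform T (\<lambda>i j. krao H i j - Z i j) v v"
      unfolding H.sform_schur by (simp add: v_def sform_def)
    also have "\<dots> = 0"
    proof -
      have "krao H i j - Z i j = 0" if "i < T" "j < T" for i j
        using XY[OF that] fdet_mono(2)[OF pdX pdY psdXY eq that] by simp
      then show ?thesis by (simp add: sform_def)
    qed
    finally have "Re (sform (T + s * T) (krao H) v v) = 0" by simp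
    \<comment> \<open>Weighting by row \<open>y p\<close> of the left inverse turns
      \<open>g' p\<close> into row \<open>y p\<close> of \<open>W p\<close>, that is, of
      \<open>(V, I)\<close>. As the tuple y is not a row of the Khatri--Rao tail, the identity parts
      contribute nothing and the product of entries of \<open>V\<close> is left.\<close>
    from hadamard_sform_zero[OF gH bl this, where h="\<lambda>p. h p (y p)"]
    have z: "(\<Sum>x<T + s * T. v x * (\<Prod>p<m. \<Sum>r<s * t p. h p (y p) r * g' p r (bidx p x))) = 0" by blast
    have hg: "(\<Sum>r<s * t p. h p (y p) r * g' p r b) = W p (y p) b" if p: "p < m" for p b
    proof -
      have "(\<Sum>r<s * t p. h p (y p) r * g' p r b) = fmult (s * t p) (h p) (g' p) (y p) b"
        by (simp add: fmult_def)
      also have "\<dots> = fmult (s * t p) (fmult (s * t p) (h p) (g p)) (W p) (y p) b"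
        by (simp add: g'_def fmult_assoc)
      also have "\<dots> = fmult (s * t p) fone (W p) (y p) b"
        using h[OF p] y[OF p] by (intro fmult_cong refl) (simp add: feq_def)
      finally show ?thesis using y[OF p] by (simp add: fmult_fone_left)
    qed
    have W: "W p (y p) b = (if b < t p then V p (y p) b else fone (y p) (b - t p))" if "p < m" for p b
      unfolding W_def by (rule schur.W_def[OF sch[OF that]])
    have low: "(\<Prod>p<m. W p (y p) (bidx p x)) = (\<Prod>p<m. V p (y p) (dig p x))" if "x < T" for x
      using that dig_less by (intro prod.cong refl) (simp add: W bidx_low)
    have high: "(\<Prod>p<m. W p (y p) (bidx p (T + x))) = 0" if x: "x < s * T" for x
    proof -
      from nr[OF x] obtain p where p: "p < m" "bidx p x \<noteq> y p" by blast
      then have "W p (y p) (bidx p (T + x)) = 0" by (simp add: W bidx_shift fone_def)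
      with p(1) show ?thesis by auto
    qed
    have "0 = (\<Sum>x<T + s * T. v x * (\<Prod>p<m. W p (y p) (bidx p x)))" using z hg by simp
    also have "\<dots> = (\<Sum>x<T. v x * (\<Prod>p<m. V p (y p) (dig p x)))"
    proof -
      have "(\<Sum>x<s * T. v (T + x) * (\<Prod>p<m. W p (y p) (bidx p (T + x)))) = 0"
        by (rule sum.neutral, intro ballI) (simp only: high lessThan_iff mult_zero_right)
      moreover have "(\<Sum>x<T. v x * (\<Prod>p<m. W p (y p) (bidx p x))) = (\<Sum>x<T. v x * (\<Prod>p<m. V p (y p) (dig p x)))"
        by (intro sum.cong refl) (simp only: low lessThan_iff)
      ultimately show ?thesis unfolding sum_lessThan_add by simp
    qed
    also have "\<dots> = fvec T fone (\<lambda>x. \<Prod>p<m. V p (y p) (dig p x)) a"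
      unfolding fvec_def by (intro sum.cong refl) (auto simp: v_def fone_def)
    finally show ?thesis using a by (simp add: fvec_fone)
  qed
  show ?thesis by (rule exI[of _ "Re (fdet T X)"]) (use 1 2 3 4 in blast)
qed


section \<open>Induction on the number of blocks\<close>

definition diag_dets :: "nat \<Rightarrow> (nat \<Rightarrow> cfun) \<Rightarrow> nat \<Rightarrow> real" where
  "diag_dets s A p = (\<Prod>i<s. Re (fdet (t p) (dblk (t p) i (A p))))"

definition det_ratio :: "nat \<Rightarrow> (nat \<Rightarrow> cfun) \<Rightarrow> nat \<Rightarrow> real" where
  "det_ratio s A p = (Re (fdet (s * t p) (A p)) / diag_dets s A p) ^ (T div t p)"

text \<open>The right-hand side of the theorem with the diagonal determinants factored out; the
  second factor is a union probability, ready for \<open>union_prob_mult\<close>.\<close>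

definition krao_bound :: "nat \<Rightarrow> (nat \<Rightarrow> cfun) \<Rightarrow> real" where
  "krao_bound s A = (\<Prod>p<m. diag_dets s A p ^ (T div t p)) * (1 - (\<Prod>p<m. 1 - det_ratio s A p))"

definition single_pair :: "nat \<Rightarrow> (nat \<Rightarrow> cfun) \<Rightarrow> bool" where
  "single_pair s A \<longleftrightarrow> (\<exists>i<s. \<exists>j<s. i \<noteq> j \<and> (\<forall>p<m. \<forall>k<s. \<forall>l<s.
      k \<noteq> l \<and> \<not> (k = i \<and> l = j) \<and> \<not> (k = j \<and> l = i) \<longrightarrow> A p k l = 0))"

lemma diag_dets_pos: "fpd (s * t p) (A p) \<Longrightarrow> 0 < diag_dets s A p"
  unfolding diag_dets_def using fpd_dblk fpd_fdet_pos(2) by (intro prod_pos) blast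

lemma diag_dets_Suc:
  "diag_dets (Suc s) A p = Re (fdet (t p) (A p)) * diag_dets s (\<lambda>p. ftail (t p) (A p)) p"
  unfolding diag_dets_def prod.lessThan_Suc_shift by (simp add: dblk_0 dblk_ftail)

lemma det_ratio_bounds:
  assumes "p < m" "fpd (s * t p) (A p)"
  shows "0 < det_ratio s A p \<and> det_ratio s A p \<le> 1"
    and "det_ratio s A p = 1 \<longleftrightarrow> block_diagonal s (t p) (A p)"
proof -
  let ?r = "Re (fdet (s * t p) (A p)) / diag_dets s A p"
  note d = diag_dets_pos[of s p A, OF assms(2)] and a = fpd_fdet_pos(2)[OF assms(2)]
  have f: "Re (fdet (s * t p) (A p)) \<le> diag_dets s A p"
    "Re (fdet (s * t p) (A p)) = diag_dets s A p \<longleftrightarrow> block_diagonal s (t p) (A p)"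
    using fischer[OF assms(2)] by (simp_all add: diag_dets_def)
  have r: "0 < ?r" "?r \<le> 1" using d a f(1) by auto
  then show "0 < det_ratio s A p \<and> det_ratio s A p \<le> 1"
    unfolding det_ratio_def by (simp add: power_le_one)
  have "det_ratio s A p = 1 \<longleftrightarrow> ?r = 1"
    unfolding det_ratio_def using r by (intro power_T_div_eq_1 assms(1)) simp
  also have "\<dots> \<longleftrightarrow> Re (fdet (s * t p) (A p)) = diag_dets s A p" using d by auto
  finally show "det_ratio s A p = 1 \<longleftrightarrow> block_diagonal s (t p) (A p)" using f(2) by simp
qed

text \<open>With blocks of size 1 and diagonal tails, \<open>A p (Suc i) 0\<close> is a multiple of
  \<open>V p i 0\<close>. By \<open>ker\<close> the entries of \<open>V\<close> along any tuple that
  is not constant in p have product 0. Every factor has a nonzero entry and there are at least two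
  factors, so all nonzero entries sit at one common index.\<close>

lemma single_pair_of_kernel:
  assumes one: "\<And>p. p < m \<Longrightarrow> t p = 1" and m2: "2 \<le> m"
    and pd: "\<And>p. p < m \<Longrightarrow> fpd (t p + s * t p) (A p)"
    and sch: "\<And>p. p < m \<Longrightarrow> schur (t p) (s * t p) (A p) (V p) (\<beta> p)"
    and bd: "\<And>p. p < m \<Longrightarrow> block_diagonal s (t p) (ftail (t p) (A p))"
    and ne: "\<And>p. p < m \<Longrightarrow> \<exists>i<s * t p. \<exists>j<t p. A p (t p + i) j \<noteq> 0"
    and ker: "\<And>y a. a < T \<Longrightarrow> (\<And>p. p < m \<Longrightarrow> y p < s * t p)
      \<Longrightarrow> (\<And>x. x < s * T \<Longrightarrow> \<exists>p<m. bidx p x \<noteq> y p) \<Longrightarrow> (\<Prod>p<m. V p (y p) (dig p a)) = 0"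
  shows "single_pair (Suc s) A"
proof -
  have T1: "T = 1" using one by (simp add: tprod_def)
  have dig0: "dig p a = 0" if "p < m" for p a using dig_less[OF that, of a] one[OF that] by simp
  have bidx: "bidx p x = x" if "p < m" for p x
    using dig0[OF that] one[OF that] T1 by (simp add: bidx_def)
  have V: "fmult s (ftail 1 (A p)) (V p) i 0 = A p (Suc i) 0" if "p < m" "i < s" for p i
    using schur.V[OF sch[OF that(1)], of i 0] one[OF that(1)] that(2) by simp
  have low: "A p (Suc i) 0 = ftail 1 (A p) i i * V p i 0" if p: "p < m" and i: "i < s" for p i
  proof -
    have off: "ftail 1 (A p) i l = 0" if "l < s" "l \<noteq> i" for l
    proof -
      have "ftail (t p) (A p) (i * t p + 0) (l * t p + 0) = 0"
        using bd[OF p, unfolded block_diagonal_def, rule_format, of i l 0 0] that i one[OF p] by simp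
      then show ?thesis using one[OF p] by simp
    qed
    have "fmult s (ftail 1 (A p)) (V p) i 0 = (\<Sum>k<s. if k = i then ftail 1 (A p) i i * V p i 0 else 0)"
      unfolding fmult_def using off by (intro sum.cong refl) auto
    then show ?thesis using V[OF p i] i by simp
  qed
  have exV: "\<exists>i<s. V p i 0 \<noteq> 0" if p: "p < m" for p
  proof -
    from ne[OF p] obtain i where "i < s" "A p (Suc i) 0 \<noteq> 0" using one[OF p] by auto
    then show ?thesis using low[OF p, of i] by auto
  qed
  then obtain l where l: "\<And>p. p < m \<Longrightarrow> l p < s" "\<And>p. p < m \<Longrightarrow> V p (l p) 0 \<noteq> 0" by metis
  have same: "i = j" if pq: "p < m" "q < m" "p \<noteq> q" and ij: "i < s" "j < s"
    and V0: "V p i 0 \<noteq> 0" "V q j 0 \<noteq> 0" for p q i j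
  proof (rule ccontr)
    assume "i \<noteq> j"
    \<comment> \<open>A tuple that is not constant, since i and j differ, but along which all
      entries of \<open>V\<close> are nonzero.\<close>
    define y where "y = l(p := i, q := j)"
    have "(\<Prod>p<m. V p (y p) (dig p 0)) = 0"
    proof (rule ker)
      show "0 < T" by (simp add: T1)
      show "y r < s * t r" if "r < m" for r using l(1)[OF that] one[OF that] ij by (simp add: y_def)
      show "\<exists>r<m. bidx r x \<noteq> y r" for x
      proof (cases "x = i")
        case True
        then have "bidx q x \<noteq> y q" using bidx[OF pq(2)] \<open>i \<noteq> j\<close> by (simp add: y_def)
        then show ?thesis using pq by blast
      next
        case False
        then have "bidx p x \<noteq> y p" using bidx[OF pq(1)] pq(3) by (simp add: y_def)
        then show ?thesis using pq by blast
      qed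
    qed
    moreover have "V r (y r) (dig r 0) \<noteq> 0" if "r < m" for r
      using l(2)[OF that] V0 dig0[OF that] by (simp add: y_def)
    ultimately show False by auto
  qed
  define j where "j = l 0"
  have m0: "0 < m" "1 < m" using m2 by auto
  have lj: "l p = j" if "p < m" for p
    using same[of p 0 "l p" j] l that m0 unfolding j_def by (cases "p = 0") auto
  have Vj: "i = j" if p: "p < m" and i: "i < s" "V p i 0 \<noteq> 0" for p i
  proof -
    obtain q where q: "q < m" "q \<noteq> p" using m0 by (metis zero_neq_one)
    show ?thesis using same[of p q i "l q"] l lj[OF q(1)] p q i by auto
  qed
  have js: "j < s" using l(1) m0 by (simp add: j_def)
  have lowz: "A p (Suc i) 0 = 0" if "p < m" "i < s" "i \<noteq> j" for p i
    using low[OF that(1,2)] Vj[OF that(1,2)] that(3) by auto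
  have "A p k k' = 0" if p: "p < m" and k: "k < Suc s" "k' < Suc s"
    and c: "k \<noteq> k' \<and> \<not> (k = 0 \<and> k' = Suc j) \<and> \<not> (k = Suc j \<and> k' = 0)" for p k k'
  proof (cases k)
    case 0
    then obtain i where i: "k' = Suc i" using c by (cases k') auto
    have "fherm (Suc s) (A p)" using pd[OF p] one[OF p] by (simp add: fpd_def)
    from fhermD[OF this k] show ?thesis using lowz[OF p, of i] 0 i c k by simp
  next
    case (Suc i)
    show ?thesis
    proof (cases k')
      case 0
      then show ?thesis using lowz[OF p, of i] Suc c k by simp
    next
      case (Suc i')
      have "ftail (t p) (A p) (i * t p + 0) (i' * t p + 0) = 0"
        using bd[OF p, unfolded block_diagonal_def, rule_format, of i i' 0 0] one[OF p] k c Suc \<open>k = Suc i\<close> by simp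
      then show ?thesis using one[OF p] Suc \<open>k = Suc i\<close> by (simp add: ftail_def)
    qed
  qed
  then show ?thesis unfolding single_pair_def using js by (intro exI[of _ 0] exI[of _ "Suc j"] conjI) auto
qed

text \<open>In the induction step, \<open>D\<close> and \<open>D'\<close> collect the diagonal
  determinants of the first and of the remaining blocks, \<open>G\<close> and \<open>G'\<close> the
  probability factors. Peeling gives \<open>E * C\<close>, at least
  \<open>D * G * (D' * G')\<close>; merging the ratios replaces \<open>G' * G\<close> by the smaller
  \<open>G''\<close>. Equality therefore passes to each factor, in particular to the induction
  hypothesis.\<close>

lemma krao_inequality:
  assumes "\<And>p. p < m \<Longrightarrow> fpd (s * t p) (A p)"
  shows "krao_bound s A \<le> Re (fdet (s * T) (krao A)) \<and>
    (Re (fdet (s * T) (krao A)) = krao_bound s A \<longrightarrow> 2 \<le> m \<longrightarrow>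
      (\<exists>p<m. block_diagonal s (t p) (A p)) \<or> ((\<forall>p<m. t p = 1) \<and> single_pair s A))"
  using assms
proof (induction s arbitrary: A)
  case 0
  \<comment> \<open>Without blocks the determinant and all ratios are 1, and factor 0 is vacuously
    block diagonal.\<close>
  have "det_ratio 0 A p = 1" for p by (simp add: det_ratio_def diag_dets_def fdet_0)
  moreover have "\<exists>p<m. block_diagonal 0 (t p) (A p)"
    using m_pos by (intro exI[of _ 0]) (simp add: block_diagonal_def)
  ultimately show ?case using m_pos by (auto simp: krao_bound_def diag_dets_def fdet_0 power_0_left)
next
  case (Suc s)
  have A: "fpd (t p + s * t p) (A p)" if "p < m" for p using Suc.prems[OF that] by simp
  have "\<exists>V \<beta>. schur (t p) (s * t p) (A p) V \<beta>" if "p < m" for p using fpd_schur[OF A[OF that]] by blast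
  then obtain V \<beta> where sch: "\<And>p. p < m \<Longrightarrow> schur (t p) (s * t p) (A p) (V p) (\<beta> p)" by metis
  define A' where "A' = (\<lambda>p. ftail (t p) (A p))"
  have A': "fpd (s * t p) (A' p)" if "p < m" for p unfolding A'_def by (rule fpd_tail[OF A[OF that]])
  define C where "C = Re (fdet (s * T) (krao A'))"
  have IH: "krao_bound s A' \<le> C"
    "C = krao_bound s A' \<Longrightarrow> 2 \<le> m \<Longrightarrow>
      (\<exists>p<m. block_diagonal s (t p) (A' p)) \<or> ((\<forall>p<m. t p = 1) \<and> single_pair s A')"
    using Suc.IH[OF A'] by (auto simp: C_def)
  define Y where "Y = Re (fdet T (\<lambda>x y. tens A x y - tens \<beta> x y))"
  from krao_peel[OF A sch] obtain E where E: "Re (fdet (T + s * T) (krao A)) = E * C" "Y \<le> E" "0 < Y"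
    and ker: "Y = E \<longrightarrow> (\<forall>y a. a < T \<longrightarrow> (\<forall>p<m. y p < s * t p)
      \<longrightarrow> (\<forall>x<s * T. \<exists>p<m. bidx p x \<noteq> y p) \<longrightarrow> (\<Prod>p<m. V p (y p) (dig p a)) = 0)"
    unfolding Y_def C_def A'_def by blast
  define y where "y = (\<lambda>p. (Re (fdet (t p) (\<lambda>i j. A p i j - \<beta> p i j)) / Re (fdet (t p) (A p))) ^ (T div t p))"
  define D where "D = (\<Prod>p<m. Re (fdet (t p) (A p)) ^ (T div t p))"
  have head: "fpd (t p) (A p)" if "p < m" for p by (rule fpd_head[OF A[OF that]])
  have al: "fpd (t p) (\<lambda>i j. A p i j - \<beta> p i j)" if "p < m" for p
    by (rule schur.fpd_alpha[OF sch[OF that] A[OF that]])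
  have be: "fpsd (t p) (\<beta> p)" if "p < m" for p
    by (rule schur.fpsd_beta[OF sch[OF that] fpd_imp_fpsd[OF fpd_tail[OF A[OF that]]]])
  have tb1: "D * (1 - (\<Prod>p<m. 1 - y p)) \<le> Y"
    unfolding y_def D_def Y_def by (rule tens_diff_bound(1)[OF head al be])
  have tb2: "\<forall>p<m. t p = 1" if "Y = D * (1 - (\<Prod>p<m. 1 - y p))" "2 \<le> m" "\<And>p. p < m \<Longrightarrow> y p \<noteq> 1"
    by (rule tens_diff_bound(2)[OF head al be]) (use that in \<open>simp_all add: y_def D_def Y_def\<close>)
  define x' where "x' = det_ratio s A'"
  define D' where "D' = (\<Prod>p<m. diag_dets s A' p ^ (T div t p))"
  define G where "G = 1 - (\<Prod>p<m. 1 - y p)"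
  define G' where "G' = 1 - (\<Prod>p<m. 1 - x' p)"
  define G'' where "G'' = 1 - (\<Prod>p<m. 1 - x' p * y p)"
  have DY: "D * G \<le> Y" using tb1 by (simp add: G_def)
  have bC: "D' * G' \<le> C" using IH(1) by (simp add: krao_bound_def D'_def G'_def x'_def)
  have y1: "0 < y p \<and> y p \<le> 1" and y_eq: "y p = 1 \<longleftrightarrow> (\<forall>i<s * t p. \<forall>j<t p. A p (t p + i) j = 0)"
    if p: "p < m" for p
  proof -
    let ?a = "Re (fdet (t p) (\<lambda>i j. A p i j - \<beta> p i j))" and ?b = "Re (fdet (t p) (A p))"
    have pos: "0 < ?a" "0 < ?b" using fpd_fdet_pos(2) al head p by auto
    note le = schur.fdet_alpha_le[OF sch[OF p] A[OF p]]
    have r: "0 < ?a / ?b" "?a / ?b \<le> 1" using pos le(1) by auto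
    then show "0 < y p \<and> y p \<le> 1" by (simp add: y_def power_le_one)
    have "y p = 1 \<longleftrightarrow> ?a / ?b = 1" unfolding y_def using r by (intro power_T_div_eq_1 p) simp
    also have "\<dots> \<longleftrightarrow> ?a = ?b" using pos by auto
    finally show "y p = 1 \<longleftrightarrow> (\<forall>i<s * t p. \<forall>j<t p. A p (t p + i) j = 0)" using le(2) by simp
  qed
  have x1: "0 < x' p \<and> x' p \<le> 1" and x_eq: "x' p = 1 \<longleftrightarrow> block_diagonal s (t p) (A' p)" if p: "p < m" for p
    unfolding x'_def using det_ratio_bounds[OF p, of s A'] A'[OF p] by auto
  have Gpos: "0 < G" "0 < G'" 
    unfolding G_def G'_def by (rule union_prob_pos[OF m_pos y1], simp, rule union_prob_pos[OF m_pos x1], simp)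
  have Dpos: "0 < D" unfolding D_def using fpd_fdet_pos(2) head by (intro prod_pos) auto
  have D'pos: "0 < D'" unfolding D'_def using diag_dets_pos A' by (intro prod_pos) auto
  have GG: "G'' \<le> G' * G"
    unfolding G_def G'_def G''_def using x1 y1 by (intro union_prob_mult) (auto simp: less_imp_le)
  have ratio: "det_ratio (Suc s) A p = x' p * y p" if p: "p < m" for p
  proof -
    have "Re (fdet (Suc s * t p) (A p))
        = Re (fdet (t p) (\<lambda>i j. A p i j - \<beta> p i j)) * Re (fdet (s * t p) (A' p))"
      using schur.Re_fdet_schur[OF sch[OF p] A[OF p]] by (simp add: A'_def)
    then show ?thesis
      by (simp add: det_ratio_def x'_def y_def diag_dets_Suc A'_def power_mult_distrib power_divide mult.commute)
  qed
  have bound: "krao_bound (Suc s) A = D * D' * G''"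
    by (simp add: krao_bound_def ratio G''_def diag_dets_Suc D_def D'_def A'_def power_mult_distrib prod.distrib)
  have det: "Re (fdet (Suc s * T) (krao A)) = E * C" using E(1) by simp
  have EC: "D * G * (D' * G') \<le> E * C" using DY E(2,3) bC Gpos Dpos D'pos by (intro mult_mono) auto
  have "D * D' * G'' \<le> D * D' * (G' * G)" using GG Dpos D'pos by (intro mult_left_mono) auto
  also have "\<dots> = D * G * (D' * G')" by simp
  finally have le: "D * D' * G'' \<le> D * G * (D' * G')" .
  have "(\<exists>p<m. block_diagonal (Suc s) (t p) (A p)) \<or> ((\<forall>p<m. t p = 1) \<and> single_pair (Suc s) A)"
    if eq: "E * C = D * D' * G''" and m2: "2 \<le> m"
  proof -
    have e1: "D * G * (D' * G') = E * C" and e2: "D * D' * G'' = D * G * (D' * G')"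
      using eq EC le by linarith+
    have "D * G = E" "D' * G' = C"
      using mult_eq_mono[OF order_trans[OF DY E(2)] bC _ _ e1] Gpos Dpos D'pos by auto
    then have YE: "Y = E" and YG: "Y = D * G" using DY E(2) by auto
    have CG: "C = krao_bound s A'"
      using \<open>D' * G' = C\<close> by (simp add: krao_bound_def D'_def G'_def x'_def)
    have "G'' = G' * G" using e2 Dpos D'pos by simp
    then have cases: "m \<le> 1 \<or> (\<exists>p<m. x' p = 1 \<and> y p = 1) \<or> (\<forall>p<m. x' p = 1) \<or> (\<forall>p<m. y p = 1)"
      using x1 y1 unfolding G_def G'_def G''_def by (intro union_prob_mult_eq) auto
    have bdS: "block_diagonal (Suc s) (t p) (A p)" if "p < m" "x' p = 1" "y p = 1" for p
    proof -
      have "fherm (t p + s * t p) (A p)" using A[OF that(1)] by (simp add: fpd_def)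
      then show ?thesis
        using block_diagonal_Suc x_eq[OF that(1)] y_eq[OF that(1)] that by (simp add: A'_def)
    qed
    show ?thesis
    proof (cases "\<exists>p<m. x' p = 1 \<and> y p = 1")
      case True
      then show ?thesis using bdS by blast
    next
      case False
      \<comment> \<open>Either all first blocks decouple and the equality case of the tails carries
        over, or all tails are block diagonal while no first block decouples. Then
        \<open>tb2\<close> gives blocks of size 1 and \<open>ker\<close> gives the common
        pair.\<close>
      with cases m2 consider "\<forall>p<m. y p = 1" | "\<forall>p<m. x' p = 1" by fastforce
      then show ?thesis
      proof cases
        case 1
        from IH(2)[OF CG m2] show ?thesis
        proof
          assume "\<exists>p<m. block_diagonal s (t p) (A' p)"
          then show ?thesis using x_eq 1 False by blast
        next
          assume sp: "(\<forall>p<m. t p = 1) \<and> single_pair s A'"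
          then obtain i j where ij: "i < s" "j < s" "i \<noteq> j" and
            z: "\<And>p k l. p < m \<Longrightarrow> k < s \<Longrightarrow> l < s \<Longrightarrow> k \<noteq> l \<and> \<not> (k = i \<and> l = j) \<and> \<not> (k = j \<and> l = i)
              \<Longrightarrow> A' p k l = 0"
            unfolding single_pair_def by blast
          have "A p k l = 0" if p: "p < m" and kl: "k < Suc s" "l < Suc s"
            and c: "k \<noteq> l \<and> \<not> (k = Suc i \<and> l = Suc j) \<and> \<not> (k = Suc j \<and> l = Suc i)" for p k l
          proof -
            have t1: "t p = 1" using sp p by blast
            have low: "A p (Suc k) 0 = 0" if "k < s" for k
              using y_eq[OF p] 1 p that t1 by simp
            have h: "fherm (Suc s) (A p)" using A[OF p] t1 by (simp add: fpd_def)
            show ?thesis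
            proof (cases k)
              case 0
              then obtain l' where "l = Suc l'" using c by (cases l) auto
              then show ?thesis using fhermD[OF h kl] low[of l'] 0 kl by simp
            next
              case k: (Suc k')
              show ?thesis
              proof (cases l)
                case 0 then show ?thesis using low[of k'] k kl by simp
              next
                case (Suc l')
                then show ?thesis using z[OF p, of k' l'] k kl c t1 by (simp add: A'_def ftail_def)
              qed
            qed
          qed
          then have "single_pair (Suc s) A" unfolding single_pair_def using ij
            by (intro exI[of _ "Suc i"] exI[of _ "Suc j"] conjI) auto
          then show ?thesis using sp by blast
        qed
      next
        case 2
        then have yne: "\<And>p. p < m \<Longrightarrow> y p \<noteq> 1" using False by blast
        have t1: "\<forall>p<m. t p = 1" by (rule tb2) (use YG m2 yne in \<open>simp_all add: G_def\<close>)
        have "single_pair (Suc s) A"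
        proof (rule single_pair_of_kernel[OF _ m2 A sch])
          show "t p = 1" if "p < m" for p using t1 that by blast
          show "block_diagonal s (t p) (ftail (t p) (A p))" if "p < m" for p
            using x_eq[OF that] 2 that by (simp add: A'_def)
          show "\<exists>i<s * t p. \<exists>j<t p. A p (t p + i) j \<noteq> 0" if "p < m" for p
            using y_eq[OF that] yne[OF that] by blast
          show "(\<Prod>p<m. V p (y p) (dig p a)) = 0"
            if "a < T" "\<And>p. p < m \<Longrightarrow> y p < s * t p" "\<And>x. x < s * T \<Longrightarrow> \<exists>p<m. bidx p x \<noteq> y p" for y a
            using ker YE that by blast
        qed
        then show ?thesis using t1 by blast
      qed
    qed
  qed
  then show ?case unfolding bound det using le EC by auto
qed

end

subsection \<open>Matrices of the statement\<close>

lemma mod_mult_div_mod: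
  fixes x a b c :: nat
  assumes "0 < a" shows "(x mod (a * b * c)) div a mod b = x div a mod b"
  using assms unfolding mult.assoc mod_mult2_eq by (simp add: mod_mod_cancel)

lemma kron_list_index:
  assumes "k \<le> m" and t: "\<And>p. p < m \<Longrightarrow> 1 \<le> t p" and M: "\<And>p. p < m \<Longrightarrow> M p \<in> carrier_mat (t p) (t p)"
  shows "kron_list (map M [k..<m]) \<in> carrier_mat (tprod m t k) (tprod m t k) \<and>
    (\<forall>x<tprod m t k. \<forall>y<tprod m t k. kron_list (map M [k..<m]) $$ (x, y)
      = (\<Prod>p\<in>{k..<m}. M p $$ (digit m t p x, digit m t p y)))"
  using assms(1)
proof (induction k rule: inc_induct)
  case base
  show ?case by (simp add: kron_list_def tprod_def)
next
  case (step k)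
  let ?T = "tprod m t (Suc k)"
  define L where "L = kron_list (map M [Suc k..<m])"
  have L: "L \<in> carrier_mat ?T ?T"
    and Li: "\<And>x y. x < ?T \<Longrightarrow> y < ?T \<Longrightarrow> L $$ (x, y) = (\<Prod>p\<in>{Suc k..<m}. M p $$ (digit m t p x, digit m t p y))"
    using step.IH by (auto simp: L_def)
  have eq: "kron_list (map M [k..<m]) = kron (M k) L"
    using step.hyps(2) by (simp add: upt_conv_Cons kron_list_def L_def)
  have Tk: "tprod m t k = t k * ?T" using tprod_rec[OF step.hyps(2)] by (simp add: mult.commute)
  have Tpos: "0 < tprod m t q" for q unfolding tprod_def using t by (intro prod_pos) force
  have dM: "dim_row (M k) = t k" "dim_col (M k) = t k" using M[OF step.hyps(2)] by auto
  have dL: "dim_row L = ?T" "dim_col L = ?T" using L by auto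
  \<comment> \<open>The place value times the radix of digit p divides \<open>?T\<close>, so
    reduction modulo \<open>?T\<close> does not change that digit.\<close>
  have dig: "digit m t p (x mod ?T) = digit m t p x" if p: "p \<in> {Suc k..<m}" for p x
  proof -
    have "{Suc k..<m} = {Suc k..<p} \<union> {p..<m}" using p by auto
    then have "?T = (\<Prod>q\<in>{Suc k..<p}. t q) * tprod m t p"
      unfolding tprod_def by (subst prod.union_disjoint[symmetric]) auto
    also have "\<dots> = tprod m t (Suc p) * t p * (\<Prod>q\<in>{Suc k..<p}. t q)"
      using p by (simp add: tprod_rec mult.commute)
    finally have "?T = tprod m t (Suc p) * t p * (\<Prod>q\<in>{Suc k..<p}. t q)" .
    then show ?thesis unfolding digit_def by (metis mod_mult_div_mod Tpos)
  qed
  have "kron (M k) L $$ (x, y) = (\<Prod>p\<in>{k..<m}. M p $$ (digit m t p x, digit m t p y))"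
    if xy: "x < tprod m t k" "y < tprod m t k" for x y
  proof -
    have d: "digit m t k z = z div ?T" if "z < tprod m t k" for z
      using that Tpos[of "Suc k"] by (simp add: digit_def Tk less_mult_imp_div_less)
    have "kron (M k) L $$ (x, y) = M k $$ (x div ?T, y div ?T) * L $$ (x mod ?T, y mod ?T)"
      using xy by (simp add: kron_def dM dL Tk)
    also have "L $$ (x mod ?T, y mod ?T) = (\<Prod>p\<in>{Suc k..<m}. M p $$ (digit m t p x, digit m t p y))"
      using Li[of "x mod ?T" "y mod ?T"] Tpos by (simp add: dig)
    finally show ?thesis
      using step.hyps(2) d xy by (simp add: prod.atLeast_Suc_lessThan)
  qed
  moreover have "kron (M k) L \<in> carrier_mat (tprod m t k) (tprod m t k)"
    by (simp add: kron_def dM dL Tk)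
  ultimately show ?case unfolding eq by blast
qed

abbreviation (input) entries :: "complex mat \<Rightarrow> cfun" where
  "entries A \<equiv> \<lambda>i j. A $$ (i, j)"

lemma (in mixed_radix) khatri_rao_eq_krao:
  "khatri_rao m s t A = fmat (s * T) (krao (\<lambda>p. entries (A p)))"
proof -
  have T: "(\<Prod>q<m. t q) = T" by (simp add: tprod_def lessThan_atLeast0)
  have "kron_list (map (\<lambda>p. blk (A p) (t p) (x div T) (y div T)) [0..<m]) $$ (x mod T, y mod T)
      = krao (\<lambda>p. entries (A p)) x y" for x y
  proof -
    have "kron_list (map (\<lambda>p. blk (A p) (t p) (x div T) (y div T)) [0..<m]) $$ (x mod T, y mod T)
      = (\<Prod>p\<in>{0..<m}. blk (A p) (t p) (x div T) (y div T) $$ (dig p (x mod T), dig p (y mod T)))"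
      using kron_list_index[of 0 m t "\<lambda>p. blk (A p) (t p) (x div T) (y div T)"] t_pos tprod_pos[of 0]
      by (simp add: blk_def)
    also have "\<dots> = krao (\<lambda>p. entries (A p)) x y"
      unfolding hadamard_def lessThan_atLeast0 using dig_less
      by (intro prod.cong refl) (simp add: blk_def bidx_def)
    finally show ?thesis .
  qed
  then show ?thesis unfolding khatri_rao_def Let_def T fmat_def by simp
qed

lemma scalar_prod_sform:
  assumes A: "A \<in> carrier_mat n n"
  shows "conjugate (vec n v) \<bullet> (A *\<^sub>v vec n v) = sform n (entries A) v v"
proof -
  have "conjugate (vec n v) \<bullet> (A *\<^sub>v vec n v) = (\<Sum>i<n. cnj (v i) * (A *\<^sub>v vec n v) $ i)"
    using A by (simp add: scalar_prod_def lessThan_atLeast0 conjugate_complex_def)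
  also have "\<dots> = (\<Sum>i<n. cnj (v i) * fvec n (entries A) v i)"
    using A by (intro sum.cong refl) (simp add: scalar_prod_def fvec_def lessThan_atLeast0)
  finally show ?thesis by (simp add: sform_fvec)
qed

lemma hermitian_mat_fherm: "A \<in> carrier_mat n n \<Longrightarrow> hermitian_mat A \<longleftrightarrow> fherm n (entries A)"
  unfolding hermitian_mat_def fherm_def by auto

lemma psd_mat_fpsd: "psd_mat n A \<Longrightarrow> fpsd n (entries A)"
  unfolding psd_mat_def fpsd_def
  using scalar_prod_sform[of A n] hermitian_mat_fherm[of A n] by (metis vec_carrier)

lemma pd_mat_fpd:
  assumes "pd_mat n A" shows "fpd n (entries A)"
proof -
  from assms have A: "A \<in> carrier_mat n n" "hermitian_mat A"
    and pos: "\<And>v. v \<in> carrier_vec n \<Longrightarrow> v \<noteq> 0\<^sub>v n \<Longrightarrow> 0 < Re (conjugate v \<bullet> (A *\<^sub>v v))"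
    by (auto simp: pd_mat_def)
  have "0 < Re (sform n (entries A) v v)" if v: "\<exists>i<n. v i \<noteq> 0" for v
  proof -
    have "vec n v \<noteq> 0\<^sub>v n"
    proof
      assume "vec n v = 0\<^sub>v n"
      then have "vec n v $ i = 0" if "i < n" for i using that by simp
      then show False using v by auto
    qed
    then show ?thesis using pos[of "vec n v"] scalar_prod_sform[OF A(1)] by simp
  qed
  then show ?thesis using A hermitian_mat_fherm by (simp add: fpd_def)
qed

text \<open>By the Leibniz formula the determinant is a polynomial in the entries.\<close>

lemma tendsto_fdet:
  assumes "\<And>i j. ((\<lambda>e. M e i j) \<longlongrightarrow> L i j) F"
  shows "((\<lambda>e. fdet n (M e)) \<longlongrightarrow> fdet n L) F"
  unfolding fdet_leibniz by (intro tendsto_intros assms)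

text \<open>A permutation that moves indices only within the pair is the identity or the
  transposition of i and j. Every other one meets a vanishing entry, so two Leibniz terms
  survive.\<close>

lemma fdet_single_pair:
  assumes ij: "i < s" "j < s" "i \<noteq> j"
    and z: "\<And>k l. k < s \<Longrightarrow> l < s \<Longrightarrow> k \<noteq> l \<Longrightarrow> \<not> (k = i \<and> l = j) \<Longrightarrow> \<not> (k = j \<and> l = i) \<Longrightarrow> M k l = 0"
  shows "fdet s M = (\<Prod>k<s. M k k) - M i j * M j i * (\<Prod>k\<in>{..<s} - {i, j}. M k k)"
proof -
  let ?\<tau> = "Transposition.transpose i j"
  let ?f = "\<lambda>\<pi>. signof \<pi> * (\<Prod>k=0..<s. M k (\<pi> k)) :: complex"
  have perm: "?\<tau> permutes {0..<s}" using ij by (intro permutes_swap_id) auto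
  have "fdet s M = sum ?f {\<pi>. \<pi> permutes {0..<s}}" by (rule fdet_leibniz)
  also have "\<dots> = sum ?f {id, ?\<tau>}"
  proof (rule sum.mono_neutral_right)
    show "finite {\<pi>. \<pi> permutes {0..<s}}" by (rule finite_permutations) simp
    show "{id, ?\<tau>} \<subseteq> {\<pi>. \<pi> permutes {0..<s}}" using perm permutes_id by auto
    show "\<forall>\<pi>\<in>{\<pi>. \<pi> permutes {0..<s}} - {id, ?\<tau>}. ?f \<pi> = 0"
    proof
      fix \<pi> assume "\<pi> \<in> {\<pi>. \<pi> permutes {0..<s}} - {id, ?\<tau>}"
      then have \<pi>: "\<pi> permutes {0..<s}" and ne: "\<pi> \<noteq> id" "\<pi> \<noteq> ?\<tau>" by auto
      have inj: "\<pi> a = \<pi> b \<Longrightarrow> a = b" for a b using permutes_inj[OF \<pi>] by (simp add: inj_eq)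
      have "\<exists>k<s. \<pi> k \<noteq> k \<and> \<not> (k = i \<and> \<pi> k = j) \<and> \<not> (k = j \<and> \<pi> k = i)"
      proof (rule ccontr)
        assume "\<not> ?thesis"
        then have c: "\<pi> k = k \<or> (k = i \<and> \<pi> k = j) \<or> (k = j \<and> \<pi> k = i)" for k
          using permutes_not_in[OF \<pi>, of k] by (cases "k < s") auto
        show False
        proof (cases "\<pi> i = i")
          case True
          then have "\<pi> k = k" for k using c[of k] inj[of k i] by auto
          then have "\<pi> = id" by (simp add: fun_eq_iff)
          with ne show False by simp
        next
          case False
          then have i: "\<pi> i = j" using c[of i] by auto
          then have j: "\<pi> j = i" using c[of j] inj[of i j] ij(3) by auto
          have "\<pi> k = ?\<tau> k" for k using i j c[of k] by (auto simp: Transposition.transpose_def)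
          then have "\<pi> = ?\<tau>" by (simp add: fun_eq_iff)
          with ne show False by simp
        qed
      qed
      then obtain k where k: "k < s" "\<pi> k \<noteq> k" "\<not> (k = i \<and> \<pi> k = j)" "\<not> (k = j \<and> \<pi> k = i)" by blast
      have "\<pi> k < s" using permutes_in_image[OF \<pi>, of k] k(1) by simp
      then have "M k (\<pi> k) = 0" using z[OF k(1), of "\<pi> k"] k by simp
      then have "(\<Prod>k=0..<s. M k (\<pi> k)) = 0" using k(1) by (intro prod_zero) auto
      then show "?f \<pi> = 0" by simp
    qed
  qed
  also have "\<dots> = ?f id + ?f ?\<tau>"
  proof -
    have "?\<tau> i \<noteq> id i" using ij(3) by simp
    then have "id \<noteq> ?\<tau>" by metis
    then show ?thesis by simp
  qed
  also have "?f id = (\<Prod>k<s. M k k)" by (simp add: lessThan_atLeast0)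
  also have "?f ?\<tau> = - (M i j * M j i * (\<Prod>k\<in>{..<s} - {i, j}. M k k))"
  proof -
    have "(\<Prod>k<s. M k (?\<tau> k)) = M i (?\<tau> i) * (M j (?\<tau> j) * (\<Prod>k\<in>{..<s} - {i} - {j}. M k (?\<tau> k)))"
      using ij by (simp add: prod.remove[of "{..<s}" i] prod.remove[of "{..<s} - {i}" j])
    also have "(\<Prod>k\<in>{..<s} - {i} - {j}. M k (?\<tau> k)) = (\<Prod>k\<in>{..<s} - {i, j}. M k k)"
      by (intro prod.cong) (auto simp: Transposition.transpose_def)
    finally show ?thesis using ij(3) by (simp add: lessThan_atLeast0 sign_swap_id)
  qed
  finally show ?thesis by simp
qed

context mixed_radix begin

subsection \<open>Equality cases\<close>

text \<open>Free of division, unlike \<open>krao_bound\<close>: it is continuous in the entries and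
  so passes to semidefinite limits, where diagonal determinants may vanish.\<close>

definition lower_bound :: "nat \<Rightarrow> (nat \<Rightarrow> cfun) \<Rightarrow> real" where
  "lower_bound s A = (\<Prod>p<m. \<Prod>i<s. Re (fdet (t p) (dblk (t p) i (A p))) ^ (T div t p))
    - (\<Prod>p<m. (\<Prod>i<s. Re (fdet (t p) (dblk (t p) i (A p))) ^ (T div t p)) - Re (fdet (s * t p) (A p)) ^ (T div t p))"

lemma lower_bound_diag_dets:
  "lower_bound s A = (\<Prod>p<m. diag_dets s A p ^ (T div t p))
    - (\<Prod>p<m. diag_dets s A p ^ (T div t p) - Re (fdet (s * t p) (A p)) ^ (T div t p))"
  by (simp add: lower_bound_def diag_dets_def prod_power_distrib)

lemma lower_bound_krao_bound:
  assumes "\<And>p. p < m \<Longrightarrow> fpd (s * t p) (A p)"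
  shows "lower_bound s A = krao_bound s A"
proof -
  have "diag_dets s A p ^ (T div t p) - Re (fdet (s * t p) (A p)) ^ (T div t p)
      = diag_dets s A p ^ (T div t p) * (1 - det_ratio s A p)" if "p < m" for p
    using diag_dets_pos[of s p A] assms[OF that] by (simp add: det_ratio_def power_divide right_diff_distrib)
  then have "(\<Prod>p<m. diag_dets s A p ^ (T div t p) - Re (fdet (s * t p) (A p)) ^ (T div t p))
      = (\<Prod>p<m. diag_dets s A p ^ (T div t p) * (1 - det_ratio s A p))" by (intro prod.cong) auto
  then show ?thesis
    unfolding lower_bound_diag_dets krao_bound_def prod.distrib by (simp add: algebra_simps)
qed

text \<open>One block diagonal factor makes the Khatri--Rao product block diagonal, so Fischer's
  inequality is an equality for both. For the factor this makes one of the subtracted differences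
  zero.\<close>

lemma equality_block_diagonal:
  assumes A: "\<And>p. p < m \<Longrightarrow> fpd (s * t p) (A p)" and p: "p < m" "block_diagonal s (t p) (A p)"
  shows "Re (fdet (s * T) (krao A)) = lower_bound s A"
proof -
  have shift: "bidx q (i * T + x) = i * t q + dig q x" if "x < T" for q i x
    using that by (simp add: bidx_def)
  have "block_diagonal s T (krao A)"
    unfolding block_diagonal_def
  proof (intro allI impI)
    fix i j x y assume "i < s" "j < s" "i \<noteq> j" "x < T" "y < T"
    then have "A p (bidx p (i * T + x)) (bidx p (j * T + y)) = 0"
      using p(2) dig_less[OF p(1)] by (simp add: shift block_diagonal_def)
    then show "krao A (i * T + x) (j * T + y) = 0" using p(1) by (auto simp: hadamard_def)
  qed
  then have "Re (fdet (s * T) (krao A)) = (\<Prod>i<s. Re (fdet T (dblk T i (krao A))))"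
    using fischer(2)[OF fpd_krao[OF A]] by simp
  also have "\<dots> = (\<Prod>i<s. \<Prod>p<m. Re (fdet (t p) (dblk (t p) i (A p))) ^ (T div t p))"
  proof (intro prod.cong refl)
    fix i assume "i \<in> {..<s}"
    then have i: "i < s" by simp
    have "fdet T (dblk T i (krao A)) = fdet T (tens (\<lambda>p. dblk (t p) i (A p)))"
      by (intro fdet_cong) (simp add: dblk_def hadamard_def shift)
    then show "Re (fdet T (dblk T i (krao A))) = (\<Prod>p<m. Re (fdet (t p) (dblk (t p) i (A p))) ^ (T div t p))"
      using Re_fdet_tens(2)[of "\<lambda>p. dblk (t p) i (A p)"] fpd_dblk[OF A i] by simp
  qed
  also have "\<dots> = (\<Prod>p<m. \<Prod>i<s. Re (fdet (t p) (dblk (t p) i (A p))) ^ (T div t p))" by (rule prod.swap)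
  also have "\<dots> = lower_bound s A"
  proof -
    have "Re (fdet (s * t p) (A p)) = diag_dets s A p"
      using fischer(2)[OF A[OF p(1)]] p(2) by (simp add: diag_dets_def)
    then have "(\<Prod>p<m. diag_dets s A p ^ (T div t p) - Re (fdet (s * t p) (A p)) ^ (T div t p)) = 0"
      using p(1) by (intro prod_zero bexI[of _ p]) auto
    then show ?thesis by (simp add: lower_bound_diag_dets diag_dets_def prod_power_distrib)
  qed
  finally show ?thesis .
qed

text \<open>With one factor \<open>bidx\<close> is the identity, so \<open>krao A\<close> is
  \<open>A 0\<close>, and the bound collapses to its determinant.\<close>

lemma equality_single_factor:
  assumes "m = 1" shows "Re (fdet (s * T) (krao A)) = lower_bound s A"
proof -
  have T: "T = t 0" using assms by (simp add: tprod_def)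
  have t0: "0 < t 0" using t_pos[of 0] assms by simp
  have "bidx 0 x = x" for x using t0 by (simp add: bidx_def T digit_def) (simp add: assms tprod_def T)
  then have "krao A = A 0" using assms by (simp add: hadamard_def fun_eq_iff)
  then show ?thesis using t0 by (simp add: lower_bound_diag_dets T) (simp add: assms)
qed

text \<open>Each determinant is the diagonal product minus a correction \<open>c p\<close>. Diagonal
  products and corrections are both multiplicative over the factors, and \<open>c p\<close> is
  exactly the difference subtracted in the bound.\<close>

lemma equality_single_pair:
  assumes A: "\<And>p. p < m \<Longrightarrow> fpd (s * t p) (A p)" and one: "\<And>p. p < m \<Longrightarrow> t p = 1" and sp: "single_pair s A"
  shows "Re (fdet (s * T) (krao A)) = lower_bound s A"
proof -
  have T1: "T = 1" using one by (simp add: tprod_def)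
  have bidx: "bidx p x = x" if "p < m" for p x
    using dig_less[OF that, of "x mod T"] one[OF that] T1 by (simp add: bidx_def)
  have K: "krao A x y = (\<Prod>p<m. A p x y)" for x y by (simp add: hadamard_def bidx)
  from sp obtain i j where ij: "i < s" "j < s" "i \<noteq> j" and
    z: "\<And>p k l. p < m \<Longrightarrow> k < s \<Longrightarrow> l < s \<Longrightarrow> k \<noteq> l \<and> \<not> (k = i \<and> l = j) \<and> \<not> (k = j \<and> l = i) \<Longrightarrow> A p k l = 0"
    unfolding single_pair_def by blast
  define c where "c = (\<lambda>p. A p i j * A p j i * (\<Prod>k\<in>{..<s} - {i, j}. A p k k))"
  have detA: "fdet s (A p) = (\<Prod>k<s. A p k k) - c p" if "p < m" for p
    unfolding c_def using z[OF that] by (intro fdet_single_pair ij) auto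
  have detK: "fdet s (krao A) = (\<Prod>k<s. \<Prod>p<m. A p k k) - (\<Prod>p<m. c p)"
  proof -
    have "fdet s (krao A) = (\<Prod>k<s. krao A k k) - krao A i j * krao A j i * (\<Prod>k\<in>{..<s} - {i, j}. krao A k k)"
    proof (rule fdet_single_pair[OF ij])
      fix k l assume "k < s" "l < s" "k \<noteq> l" "\<not> (k = i \<and> l = j)" "\<not> (k = j \<and> l = i)"
      then have "A 0 k l = 0" using z[of 0 k l] m_pos by simp
      then show "krao A k l = 0" unfolding K using m_pos by (intro prod_zero) (auto intro!: bexI[of _ 0])
    qed
    also have "krao A i j * krao A j i * (\<Prod>k\<in>{..<s} - {i, j}. krao A k k) = (\<Prod>p<m. c p)"
      unfolding K c_def prod.distrib by (simp add: prod.swap[of _ "{..<m}"])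
    also have "(\<Prod>k<s. krao A k k) = (\<Prod>k<s. \<Prod>p<m. A p k k)" by (simp add: K)
    finally show ?thesis .
  qed
  have diag: "A p k k = of_real (Re (fdet (t p) (dblk (t p) k (A p))))" if p: "p < m" and k: "k < s" for p k
  proof -
    have "fdet (t p) (dblk (t p) k (A p)) = A p k k"
      using fdet_upper_triangular[of 1 "dblk 1 k (A p)"] one[OF p] by (simp add: dblk_def)
    then show ?thesis using fpd_fdet_pos(1)[OF fpd_dblk[OF A[OF p] k]] by simp
  qed
  have d: "(\<Prod>k<s. A p k k) = of_real (diag_dets s A p)" if "p < m" for p
    unfolding diag_dets_def of_real_prod using diag[OF that] by (intro prod.cong refl) simp
  have c: "c p = of_real (diag_dets s A p - Re (fdet (s * t p) (A p)))" if p: "p < m" for p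
  proof -
    have "fdet (s * t p) (A p) = of_real (diag_dets s A p) - c p" using detA[OF p] d[OF p] one[OF p] by simp
    moreover have "fdet (s * t p) (A p) = of_real (Re (fdet (s * t p) (A p)))" by (rule fpd_fdet_pos(1)[OF A[OF p]])
    ultimately show ?thesis by (simp add: algebra_simps)
  qed
  have "(\<Prod>k<s. \<Prod>p<m. A p k k) = (\<Prod>p<m. \<Prod>k<s. A p k k)" by (rule prod.swap)
  also have "\<dots> = of_real (\<Prod>p<m. diag_dets s A p)" using d by simp
  finally have "fdet s (krao A) = of_real ((\<Prod>p<m. diag_dets s A p) - (\<Prod>p<m. diag_dets s A p - Re (fdet (s * t p) (A p))))"
    using c by (simp add: detK)
  then have "Re (fdet s (krao A)) = (\<Prod>p<m. diag_dets s A p) - (\<Prod>p<m. diag_dets s A p - Re (fdet (s * t p) (A p)))"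
    by (simp only: Re_complex_of_real)
  then show ?thesis using one T1 by (simp add: lower_bound_diag_dets)
qed

lemma inequality_psd:
  assumes A: "\<And>p. p < m \<Longrightarrow> fpsd (s * t p) (A p)"
  shows "lower_bound s A \<le> Re (fdet (s * T) (krao A))"
proof -
  \<comment> \<open>Adding e times the identity makes all factors definite; the inequality is then
    carried to the limit as e tends to 0 from the right.\<close>
  define B where "B = (\<lambda>e p i j. complex_of_real e * fone i j + A p i j)"
  have pd: "fpd (s * t p) (B e p)" if e: "0 < e" and p: "p < m" for e p
  proof -
    have "sform (s * t p) (\<lambda>i j. complex_of_real e * fone i j) v v = of_real e * sform (s * t p) fone v v" for v
      unfolding sform_def sum_distrib_left by (intro sum.cong refl) simp
    moreover have "0 < e * Re (sform (s * t p) fone v v)" if "\<exists>i<s * t p. v i \<noteq> 0" for v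
      using fpd_fone[of "s * t p"] e that by (simp add: fpd_def)
    moreover have "fherm (s * t p) (\<lambda>i j. complex_of_real e * fone i j)"
      by (rule fhermI) (simp add: fone_def)
    ultimately have "fpd (s * t p) (\<lambda>i j. complex_of_real e * fone i j)"
      unfolding fpd_def by simp
    then show ?thesis unfolding B_def by (rule fpd_add_fpsd[OF _ A[OF p]])
  qed
  have lim: "((\<lambda>e. B e p i j) \<longlongrightarrow> A p i j) (at_right 0)" for p i j
  proof -
    have "((\<lambda>e. complex_of_real e * fone i j + A p i j) \<longlongrightarrow> complex_of_real 0 * fone i j + A p i j) (at_right 0)"
      by (intro tendsto_intros)
    then show ?thesis by (simp add: B_def)
  qed
  have 1: "((\<lambda>e. Re (fdet (s * T) (krao (B e)))) \<longlongrightarrow> Re (fdet (s * T) (krao A))) (at_right 0)"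
    unfolding hadamard_def[abs_def] by (intro tendsto_intros tendsto_fdet lim)
  have 2: "((\<lambda>e. lower_bound s (B e)) \<longlongrightarrow> lower_bound s A) (at_right 0)"
    unfolding lower_bound_def dblk_def by (intro tendsto_intros tendsto_fdet lim)
  have "\<forall>\<^sub>F e in at_right 0. lower_bound s (B e) \<le> Re (fdet (s * T) (krao (B e)))"
  proof (rule eventually_at_right_less[THEN eventually_mono])
    fix e :: real assume "0 < e"
    then show "lower_bound s (B e) \<le> Re (fdet (s * T) (krao (B e)))"
      using krao_inequality[of s "B e"] lower_bound_krao_bound[of s "B e"] pd by simp
  qed
  then show ?thesis by (intro tendsto_le[OF _ 1 2]) simp_all
qed

lemma equality_pd:
  assumes A: "\<And>p. p < m \<Longrightarrow> fpd (s * t p) (A p)"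
  shows "Re (fdet (s * T) (krao A)) = lower_bound s A \<longleftrightarrow>
    m = 1 \<or> (\<exists>p<m. block_diagonal s (t p) (A p)) \<or> ((\<forall>p<m. t p = 1) \<and> single_pair s A)"
proof
  assume "Re (fdet (s * T) (krao A)) = lower_bound s A"
  then have "Re (fdet (s * T) (krao A)) = krao_bound s A" using lower_bound_krao_bound[OF A] by simp
  then show "m = 1 \<or> (\<exists>p<m. block_diagonal s (t p) (A p)) \<or> ((\<forall>p<m. t p = 1) \<and> single_pair s A)"
    using krao_inequality[OF A] m_pos by (cases "m = 1") auto
next
  assume "m = 1 \<or> (\<exists>p<m. block_diagonal s (t p) (A p)) \<or> ((\<forall>p<m. t p = 1) \<and> single_pair s A)"
  then show "Re (fdet (s * T) (krao A)) = lower_bound s A"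
    using equality_single_factor[of s A] equality_block_diagonal[OF A] equality_single_pair[OF A] by blast
qed

end

lemma block_diagonal_blk:
  "block_diagonal s t (entries A) \<longleftrightarrow> (\<forall>i<s. \<forall>j<s. i \<noteq> j \<longrightarrow> blk A t i j = 0\<^sub>m t t)"
proof -
  have "blk A t i j = 0\<^sub>m t t \<longleftrightarrow> (\<forall>a<t. \<forall>b<t. A $$ (i * t + a, j * t + b) = 0)" for i j
  proof
    assume eq: "blk A t i j = 0\<^sub>m t t"
    show "\<forall>a<t. \<forall>b<t. A $$ (i * t + a, j * t + b) = 0"
    proof (intro allI impI)
      fix a b assume "a < t" "b < t"
      then have "blk A t i j $$ (a, b) = 0" unfolding eq by simp
      then show "A $$ (i * t + a, j * t + b) = 0" using \<open>a < t\<close> \<open>b < t\<close> by (simp add: blk_def)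
    qed
  next
    assume "\<forall>a<t. \<forall>b<t. A $$ (i * t + a, j * t + b) = 0"
    then show "blk A t i j = 0\<^sub>m t t" by (intro eq_matI) (auto simp: blk_def)
  qed
  then show ?thesis by (simp add: block_diagonal_def)
qed

theorem mainTheorem1:
  fixes m s :: nat and t :: "nat \<Rightarrow> nat" and A :: "nat \<Rightarrow> complex mat"
  assumes "m \<ge> 1" and "s \<ge> 1"
    and "\<forall>p<m. t p \<ge> 1"
    and "\<forall>p<m. psd_mat (s * t p) (A p)"
  defines "\<sigma> \<equiv> (\<lambda>p. (\<Prod>q<m. t q) div t p)"
  defines "R \<equiv> (\<Prod>p<m. \<Prod>i<s. Re (det (blk (A p) (t p) i i)) ^ \<sigma> p)
              - (\<Prod>p<m. (\<Prod>i<s. Re (det (blk (A p) (t p) i i)) ^ \<sigma> p) - Re (det (A p)) ^ \<sigma> p)"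
  shows "Re (det (khatri_rao m s t A)) \<ge> R
    \<and> ((\<forall>p<m. pd_mat (s * t p) (A p)) \<longrightarrow>
        (Re (det (khatri_rao m s t A)) = R \<longleftrightarrow>
          (m = 1 \<or> s = 1
           \<or> (\<exists>p<m. \<forall>i<s. \<forall>j<s. i \<noteq> j \<longrightarrow> blk (A p) (t p) i j = 0\<^sub>m (t p) (t p))
           \<or> ((\<forall>p<m. t p = 1) \<and>
               (\<exists>i<s. \<exists>j<s. i \<noteq> j \<and>
                  (\<forall>p<m. \<forall>k<s. \<forall>l<s. k \<noteq> l \<and> \<not> (k = i \<and> l = j) \<and> \<not> (k = j \<and> l = i)
                      \<longrightarrow> A p $$ (k, l) = 0))))))"
proof -
  interpret mixed_radix m t using assms(1,3) by unfold_locales auto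
  let ?A = "\<lambda>p. entries (A p)"
  have T: "(\<Prod>q<m. t q) = T" by (simp add: tprod_def lessThan_atLeast0)
  have detA: "det (A p) = fdet (s * t p) (?A p)" if "p < m" for p
    using assms(4) that fmat_of_mat[of "A p" "s * t p"] by (simp add: fdet_def psd_mat_def)
  have detB: "det (blk (A p) (t p) i i) = fdet (t p) (dblk (t p) i (?A p))" for p i
    by (simp add: fdet_def fmat_def blk_def dblk_def)
  have R: "R = lower_bound s ?A"
    unfolding R_def lower_bound_def \<sigma>_def T detB
    using detA by (intro arg_cong2[where f="(-)"] prod.cong refl) auto
  have K: "det (khatri_rao m s t A) = fdet (s * T) (krao ?A)"
    by (simp add: khatri_rao_eq_krao fdet_def)
  have ineq: "R \<le> Re (det (khatri_rao m s t A))"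
    unfolding R K using assms(4) by (intro inequality_psd psd_mat_fpsd) auto
  \<comment> \<open>With one block there is nothing off the diagonal, so the case s = 1 is absorbed
    into block diagonality of factor 0.\<close>
  have s1: "\<exists>p<m. block_diagonal s (t p) (?A p)" if "s = 1"
    using assms(1) that by (intro exI[of _ 0]) (auto simp: block_diagonal_def)
  have "Re (det (khatri_rao m s t A)) = R \<longleftrightarrow>
      m = 1 \<or> (\<exists>p<m. block_diagonal s (t p) (?A p)) \<or> ((\<forall>p<m. t p = 1) \<and> single_pair s ?A)"
    if "\<forall>p<m. pd_mat (s * t p) (A p)"
    unfolding R K using that by (intro equality_pd pd_mat_fpd) auto
  then show ?thesis
    using ineq s1 unfolding block_diagonal_blk single_pair_def by blast
qed

end
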